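(* Let $\mathbb{F}$ be an arbitrary field, let $G$ be an abelian group, and let $G^\#=\mathbb{Z}\times G$. Let $n=n_1+\dots+n_s$ with all $n_i\ge 1$, let $U(\mathscr{F})=UT(n_1,\ldots,n_s)\subset M_n(\mathbb{F})$ be the associative algebra of upper block-triangular matrices, and write $M_n=M_n(\mathbb{F})$. The mapping that sends an admissible $G^\#$-grading $M_n=\bigoplus_{(m,g)\in G^\#}A_{(m,g)}$ to the $G$-grading $U(\mathscr{F})=\bigoplus_{g\in G}B_g$, $B_g=\bigoplus_{m\ge 0}A_{(m,g)}$ (restriction to $U(\mathscr{F})$ followed by coarsening along the projection $G^\#\to G$), yields a bijection between the admissible isomorphism classes of $G^\#$-gradings on the associative algebra $M_n$ and the isomorphism classes of $G$-gradings on the associative algebra $U(\mathscr{F})$.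
   Context: A $G$-grading on an algebra $A$ is a vector space decomposition $A=\bigoplus_{g\in G}A_g$ with $A_gA_h\subset A_{gh}$ for all $g,h\in G$. Two $G$-gradings $A=\bigoplus_g A_g=\bigoplus_g A'_g$ are isomorphic if there is an algebra automorphism $\psi$ of $A$ with $\psi(A_g)=A'_g$ for all $g$. For a group homomorphism $\alpha:G\to H$, the coarsening induced by $\alpha$ is the $H$-grading with components $A'_h=\bigoplus_{g\in\alpha^{-1}(h)}A_g$. $UT(n_1,\ldots,n_s)$ is the algebra of $n\times n$ matrices that are upper block-triangular with diagonal blocks of sizes $n_1,\ldots,n_s$. For $m\in\mathbb{Z}$, $J_m\subset M_n$ is the $m$-th block-diagonal: the span of the matrix units $E_{ij}$ lying in blocks of block-position $(q,q+m)$, with $1\le q\le s$ and $1\le q+m\le s$ ($J_m=0$ if $|m|\ge s$). The natural $\mathbb{Z}$-grading of $U(\mathscr{F})$ is $U(\mathscr{F})=\bigoplus_{m\ge0}J_m$. A $G^\#$-grading on $M_n$ is admissible if, with respect to the $\mathbb{Z}$-grading on $M_n$ obtained as the coarsening induced by the projection $G^\#\to\mathbb{Z}$, the algebra $U(\mathscr{F})$ with its natural $\mathbb{Z}$-grading is a graded subalgebra of $M_n$ (i.e. $J_m$ is contained in the component of degree $m$ for every $m\ge 0$). An isomorphism class of $G^\#$-gradings on $M_n$ is admissible if it contains an admissible grading. *)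

theory Defs
  imports Jordan_Normal_Form.Matrix "HOL-Library.Product_Plus"
begin

text \<open>
  All algebras considered are sets of \<open>n \<times> n\<close> matrices over a field. The abelian grading
  groups are types of class \<^class>\<open>ab_group_add\<close>, hence written additively; \<open>int \<times> 'g\<close> carries the
  componentwise structure of the direct product \<open>\<int> \<times> G\<close>.
\<close>

definition mat_subspace :: "nat \<Rightarrow> 'a::field mat set \<Rightarrow> bool" where
  "mat_subspace n V \<longleftrightarrow>
     V \<subseteq> carrier_mat n n \<and> 0\<^sub>m n n \<in> V \<and>
     (\<forall>x\<in>V. \<forall>y\<in>V. x + y \<in> V) \<and> (\<forall>c. \<forall>x\<in>V. c \<cdot>\<^sub>m x \<in> V)"

definition mat_sum :: "nat \<Rightarrow> ('g \<Rightarrow> 'a::field mat) \<Rightarrow> 'g set \<Rightarrow> 'a mat" where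
  "mat_sum n f K = finsum (module_mat TYPE('a) n n) f K"

text \<open>The sum \<open>\<Sum>\<^sub>g\<^sub>\<in>\<^sub>I A\<^sub>g\<close> of a possibly infinite family of subspaces.\<close>

definition subspace_sum :: "nat \<Rightarrow> ('g \<Rightarrow> 'a::field mat set) \<Rightarrow> 'g set \<Rightarrow> 'a mat set" where
  "subspace_sum n A I =
     {mat_sum n f K | f K. finite K \<and> K \<subseteq> I \<and> (\<forall>g\<in>K. f g \<in> A g)}"

definition independent_family :: "nat \<Rightarrow> ('g \<Rightarrow> 'a::field mat set) \<Rightarrow> bool" where
  "independent_family n A \<longleftrightarrow>
     (\<forall>f K. finite K \<longrightarrow> (\<forall>g\<in>K. f g \<in> A g) \<longrightarrow> mat_sum n f K = 0\<^sub>m n n \<longrightarrow>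
        (\<forall>g\<in>K. f g = 0\<^sub>m n n))"

definition is_grading ::
  "nat \<Rightarrow> 'a::field mat set \<Rightarrow> ('g::ab_group_add \<Rightarrow> 'a mat set) \<Rightarrow> bool" where
  "is_grading n S A \<longleftrightarrow>
     (\<forall>g. mat_subspace n (A g)) \<and>
     subspace_sum n A UNIV = S \<and> independent_family n A \<and>
     (\<forall>g h. \<forall>x\<in>A g. \<forall>y\<in>A h. x * y \<in> A (g + h))"

definition gradings :: "nat \<Rightarrow> 'a::field mat set \<Rightarrow> ('g::ab_group_add \<Rightarrow> 'a mat set) set" where
  "gradings n S = {A. is_grading n S A}"

definition algebra_automorphism :: "'a::field mat set \<Rightarrow> ('a mat \<Rightarrow> 'a mat) \<Rightarrow> bool" where
  "algebra_automorphism S \<psi> \<longleftrightarrow>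
     bij_betw \<psi> S S \<and>
     (\<forall>x\<in>S. \<forall>y\<in>S. \<psi> (x + y) = \<psi> x + \<psi> y) \<and>
     (\<forall>c. \<forall>x\<in>S. \<psi> (c \<cdot>\<^sub>m x) = c \<cdot>\<^sub>m \<psi> x) \<and>
     (\<forall>x\<in>S. \<forall>y\<in>S. \<psi> (x * y) = \<psi> x * \<psi> y)"

definition grading_iso ::
  "nat \<Rightarrow> 'a::field mat set \<Rightarrow>
   (('g::ab_group_add \<Rightarrow> 'a mat set) \<times> ('g \<Rightarrow> 'a mat set)) set" where
  "grading_iso n S =
     {(A, A'). A \<in> gradings n S \<and> A' \<in> gradings n S \<and>
        (\<exists>\<psi>. algebra_automorphism S \<psi> \<and> (\<forall>g. \<psi> ` A g = A' g))}"

definition coarsening ::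
  "nat \<Rightarrow> ('g \<Rightarrow> 'h) \<Rightarrow> ('g \<Rightarrow> 'a::field mat set) \<Rightarrow> 'h \<Rightarrow> 'a mat set" where
  "coarsening n \<alpha> A h = subspace_sum n A (\<alpha> -` {h})"

text \<open>
  The block containing the row (or column) index \<open>i < sum_list ns\<close>, where \<open>ns\<close> lists the sizes
  of the diagonal blocks. Both indices and blocks are counted from \<open>0\<close>.
\<close>

definition block_of :: "nat list \<Rightarrow> nat \<Rightarrow> nat" where
  "block_of ns i = (LEAST q. i < sum_list (take (Suc q) ns))"

definition UT :: "nat list \<Rightarrow> 'a::field mat set" where
  "UT ns = {x \<in> carrier_mat (sum_list ns) (sum_list ns).
     \<forall>i<sum_list ns. \<forall>j<sum_list ns. block_of ns j < block_of ns i \<longrightarrow> x $$ (i, j) = 0}"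

text \<open>
  The span of the matrix units \<open>E\<^sub>i\<^sub>j\<close> lying in blocks \<open>(q, q + m)\<close> consists of the matrices
  all of whose other entries vanish; it is zero for \<open>\<bar>m\<bar> \<ge> length ns\<close>.
\<close>

definition block_diagonal :: "nat list \<Rightarrow> int \<Rightarrow> 'a::field mat set" where
  "block_diagonal ns m = {x \<in> carrier_mat (sum_list ns) (sum_list ns).
     \<forall>i<sum_list ns. \<forall>j<sum_list ns.
       int (block_of ns j) \<noteq> int (block_of ns i) + m \<longrightarrow> x $$ (i, j) = 0}"

definition admissible ::
  "nat list \<Rightarrow> (int \<times> 'g::ab_group_add \<Rightarrow> 'a::field mat set) \<Rightarrow> bool" where
  "admissible ns A \<longleftrightarrow>
     A \<in> gradings (sum_list ns) (carrier_mat (sum_list ns) (sum_list ns)) \<and>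
     (\<forall>m\<ge>0. block_diagonal ns m \<subseteq> coarsening (sum_list ns) fst A m)"

definition admissible_classes ::
  "nat list \<Rightarrow> (int \<times> 'g::ab_group_add \<Rightarrow> 'a::field mat set) set set" where
  "admissible_classes ns =
     {C \<in> gradings (sum_list ns) (carrier_mat (sum_list ns) (sum_list ns)) //
          grading_iso (sum_list ns) (carrier_mat (sum_list ns) (sum_list ns)).
        \<exists>A\<in>C. admissible ns A}"

definition restrict_coarsen ::
  "nat \<Rightarrow> (int \<times> 'g \<Rightarrow> 'a::field mat set) \<Rightarrow> 'g \<Rightarrow> 'a mat set" where
  "restrict_coarsen n A g = subspace_sum n A {(m, g) | m. m \<ge> 0}"

end

theory Submission
  imports Defs "Jordan_Normal_Form.Determinant"
begin

text \<open>
  Let \<open>e q\<close> be the identity matrix of the diagonal block \<open>q\<close>. In an admissible grading the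
  components of the \<open>\<int>\<close>-coarsening are exactly the block diagonals \<open>\<Delta> m\<close>, so the grading is the
  common refinement of the block diagonals and of a \<open>G\<close>-grading \<open>D\<close> of the full matrix algebra \<open>M\<close>
  in which all \<open>e q\<close> have degree zero (\<open>compatible_iff\<close>, \<open>compatible_std\<close>). Conversely each such
  \<open>D\<close> has an admissible refinement (\<open>grading_refine\<close>). The theorem thus compares
  \<open>G\<close>-gradings of \<open>M\<close> with \<open>G\<close>-gradings of the algebra \<open>U\<close> of block-triangular matrices, and it
  rests on two facts.

  First, every \<open>G\<close>-grading of \<open>U\<close> extends to exactly one \<open>G\<close>-grading of \<open>M\<close> (\<open>ext_grading\<close>,
  \<open>extension_unique\<close>). The radical \<open>J\<close> is the largest left ideal of \<open>U\<close> on which the traces of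
  all diagonal blocks vanish; since it consists of sums of commutators and commutators of homogeneous
  elements are homogeneous, it is graded over every field (\<open>J_graded\<close>). Hence the first block row
  \<open>L\<close>, the annihilator of \<open>J\<close> in \<open>U\<close>, is graded. It is a right ideal of \<open>M\<close>, and \<open>M\<close> is the algebra of all
  endomorphisms of \<open>L\<close> that commute with the left action of \<open>U\<close>. As \<open>L\<close> is finite-dimensional, such
  an endomorphism is the sum of its homogeneous components, which commute with \<open>U\<close> again.

  Secondly, let \<open>T q\<close> be the left ideal of \<open>M\<close> generated by \<open>e q + e (q + 1) + \<dots>\<close>. The flag of these
  left ideals is determined by \<open>J\<close> (\<open>T_step\<close>), so it is graded and is preserved by automorphisms of
  \<open>U\<close>. The degree-zero component of a right identity of a graded left ideal is again a right identity;
  this gives a chain of idempotents of degree zero that splits the flag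
  (\<open>homogeneous_splitting\<close>), and any two splittings are conjugate by an explicit matrix
  (\<open>splitting_conjugate\<close>).

  Surjectivity: after conjugating the extension of a grading of \<open>U\<close>, its splitting of degree zero
  becomes the standard one given by the \<open>e q\<close>. Injectivity: an isomorphism of restrictions is conjugation
  by a matrix (\<open>automorphism_inner\<close>), which maps the extensions to each other by uniqueness and moves the
  \<open>e q\<close> to another splitting of degree zero. The matrix conjugating this splitting back has degree zero,
  so the correction leaves the \<open>G\<close>-grading unchanged and makes the isomorphism respect the block diagonals.
\<close>

section \<open>Square matrices\<close>

text \<open>Fixing the size \<open>n\<close> turns the laws of matrix algebra into rewrite rules whose only side
  conditions are memberships in the set \<open>M\<close> of \<open>n \<times> n\<close> matrices.\<close>

locale square_matrices =
  fixes n :: nat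
begin

abbreviation M :: "'a::field mat set" where "M \<equiv> carrier_mat n n"
abbreviation \<O> :: "'a::field mat" where "\<O> \<equiv> 0\<^sub>m n n"

lemma mat_eqI:
  assumes "x \<in> M" "y \<in> M" "\<And>i j. i < n \<Longrightarrow> j < n \<Longrightarrow> x $$ (i, j) = y $$ (i, j)"
  shows "x = y"
  using assms by (intro eq_matI) auto

lemma entry_simps [simp]:
  assumes "x \<in> M" "y \<in> M" "i < n" "j < n"
  shows "(x + y) $$ (i, j) = x $$ (i, j) + y $$ (i, j)"
    "(x - y) $$ (i, j) = x $$ (i, j) - y $$ (i, j)"
  using assms by auto

lemma smult_entry [simp]: "x \<in> M \<Longrightarrow> i < n \<Longrightarrow> j < n \<Longrightarrow> (c \<cdot>\<^sub>m x) $$ (i, j) = c * x $$ (i, j)"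
  by auto

lemma mult_closed [simp]: "x \<in> M \<Longrightarrow> y \<in> M \<Longrightarrow> x * y \<in> M"
  by simp

lemma minus_closed [simp]: "x \<in> M \<Longrightarrow> y \<in> M \<Longrightarrow> x - y \<in> M"
  by (simp add: minus_carrier_mat)

lemma mult_index:
  "x \<in> M \<Longrightarrow> y \<in> M \<Longrightarrow> i < n \<Longrightarrow> j < n \<Longrightarrow>
   (x * y) $$ (i, j) = (\<Sum>k<n. x $$ (i, k) * y $$ (k, j))"
  by (auto simp: scalar_prod_def atLeast0LessThan intro!: sum.cong)

lemma mult_assoc:
  "x \<in> M \<Longrightarrow> y \<in> M \<Longrightarrow> z \<in> M \<Longrightarrow> (x * y) * z = x * (y * z)"
  by simp

lemma mult_zero_one [simp]:
  "x \<in> M \<Longrightarrow> x * \<O> = \<O>" "x \<in> M \<Longrightarrow> \<O> * x = \<O>"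
  "x \<in> M \<Longrightarrow> x * 1\<^sub>m n = x" "x \<in> M \<Longrightarrow> 1\<^sub>m n * x = x"
  by auto

lemma distrib_right: "x \<in> M \<Longrightarrow> y \<in> M \<Longrightarrow> z \<in> M \<Longrightarrow> (x + y) * z = x * z + y * z"
  by (rule add_mult_distrib_mat)

lemma distrib_left: "x \<in> M \<Longrightarrow> y \<in> M \<Longrightarrow> z \<in> M \<Longrightarrow> x * (y + z) = x * y + x * z"
  by (rule mult_add_distrib_mat)

lemma diff_right: "x \<in> M \<Longrightarrow> y \<in> M \<Longrightarrow> z \<in> M \<Longrightarrow> (x - y) * z = x * z - y * z"
  by (rule minus_mult_distrib_mat)

lemma diff_left: "x \<in> M \<Longrightarrow> y \<in> M \<Longrightarrow> z \<in> M \<Longrightarrow> x * (y - z) = x * y - x * z"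
  by (rule mult_minus_distrib_mat)

lemma smult_mult: "x \<in> M \<Longrightarrow> y \<in> M \<Longrightarrow> (c \<cdot>\<^sub>m x) * y = c \<cdot>\<^sub>m (x * y)"
  by (rule mult_smult_assoc_mat)

lemma mult_smult: "x \<in> M \<Longrightarrow> y \<in> M \<Longrightarrow> x * (c \<cdot>\<^sub>m y) = c \<cdot>\<^sub>m (x * y)"
  by (rule mult_smult_distrib)

lemma diff_eq_zero_iff: "x \<in> M \<Longrightarrow> y \<in> M \<Longrightarrow> x - y = \<O> \<longleftrightarrow> x = y"
proof
  assume a: "x \<in> M" "y \<in> M" "x - y = \<O>"
  show "x = y"
  proof (rule mat_eqI)
    fix i j assume "i < n" "j < n"
    moreover from this have "(x - y) $$ (i, j) = 0" using a(3) by simp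
    ultimately show "x $$ (i, j) = y $$ (i, j)"
      using a(1,2) index_minus_mat(1)[of i y j x] by auto
  qed (use a in auto)
qed auto

lemma double_eq_self_imp_zero: "x \<in> M \<Longrightarrow> x = x + x \<Longrightarrow> x = \<O>"
proof (rule mat_eqI)
  fix i j assume "x \<in> M" "x = x + x" "i < n" "j < n"
  then have "x $$ (i, j) = x $$ (i, j) + x $$ (i, j)" using entry_simps(1)[of x x i j] by metis
  then have "x $$ (i, j) = 0" by (metis add_cancel_right_right)
  then show "x $$ (i, j) = \<O> $$ (i, j)" using \<open>i < n\<close> \<open>j < n\<close> by simp
qed auto

section \<open>Finite sums of matrices\<close>

lemma mat_sum_closed [simp]:
  fixes f :: "'g \<Rightarrow> 'a::field mat"
  shows "(\<And>g. g \<in> K \<Longrightarrow> f g \<in> M) \<Longrightarrow> mat_sum n f K \<in> M"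
proof -
  interpret V: abelian_group "module_mat TYPE('a) n n" by (rule abelian_group_mat)
  show "(\<And>g. g \<in> K \<Longrightarrow> f g \<in> M) \<Longrightarrow> mat_sum n f K \<in> M"
    using V.finsum_closed[of f K] by (auto simp: mat_sum_def module_mat_simps)
qed

lemma mat_sum_index:
  fixes f :: "'g \<Rightarrow> 'a::field mat"
  assumes "finite K" "\<And>g. g \<in> K \<Longrightarrow> f g \<in> M" "i < n" "j < n"
  shows "mat_sum n f K $$ (i, j) = (\<Sum>g\<in>K. f g $$ (i, j))"
  using assms(1,2)
proof (induction K)
  case empty
  interpret V: abelian_group "module_mat TYPE('a) n n" by (rule abelian_group_mat)
  show ?case using assms V.finsum_empty by (simp add: mat_sum_def module_mat_simps)
next
  case (insert g K)
  interpret V: abelian_group "module_mat TYPE('a) n n" by (rule abelian_group_mat)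
  have "mat_sum n f (insert g K) = f g + mat_sum n f K"
    using V.finsum_insert[OF insert(1,2), of f] insert(4)
    by (auto simp: mat_sum_def module_mat_simps)
  moreover have "mat_sum n f K \<in> M" using insert(4) by simp
  ultimately show ?case using insert assms by simp
qed

lemma mat_sum_eqI:
  assumes "finite K" "\<And>g. g \<in> K \<Longrightarrow> f g \<in> M" "x \<in> M"
    "\<And>i j. i < n \<Longrightarrow> j < n \<Longrightarrow> (\<Sum>g\<in>K. f g $$ (i, j)) = x $$ (i, j)"
  shows "mat_sum n f K = x"
  by (rule mat_eqI) (use assms in \<open>auto simp: mat_sum_index\<close>)

lemma mat_sum_empty [simp]: "mat_sum n f {} = \<O>"
  by (rule mat_sum_eqI) auto

lemma mat_sum_insert:
  "finite K \<Longrightarrow> g \<notin> K \<Longrightarrow> (\<And>h. h \<in> insert g K \<Longrightarrow> f h \<in> M) \<Longrightarrow>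
   mat_sum n f (insert g K) = f g + mat_sum n f K"
  by (rule mat_sum_eqI) (auto simp: mat_sum_index)

lemma mat_sum_cong:
  fixes f :: "'g \<Rightarrow> 'a::field mat"
  shows "K = K' \<Longrightarrow> (\<And>g. g \<in> K \<Longrightarrow> f g = f' g) \<Longrightarrow> (\<And>g. g \<in> K \<Longrightarrow> f g \<in> M) \<Longrightarrow>
   mat_sum n f K = mat_sum n f' K'"
proof -
  assume a: "K = K'" "\<And>g. g \<in> K \<Longrightarrow> f g = f' g" "\<And>g. g \<in> K \<Longrightarrow> f g \<in> M"
  interpret V: abelian_group "module_mat TYPE('a) n n" by (rule abelian_group_mat)
  have "f' \<in> K' \<rightarrow> M" using a by (metis Pi_I)
  then show ?thesis unfolding mat_sum_def
    using a by (intro V.finsum_cong') (auto simp: module_mat_simps)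
qed

lemma mat_sum_neutral:
  assumes "finite K" "K' \<subseteq> K" "\<And>g. g \<in> K \<Longrightarrow> f g \<in> M" "\<And>g. g \<in> K - K' \<Longrightarrow> f g = \<O>"
  shows "mat_sum n f K = mat_sum n f K'"
proof (rule mat_sum_eqI[OF assms(1,3)])
  have fin: "finite K'" using assms finite_subset by blast
  have c: "g \<in> K' \<Longrightarrow> f g \<in> M" for g using assms by auto
  show "mat_sum n f K' \<in> M" using c by simp
  fix i j assume ij: "i < n" "j < n"
  show "(\<Sum>g\<in>K. f g $$ (i, j)) = mat_sum n f K' $$ (i, j)"
    by (subst mat_sum_index[OF fin c ij], assumption, rule sum.mono_neutral_right)
      (use assms ij in auto)
qed

lemma mat_sum_single:
  assumes "finite K" "x \<in> M" "h \<in> K"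
  shows "mat_sum n (\<lambda>g. if g = h then x else \<O>) K = x"
  by (rule mat_sum_eqI)
     (use assms in \<open>auto simp: if_distrib[of "\<lambda>x. x $$ _"] cong: if_cong\<close>)

lemma mat_sum_singleton [simp]: "f h \<in> M \<Longrightarrow> mat_sum n f {h} = f h"
  by (rule mat_sum_eqI) auto

lemma mat_sum_add:
  assumes "finite K" "\<And>g. g \<in> K \<Longrightarrow> f g \<in> M" "\<And>g. g \<in> K \<Longrightarrow> f' g \<in> M"
  shows "mat_sum n (\<lambda>g. f g + f' g) K = mat_sum n f K + mat_sum n f' K"
proof (rule mat_sum_eqI)
  fix i j assume ij: "i < n" "j < n"
  have "(\<Sum>g\<in>K. (f g + f' g) $$ (i, j)) = (\<Sum>g\<in>K. f g $$ (i, j) + f' g $$ (i, j))"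
    by (rule sum.cong) (use assms ij in auto)
  also have "\<dots> = (mat_sum n f K + mat_sum n f' K) $$ (i, j)"
    using assms ij by (simp add: mat_sum_index sum.distrib)
  finally show "(\<Sum>g\<in>K. (f g + f' g) $$ (i, j)) = (mat_sum n f K + mat_sum n f' K) $$ (i, j)" .
qed (use assms in auto)

lemma mat_sum_diff:
  assumes "finite K" "\<And>g. g \<in> K \<Longrightarrow> f g \<in> M" "\<And>g. g \<in> K \<Longrightarrow> f' g \<in> M"
  shows "mat_sum n (\<lambda>g. f g - f' g) K = mat_sum n f K - mat_sum n f' K"
proof (rule mat_sum_eqI)
  fix i j assume ij: "i < n" "j < n"
  have "(\<Sum>g\<in>K. (f g - f' g) $$ (i, j)) = (\<Sum>g\<in>K. f g $$ (i, j) - f' g $$ (i, j))"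
    by (rule sum.cong) (use assms ij in auto)
  also have "\<dots> = (mat_sum n f K - mat_sum n f' K) $$ (i, j)"
    using assms ij by (simp add: mat_sum_index sum_subtractf)
  finally show "(\<Sum>g\<in>K. (f g - f' g) $$ (i, j)) = (mat_sum n f K - mat_sum n f' K) $$ (i, j)" .
qed (use assms in auto)

text \<open>Projections onto homogeneous components are defined and additive only on the graded algebra,
  which is why additivity is required on a set \<open>V\<close> instead of all matrices.\<close>

lemma mat_sum_additive:
  assumes "finite K" "\<And>g. g \<in> K \<Longrightarrow> f g \<in> V" "\<O> \<in> V" "V \<subseteq> M"
    "\<And>x y. x \<in> V \<Longrightarrow> y \<in> V \<Longrightarrow> x + y \<in> V"
    "\<And>x. x \<in> V \<Longrightarrow> \<phi> x \<in> M"
    "\<And>x y. x \<in> V \<Longrightarrow> y \<in> V \<Longrightarrow> \<phi> (x + y) = \<phi> x + \<phi> y"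
  shows "mat_sum n f K \<in> V \<and> \<phi> (mat_sum n f K) = mat_sum n (\<lambda>g. \<phi> (f g)) K"
  using assms(1,2)
proof (induction K)
  case empty
  have "\<phi> \<O> = \<phi> \<O> + \<phi> \<O>" using assms(7)[OF assms(3,3)] by simp
  then have "\<phi> \<O> = \<O>"
    using assms(6)[OF assms(3)] by (intro double_eq_self_imp_zero)
  then show ?case using assms by simp
next
  case (insert g K)
  have "mat_sum n f (insert g K) = f g + mat_sum n f K"
    by (rule mat_sum_insert) (use insert assms(4) in auto)
  moreover have "mat_sum n (\<lambda>g. \<phi> (f g)) (insert g K) = \<phi> (f g) + mat_sum n (\<lambda>g. \<phi> (f g)) K"
    by (rule mat_sum_insert) (use insert assms(6) in auto)
  ultimately show ?case using insert assms by auto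
qed

lemma mat_sum_mem:
  assumes "finite K" "\<And>g. g \<in> K \<Longrightarrow> f g \<in> V" "\<O> \<in> V" "V \<subseteq> M"
    "\<And>x y. x \<in> V \<Longrightarrow> y \<in> V \<Longrightarrow> x + y \<in> V"
  shows "mat_sum n f K \<in> V"
  using mat_sum_additive[of K f V "\<lambda>x. x"] assms by auto

lemma mat_sum_reindex:
  assumes "finite K" "inj_on h K" "\<And>g. g \<in> h ` K \<Longrightarrow> f g \<in> M"
  shows "mat_sum n f (h ` K) = mat_sum n (\<lambda>g. f (h g)) K"
  by (rule mat_sum_eqI) (use assms in \<open>auto simp: mat_sum_index sum.reindex\<close>)

lemma mat_sum_mult_left:
  assumes "finite K" "\<And>g. g \<in> K \<Longrightarrow> f g \<in> M" "a \<in> M"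
  shows "a * mat_sum n f K = mat_sum n (\<lambda>g. a * f g) K"
  using mat_sum_additive[of K f M "\<lambda>x. a * x"] assms by (auto simp: distrib_left)

lemma mat_sum_mult_right:
  assumes "finite K" "\<And>g. g \<in> K \<Longrightarrow> f g \<in> M" "a \<in> M"
  shows "mat_sum n f K * a = mat_sum n (\<lambda>g. f g * a) K"
  using mat_sum_additive[of K f M "\<lambda>x. x * a"] assms by (auto simp: distrib_right)

section \<open>Subspaces\<close>

lemma subspaceD:
  assumes "mat_subspace n V"
  shows "V \<subseteq> M" "\<O> \<in> V" "x \<in> V \<Longrightarrow> y \<in> V \<Longrightarrow> x + y \<in> V" "x \<in> V \<Longrightarrow> c \<cdot>\<^sub>m x \<in> V"
    "x \<in> V \<Longrightarrow> x \<in> M"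
  using assms by (auto simp: mat_subspace_def)

lemma subspace_diff:
  assumes "mat_subspace n V" "x \<in> V" "y \<in> V"
  shows "x - y \<in> V"
proof -
  have "x \<in> M" "y \<in> M" using subspaceD[OF assms(1)] assms by auto
  then have "x - y = x + (-1) \<cdot>\<^sub>m y" by (intro mat_eqI) auto
  then show ?thesis using subspaceD[OF assms(1)] assms by simp
qed

lemma subspace_mat_sum:
  assumes "mat_subspace n V" "finite K" "\<And>g. g \<in> K \<Longrightarrow> f g \<in> V"
  shows "mat_sum n f K \<in> V"
  using mat_sum_mem[of K f V] subspaceD[OF assms(1)] assms(2,3) by auto

lemma subspace_carrier: "mat_subspace n M"
  by (simp add: mat_subspace_def)

end

section \<open>Homogeneous components\<close>

text \<open>The choice is unique because the sum of the spaces \<open>A g\<close> is direct, see \<open>component_unique\<close>.\<close>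

definition component :: "nat \<Rightarrow> ('g \<Rightarrow> 'a::field mat set) \<Rightarrow> 'g \<Rightarrow> 'a mat \<Rightarrow> 'a mat" where
  "component n A g x =
     (SOME f. finite {k. f k \<noteq> 0\<^sub>m n n} \<and> (\<forall>k. f k \<in> A k) \<and>
        mat_sum n f {k. f k \<noteq> 0\<^sub>m n n} = x) g"

definition graded_subspace :: "nat \<Rightarrow> 'a::field mat set \<Rightarrow> ('g \<Rightarrow> 'a mat set) \<Rightarrow> 'a mat set \<Rightarrow> bool" where
  "graded_subspace n S A V \<longleftrightarrow>
     mat_subspace n V \<and> V \<subseteq> S \<and> (\<forall>x\<in>V. \<forall>g. component n A g x \<in> V)"

context square_matrices
begin

lemma gradingD:
  assumes "is_grading n S A"
  shows "mat_subspace n (A g)" "x \<in> A g \<Longrightarrow> x \<in> M" "\<O> \<in> A g"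
    "x \<in> A g \<Longrightarrow> y \<in> A h \<Longrightarrow> x * y \<in> A (g + h)"
  using assms by (auto simp: is_grading_def mat_subspace_def)

lemma independent_familyD:
  assumes "is_grading n S A" "finite K" "\<And>g. g \<in> K \<Longrightarrow> f g \<in> A g" "mat_sum n f K = \<O>" "g \<in> K"
  shows "f g = \<O>"
proof -
  have "independent_family n A" using assms(1) by (simp add: is_grading_def)
  then show ?thesis using assms(2-5) unfolding independent_family_def by metis
qed

lemma grading_sum_mem:
  assumes "is_grading n S A" "finite K" "\<And>g. g \<in> K \<Longrightarrow> f g \<in> A g"
  shows "mat_sum n f K \<in> S"
proof -
  have "mat_sum n f K \<in> subspace_sum n A UNIV"
    unfolding subspace_sum_def using assms by blast
  then show ?thesis using assms(1) by (simp add: is_grading_def)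
qed

lemma component_spec:
  assumes "is_grading n S A" "x \<in> S"
  shows "finite {g. component n A g x \<noteq> \<O>} \<and> (\<forall>g. component n A g x \<in> A g) \<and>
    mat_sum n (\<lambda>g. component n A g x) {g. component n A g x \<noteq> \<O>} = x"
proof -
  let ?Q = "\<lambda>f. finite {k. f k \<noteq> \<O>} \<and> (\<forall>k. f k \<in> A k) \<and> mat_sum n f {k. f k \<noteq> \<O>} = x"
  obtain f K where f: "finite K" "\<forall>g\<in>K. f g \<in> A g" "x = mat_sum n f K"
    using assms unfolding is_grading_def subspace_sum_def by blast
  define f' where "f' = (\<lambda>g. if g \<in> K then f g else \<O>)"
  have mem: "f' g \<in> A g" for g
    unfolding f'_def using f gradingD(3)[OF assms(1)] by simp
  have sub: "{g. f' g \<noteq> \<O>} \<subseteq> K" by (auto simp: f'_def)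
  have car: "f' g \<in> M" for g using mem gradingD(2)[OF assms(1)] by blast
  have "mat_sum n f' {g. f' g \<noteq> \<O>} = mat_sum n f' K"
    by (rule mat_sum_neutral[symmetric]) (use f sub car in auto)
  also have "\<dots> = x"
    unfolding f(3) by (rule mat_sum_cong) (use f(2) gradingD(2)[OF assms(1)] in \<open>auto simp: f'_def\<close>)
  finally have "?Q f'" using mem sub f finite_subset by blast
  then have "?Q (SOME f. ?Q f)" by (rule someI[of ?Q])
  then show ?thesis unfolding component_def by simp
qed

lemma
  assumes "is_grading n S A" "x \<in> S"
  shows finite_component_support: "finite {g. component n A g x \<noteq> \<O>}"
    and component_mem: "component n A g x \<in> A g"
    and component_closed [simp]: "component n A g x \<in> M"
  using component_spec[OF assms] gradingD(2)[OF assms(1)] by blast+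

lemma component_sum:
  assumes "is_grading n S A" "x \<in> S" "finite K" "{g. component n A g x \<noteq> \<O>} \<subseteq> K"
  shows "mat_sum n (\<lambda>g. component n A g x) K = x"
proof -
  have "mat_sum n (\<lambda>g. component n A g x) K
      = mat_sum n (\<lambda>g. component n A g x) {g. component n A g x \<noteq> \<O>}"
    by (rule mat_sum_neutral) (use assms in auto)
  then show ?thesis using component_spec[OF assms(1,2)] by simp
qed

lemma component_unique:
  assumes gr: "is_grading n S A" and K: "finite K" and f: "\<And>g. f g \<in> A g"
    and out: "\<And>g. g \<notin> K \<Longrightarrow> f g = \<O>" and x: "mat_sum n f K = x"
  shows "component n A g x = f g"
proof -
  have xS: "x \<in> S" using grading_sum_mem[OF gr K, of f] f x by simp
  let ?c = "\<lambda>g. component n A g x"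
  have car: "f g \<in> M" for g using f gradingD(2)[OF gr] by blast
  let ?K = "K \<union> {g. ?c g \<noteq> \<O>}"
  have fin: "finite ?K" using K finite_component_support[OF gr xS] by blast
  have "mat_sum n f ?K = mat_sum n f K"
    by (rule mat_sum_neutral) (use fin out car in auto)
  then have fx: "mat_sum n f ?K = x" using x by simp
  have "mat_sum n (\<lambda>g. f g - ?c g) ?K = mat_sum n f ?K - mat_sum n ?c ?K"
    by (rule mat_sum_diff) (use fin car gr xS in auto)
  also have "\<dots> = \<O>"
    unfolding fx component_sum[OF gr xS fin Un_upper2]
    using mat_sum_closed[of K f, OF car] x by (metis diff_eq_zero_iff)
  finally have zero: "mat_sum n (\<lambda>g. f g - ?c g) ?K = \<O>" .
  have "f g - ?c g \<in> A g" for g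
    using subspace_diff[OF gradingD(1)[OF gr]] f component_mem[OF gr xS] by simp
  then have "\<forall>g\<in>?K. f g - ?c g = \<O>"
    using independent_familyD[OF gr fin _ zero] by simp
  then have "f g = ?c g" if "g \<in> ?K"
    using that car diff_eq_zero_iff component_closed[OF gr xS] by blast
  then show ?thesis using out by (cases "g \<in> ?K") auto
qed

lemma grading_total_subspace:
  assumes gr: "is_grading n S A"
  shows "mat_subspace n S"
proof -
  have add: "x + y \<in> S" if "x \<in> S" "y \<in> S" for x y
  proof -
    let ?K = "{g. component n A g x \<noteq> \<O>} \<union> {g. component n A g y \<noteq> \<O>}"
    have fin: "finite ?K" using finite_component_support[OF gr] that by simp
    have "x + y = mat_sum n (\<lambda>g. component n A g x) ?K + mat_sum n (\<lambda>g. component n A g y) ?K"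
      using component_sum[OF gr _ fin] that by simp
    also have "\<dots> = mat_sum n (\<lambda>g. component n A g x + component n A g y) ?K"
      by (rule mat_sum_add[symmetric]) (use fin gr that in auto)
    also have "\<dots> \<in> S"
      by (rule grading_sum_mem[OF gr fin])
         (use component_mem[OF gr] that subspaceD[OF gradingD(1)[OF gr]] in auto)
    finally show ?thesis .
  qed
  have smult: "c \<cdot>\<^sub>m x \<in> S" if "x \<in> S" for c x
  proof -
    let ?K = "{g. component n A g x \<noteq> \<O>}"
    have fin: "finite ?K" using finite_component_support[OF gr] that by simp
    have "c \<cdot>\<^sub>m mat_sum n (\<lambda>g. component n A g x) ?K = mat_sum n (\<lambda>g. c \<cdot>\<^sub>m component n A g x) ?K"
      using mat_sum_additive[of ?K "\<lambda>g. component n A g x" M "\<lambda>x. c \<cdot>\<^sub>m x"] fin gr that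
      by (auto simp: add_smult_distrib_left_mat)
    moreover have "\<dots> \<in> S"
      by (rule grading_sum_mem[OF gr fin])
         (use component_mem[OF gr] that subspaceD[OF gradingD(1)[OF gr]] in auto)
    ultimately show ?thesis using component_sum[OF gr that fin] by simp
  qed
  have "x \<in> M" if "x \<in> S" for x
  proof -
    have "mat_sum n (\<lambda>g. component n A g x) {g. component n A g x \<noteq> \<O>} \<in> M"
      by (rule mat_sum_closed) (rule component_closed[OF gr that])
    then show ?thesis
      using component_sum[OF gr that finite_component_support[OF gr that]] by simp
  qed
  moreover have "\<O> \<in> S" using grading_sum_mem[OF gr, of "{}"] by simp
  ultimately show ?thesis unfolding mat_subspace_def using add smult by auto
qed

lemma grading_carrier: "is_grading n S A \<Longrightarrow> x \<in> S \<Longrightarrow> x \<in> M"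
  using grading_total_subspace subspaceD(5) by blast

lemma component_homogeneous:
  assumes gr: "is_grading n S A" and "x \<in> A h"
  shows "component n A g x = (if g = h then x else \<O>)"
  by (rule component_unique[OF gr, of "{h}"])
     (use assms gradingD(2,3)[OF gr] mat_sum_single[of "{h}" x h] in auto)

lemma homogeneous_subset:
  assumes "is_grading n S A" "x \<in> A g"
  shows "x \<in> S"
  using grading_sum_mem[OF assms(1), of "{g}" "\<lambda>h. if h = g then x else \<O>"]
    mat_sum_single[of "{g}" x g] gradingD(2)[OF assms] assms by auto

lemma component_zero: "is_grading n S A \<Longrightarrow> component n A g \<O> = \<O>"
  using component_homogeneous[of S A \<O> g] gradingD(3) by metis

lemma component_add:
  assumes gr: "is_grading n S A" and xy: "x \<in> S" "y \<in> S"
  shows "component n A g (x + y) = component n A g x + component n A g y"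
proof (rule component_unique[OF gr])
  let ?K = "{g. component n A g x \<noteq> \<O>} \<union> {g. component n A g y \<noteq> \<O>}"
  show fin: "finite ?K" using finite_component_support[OF gr] xy by simp
  show "component n A g x + component n A g y \<in> A g" for g
    using component_mem[OF gr] xy subspaceD[OF gradingD(1)[OF gr]] by simp
  show "mat_sum n (\<lambda>g. component n A g x + component n A g y) ?K = x + y"
    by (subst mat_sum_add) (use fin gr xy component_sum[OF gr _ fin] in auto)
qed auto

lemma component_smult:
  assumes gr: "is_grading n S A" and x: "x \<in> S"
  shows "component n A g (c \<cdot>\<^sub>m x) = c \<cdot>\<^sub>m component n A g x"
proof (rule component_unique[OF gr])
  let ?K = "{g. component n A g x \<noteq> \<O>}"
  show fin: "finite ?K" by (rule finite_component_support[OF gr x])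
  show "c \<cdot>\<^sub>m component n A g x \<in> A g" for g
    by (rule subspaceD(4)[OF gradingD(1)[OF gr] component_mem[OF gr x]])
  have "c \<cdot>\<^sub>m mat_sum n (\<lambda>g. component n A g x) ?K = mat_sum n (\<lambda>g. c \<cdot>\<^sub>m component n A g x) ?K"
    using mat_sum_additive[of ?K "\<lambda>g. component n A g x" M "\<lambda>x. c \<cdot>\<^sub>m x"] fin gr x
    by (auto simp: add_smult_distrib_left_mat)
  then show "mat_sum n (\<lambda>g. c \<cdot>\<^sub>m component n A g x) ?K = c \<cdot>\<^sub>m x"
    using component_sum[OF gr x fin] by simp
qed auto

lemma component_mat_sum:
  assumes gr: "is_grading n S A" and K: "finite K" and f: "\<And>k. k \<in> K \<Longrightarrow> f k \<in> S"
  shows "component n A g (mat_sum n f K) = mat_sum n (\<lambda>k. component n A g (f k)) K"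
  using mat_sum_additive[of K f S "component n A g"] K f component_add[OF gr]
    subspaceD[OF grading_total_subspace[OF gr]] component_closed[OF gr] by auto

lemma homogeneous_iff:
  assumes gr: "is_grading n S A"
  shows "x \<in> A g \<longleftrightarrow> x \<in> S \<and> (\<forall>h. h \<noteq> g \<longrightarrow> component n A h x = \<O>)"
proof
  assume "x \<in> A g"
  then show "x \<in> S \<and> (\<forall>h. h \<noteq> g \<longrightarrow> component n A h x = \<O>)"
    using component_homogeneous[OF gr] homogeneous_subset[OF gr] by auto
next
  assume a: "x \<in> S \<and> (\<forall>h. h \<noteq> g \<longrightarrow> component n A h x = \<O>)"
  then have "mat_sum n (\<lambda>h. component n A h x) {g} = x"
    using component_sum[OF gr, of x "{g}"] by auto
  moreover have "mat_sum n (\<lambda>h. component n A h x) {g} \<in> A g"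
    using subspace_mat_sum[OF gradingD(1)[OF gr, of g], of "{g}"] component_mem[OF gr] a by auto
  ultimately show "x \<in> A g" by simp
qed

lemma component_all_zero:
  assumes gr: "is_grading n S A" "x \<in> S" "\<And>g. component n A g x = \<O>"
  shows "x = \<O>"
  using component_sum[OF gr(1,2), of "{}"] gr(3) by simp

lemma component_mult_left:
  assumes gr: "is_grading n S A" and a: "a \<in> A k" and x: "x \<in> S"
  shows "component n A (k + g) (a * x) = a * component n A g x"
proof -
  let ?S = "{g. component n A g x \<noteq> \<O>}"
  let ?f = "\<lambda>h. a * component n A (h - k) x"
  have fin: "finite ?S" using finite_component_support[OF gr x] .
  have aM: "a \<in> M" using gradingD(2)[OF gr a] .
  have "component n A (k + g) (a * x) = ?f (k + g)"
  proof (rule component_unique[OF gr])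
    show "finite ((+) k ` ?S)" using fin by simp
    show "?f h \<in> A h" for h
      using gradingD(4)[OF gr a component_mem[OF gr x, of "h - k"]] by simp
    show "?f h = \<O>" if "h \<notin> (+) k ` ?S" for h
    proof -
      have "h - k \<notin> ?S" using that by (metis add.commute diff_add_cancel image_eqI)
      then show ?thesis using aM by simp
    qed
    have "mat_sum n ?f ((+) k ` ?S) = mat_sum n (\<lambda>g. ?f (k + g)) ?S"
      by (rule mat_sum_reindex) (use fin aM gr x in auto)
    also have "\<dots> = a * mat_sum n (\<lambda>g. component n A g x) ?S"
      by (subst mat_sum_mult_left) (use fin aM gr x in auto)
    also have "\<dots> = a * x" using component_sum[OF gr x fin] by simp
    finally show "mat_sum n ?f ((+) k ` ?S) = a * x" .
  qed
  then show ?thesis by simp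
qed

lemma component_mult_right:
  assumes gr: "is_grading n S A" and a: "a \<in> A k" and x: "x \<in> S"
  shows "component n A (g + k) (x * a) = component n A g x * a"
proof -
  let ?S = "{g. component n A g x \<noteq> \<O>}"
  let ?f = "\<lambda>h. component n A (h - k) x * a"
  have fin: "finite ?S" using finite_component_support[OF gr x] .
  have aM: "a \<in> M" using gradingD(2)[OF gr a] .
  have "component n A (g + k) (x * a) = ?f (g + k)"
  proof (rule component_unique[OF gr])
    show "finite ((\<lambda>g. g + k) ` ?S)" using fin by simp
    show "?f h \<in> A h" for h
      using gradingD(4)[OF gr component_mem[OF gr x, of "h - k"] a] by simp
    show "?f h = \<O>" if "h \<notin> (\<lambda>g. g + k) ` ?S" for h
    proof -
      have "h - k \<notin> ?S" using that by (metis diff_add_cancel image_eqI)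
      then show ?thesis using aM by simp
    qed
    have "mat_sum n ?f ((\<lambda>g. g + k) ` ?S) = mat_sum n (\<lambda>g. ?f (g + k)) ?S"
      by (rule mat_sum_reindex) (use fin aM gr x in auto)
    also have "\<dots> = mat_sum n (\<lambda>g. component n A g x) ?S * a"
      by (subst mat_sum_mult_right) (use fin aM gr x in auto)
    also have "\<dots> = x * a" using component_sum[OF gr x fin] by simp
    finally show "mat_sum n ?f ((\<lambda>g. g + k) ` ?S) = x * a" .
  qed
  then show ?thesis by simp
qed

lemma graded_subspaceD:
  assumes "graded_subspace n S A V"
  shows "mat_subspace n V" "x \<in> V \<Longrightarrow> x \<in> S" "x \<in> V \<Longrightarrow> component n A g x \<in> V"
  using assms by (auto simp: graded_subspace_def)

lemma graded_subspace_whole: "is_grading n S A \<Longrightarrow> graded_subspace n S A S"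
  unfolding graded_subspace_def
  using grading_total_subspace[of S A] component_mem[of S A] homogeneous_subset[of S A] by auto

lemma homogeneous_induct [consumes 3, case_names zero add homogeneous]:
  assumes gr: "is_grading n S A" and V: "graded_subspace n S A V" and x: "x \<in> V"
    and zero: "P \<O>"
    and add: "\<And>x y. x \<in> V \<Longrightarrow> y \<in> V \<Longrightarrow> P x \<Longrightarrow> P y \<Longrightarrow> P (x + y)"
    and hom: "\<And>g x. x \<in> V \<Longrightarrow> x \<in> A g \<Longrightarrow> P x"
  shows "P x"
proof -
  note Vs = subspaceD[OF graded_subspaceD(1)[OF V]]
  have xS: "x \<in> S" using graded_subspaceD(2)[OF V x] .
  let ?K = "{g. component n A g x \<noteq> \<O>}"
  have fin: "finite ?K" using finite_component_support[OF gr xS] .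
  have "component n A g x \<in> {x \<in> V. P x}" for g
    using hom component_mem[OF gr xS] graded_subspaceD(3)[OF V x] by blast
  then have "mat_sum n (\<lambda>g. component n A g x) ?K \<in> {x \<in> V. P x}"
    using Vs zero add by (intro mat_sum_mem[OF fin]) auto
  then show ?thesis using component_sum[OF gr xS fin] by simp
qed

text \<open>For \<open>S \<subset> S'\<close> this says that components may be computed in the smaller algebra when a
  grading is extended.\<close>

lemma component_coarser:
  assumes "is_grading n S A" "is_grading n S' A'" "\<And>g. A g \<subseteq> A' g" "x \<in> S"
  shows "component n A' g x = component n A g x"
  by (rule component_unique[OF assms(2) finite_component_support[OF assms(1,4)]])
     (use component_mem[OF assms(1,4)] assms(3)
        component_sum[OF assms(1,4) finite_component_support[OF assms(1,4)] subset_refl] in auto)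

text \<open>Gradings of the same algebra are incomparable: the sum of the smaller components is already
  everything, and the sum of the larger ones is direct.\<close>

lemma grading_le_eq:
  assumes A: "is_grading n S A" and A': "is_grading n S A'" and le: "\<And>g. A g \<subseteq> A' g"
  shows "A = A'"
proof (rule ext, rule equalityI[OF le], rule subsetI)
  fix g x assume x: "x \<in> A' g"
  have xS: "x \<in> S" using homogeneous_subset[OF A' x] .
  have "component n A g x = x"
    using component_coarser[OF A A' le xS, of g] component_homogeneous[OF A' x, of g] by simp
  then show "x \<in> A g" using component_mem[OF A xS, of g] by simp
qed

section \<open>Coarsenings\<close>

lemma subspace_sum_iff:
  assumes gr: "is_grading n S A"
  shows "x \<in> subspace_sum n A I \<longleftrightarrow> x \<in> S \<and> (\<forall>g. g \<notin> I \<longrightarrow> component n A g x = \<O>)"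
proof
  assume "x \<in> subspace_sum n A I"
  then obtain f K where f: "finite K" "K \<subseteq> I" "\<forall>g\<in>K. f g \<in> A g" "x = mat_sum n f K"
    unfolding subspace_sum_def by blast
  have "component n A g x = (if g \<in> K then f g else \<O>)" for g
    by (rule component_unique[OF gr f(1)])
       (use f gradingD(2,3)[OF gr] in \<open>auto intro!: mat_sum_cong\<close>)
  then show "x \<in> S \<and> (\<forall>g. g \<notin> I \<longrightarrow> component n A g x = \<O>)"
    using f grading_sum_mem[OF gr] by auto
next
  assume x: "x \<in> S \<and> (\<forall>g. g \<notin> I \<longrightarrow> component n A g x = \<O>)"
  let ?K = "{g. component n A g x \<noteq> \<O>}"
  have "finite ?K" "mat_sum n (\<lambda>g. component n A g x) ?K = x"
    "\<forall>g. component n A g x \<in> A g" "?K \<subseteq> I"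
    using component_spec[OF gr] x by auto
  then show "x \<in> subspace_sum n A I" unfolding subspace_sum_def
    by (smt (verit) mem_Collect_eq)
qed

lemma subspace_sum_subspace:
  assumes gr: "is_grading n S A"
  shows "mat_subspace n (subspace_sum n A I)"
proof -
  note Ss = subspaceD[OF grading_total_subspace[OF gr]]
  show ?thesis unfolding mat_subspace_def subset_iff
    using Ss component_add[OF gr] component_zero[OF gr] component_smult[OF gr]
    by (auto simp: subspace_sum_iff[OF gr])
qed

lemma homogeneous_in_subspace_sum:
  "is_grading n S A \<Longrightarrow> x \<in> A g \<Longrightarrow> g \<in> I \<Longrightarrow> x \<in> subspace_sum n A I"
  by (auto simp: subspace_sum_iff component_homogeneous homogeneous_subset)

lemma subspace_sum_graded:
  assumes gr: "is_grading n S A"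
  shows "graded_subspace n S A (subspace_sum n A I)"
  unfolding graded_subspace_def
  using subspace_sum_subspace[OF gr] component_homogeneous[OF gr component_mem[OF gr]]
    homogeneous_subset[OF gr component_mem[OF gr]]
  by (auto simp: subspace_sum_iff[OF gr])

lemma subspace_sum_induct [consumes 2, case_names zero add homogeneous]:
  assumes gr: "is_grading n S A" and x: "x \<in> subspace_sum n A I"
    and zero: "P \<O>"
    and add: "\<And>x y. x \<in> S \<Longrightarrow> y \<in> S \<Longrightarrow> P x \<Longrightarrow> P y \<Longrightarrow> P (x + y)"
    and hom: "\<And>g x. g \<in> I \<Longrightarrow> x \<in> A g \<Longrightarrow> P x"
  shows "P x"
  using gr subspace_sum_graded[OF gr] x
proof (induction rule: homogeneous_induct)
  case (homogeneous g x)
  show ?case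
  proof (cases "g \<in> I")
    case False
    then have "x = \<O>"
      using homogeneous component_homogeneous[OF gr homogeneous(2), of g] subspace_sum_iff[OF gr, of x I]
      by auto
    then show ?thesis using zero by simp
  qed (use hom homogeneous in blast)
qed (use zero add subspace_sum_iff[OF gr] in auto)

lemma subspace_sum_mono: "I \<subseteq> I' \<Longrightarrow> subspace_sum n A I \<subseteq> subspace_sum n A I'"
  unfolding subspace_sum_def by blast

text \<open>The set \<open>P\<close> of admitted degrees cuts out a graded subalgebra. With \<open>P\<close> everything this is the
  coarsening along \<open>\<alpha>\<close>; with \<open>P\<close> the nonnegative degrees it is the restriction to \<open>U\<close> followed by
  a coarsening.\<close>

lemma grading_coarsen:
  fixes \<alpha> :: "'g::ab_group_add \<Rightarrow> 'h::ab_group_add"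
  assumes gr: "is_grading n S A"
    and P: "\<And>a b. a \<in> P \<Longrightarrow> b \<in> P \<Longrightarrow> a + b \<in> P"
    and \<alpha>: "\<And>a b. \<alpha> (a + b) = \<alpha> a + \<alpha> b"
  shows "is_grading n (subspace_sum n A P) (\<lambda>h. subspace_sum n A {g \<in> P. \<alpha> g = h})"
proof -
  let ?A = "\<lambda>h. subspace_sum n A {g \<in> P. \<alpha> g = h}"
  have sub: "?A h \<subseteq> subspace_sum n A P" for h by (rule subspace_sum_mono) auto
  have total: "subspace_sum n ?A UNIV = subspace_sum n A P"
  proof (intro equalityI subsetI)
    fix x assume "x \<in> subspace_sum n ?A UNIV"
    then obtain f K where "finite K" "\<forall>g\<in>K. f g \<in> ?A g" "x = mat_sum n f K"
      unfolding subspace_sum_def[of n ?A] by blast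
    then show "x \<in> subspace_sum n A P"
      using subspace_mat_sum[OF subspace_sum_subspace[OF gr], of K f P] sub by blast
  next
    fix x assume x: "x \<in> subspace_sum n A P"
    then have xS: "x \<in> S" by (simp add: subspace_sum_iff[OF gr])
    let ?c = "\<lambda>g. component n A g x"
    let ?K = "{g. ?c g \<noteq> \<O>}"
    have KP: "?K \<subseteq> P" using x subspace_sum_iff[OF gr] by auto
    have fin: "finite ?K" by (rule finite_component_support[OF gr xS])
    define f where "f = (\<lambda>h. mat_sum n ?c {g \<in> ?K. \<alpha> g = h})"
    have fA: "f h \<in> ?A h" for h
      unfolding f_def subspace_sum_def using fin KP component_mem[OF gr xS]
      by (intro CollectI exI[of _ ?c] exI[of _ "{g \<in> ?K. \<alpha> g = h}"]) auto
    have fM: "f h \<in> M" for h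
      unfolding f_def using gr xS by (intro mat_sum_closed) auto
    have "mat_sum n f (\<alpha> ` ?K) = x"
    proof (rule mat_sum_eqI)
      show "finite (\<alpha> ` ?K)" using fin by simp
      show "f g \<in> M" for g by (rule fM)
      show "x \<in> M" using grading_carrier[OF gr xS] .
      fix i j assume ij: "i < n" "j < n"
      have "(\<Sum>g\<in>\<alpha> ` ?K. f g $$ (i, j)) = (\<Sum>h\<in>\<alpha> ` ?K. \<Sum>g | g \<in> ?K \<and> \<alpha> g = h. ?c g $$ (i, j))"
        unfolding f_def by (rule sum.cong) (use fin gr xS ij in \<open>auto simp: mat_sum_index\<close>)
      also have "\<dots> = (\<Sum>g\<in>?K. ?c g $$ (i, j))"
        by (rule sum.group) (use fin in auto)
      also have "\<dots> = mat_sum n ?c ?K $$ (i, j)"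
        by (rule mat_sum_index[symmetric]) (use fin gr xS ij in auto)
      finally show "(\<Sum>g\<in>\<alpha> ` ?K. f g $$ (i, j)) = x $$ (i, j)"
        using component_sum[OF gr xS fin] by simp
    qed
    then show "x \<in> subspace_sum n ?A UNIV"
      unfolding subspace_sum_def[of n ?A]
      by (intro CollectI exI[of _ f] exI[of _ "\<alpha> ` ?K"]) (use fA fin in auto)
  qed
  have indep: "independent_family n ?A"
    unfolding independent_family_def
  proof (intro allI impI ballI)
    fix f K h assume K: "finite K" "\<forall>g\<in>K. f g \<in> ?A g" "mat_sum n f K = \<O>" "h \<in> K"
    have fS: "f k \<in> S" if "k \<in> K" for k using K that subspace_sum_iff[OF gr] by auto
    have fM: "f k \<in> M" if "k \<in> K" for k using fS[OF that] grading_carrier[OF gr] by blast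
    have comp: "component n A g (f k) = \<O>" if "k \<in> K" "\<alpha> g \<noteq> k" for g k
      using K that subspace_sum_iff[OF gr] by auto
    show "f h = \<O>"
    proof (rule component_all_zero[OF gr fS[OF K(4)]])
      fix g
      show "component n A g (f h) = \<O>"
      proof (cases "\<alpha> g = h")
        case True
        have "\<O> = component n A g (mat_sum n f K)" using K component_zero[OF gr] by simp
        also have "\<dots> = mat_sum n (\<lambda>k. component n A g (f k)) K"
          by (rule component_mat_sum[OF gr K(1) fS])
        also have "\<dots> = mat_sum n (\<lambda>k. component n A g (f k)) {h}"
          by (rule mat_sum_neutral) (use K True comp component_closed[OF gr fS] in auto)
        also have "\<dots> = component n A g (f h)"
          using component_closed[OF gr fS] K by simp
        finally show ?thesis by simp
      qed (use comp K in auto)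
    qed
  qed
  have mult: "x * y \<in> ?A (h + k)" if x: "x \<in> ?A h" and y: "y \<in> ?A k" for x y h k
  proof -
    note Vs = subspaceD[OF subspace_sum_subspace[OF gr, of "{g \<in> P. \<alpha> g = h + k}"]]
    have yS: "y \<in> S" using y subspace_sum_iff[OF gr] by auto
    have yM: "y \<in> M" using grading_carrier[OF gr yS] .
    show ?thesis using gr x
    proof (induction rule: subspace_sum_induct)
      case zero
      then show ?case using Vs yM by simp
    next
      case (add u v)
      then show ?case using Vs yM grading_carrier[OF gr] by (simp add: distrib_right)
    next
      case (homogeneous g u)
      then have uM: "u \<in> M" and uA: "u \<in> A g" and g: "g \<in> P" "\<alpha> g = h"
        using gradingD(2)[OF gr] by auto
      show ?case using gr y
      proof (induction rule: subspace_sum_induct)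
        case zero
        then show ?case using Vs uM by simp
      next
        case (add v w)
        then show ?case using Vs uM grading_carrier[OF gr] by (simp add: distrib_left)
      next
        case (homogeneous g' v)
        show ?case
          by (rule homogeneous_in_subspace_sum[OF gr gradingD(4)[OF gr uA homogeneous(2)]])
             (use homogeneous g P \<alpha> in auto)
      qed
    qed
  qed
  show ?thesis unfolding is_grading_def
    using subspace_sum_subspace[OF gr] total indep mult by blast
qed

lemma grading_coarsening:
  fixes \<alpha> :: "'g::ab_group_add \<Rightarrow> 'h::ab_group_add"
  assumes gr: "is_grading n S A" and \<alpha>: "\<And>a b. \<alpha> (a + b) = \<alpha> a + \<alpha> b"
  shows "is_grading n S (coarsening n \<alpha> A)"
proof -
  have "coarsening n \<alpha> A = (\<lambda>h. subspace_sum n A {g \<in> UNIV. \<alpha> g = h})"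
    by (auto simp: coarsening_def fun_eq_iff vimage_def)
  moreover have "subspace_sum n A UNIV = S" using gr by (simp add: is_grading_def)
  ultimately show ?thesis using grading_coarsen[OF gr, of UNIV \<alpha>] \<alpha> by simp
qed

section \<open>Conjugated gradings\<close>

lemma grading_conj:
  assumes gr: "is_grading n S A" and t: "t \<in> M" "t' \<in> M" "t' * t = 1\<^sub>m n"
  shows "is_grading n ((\<lambda>x. t * x * t') ` S) (\<lambda>g. (\<lambda>x. t * x * t') ` A g)"
proof -
  let ?\<phi> = "\<lambda>x. t * x * t'"
  let ?A = "\<lambda>g. ?\<phi> ` A g"
  have t'x: "t' * (t * x) = x" if "x \<in> M" for x
    using t that by (simp flip: mult_assoc)
  have mult: "?\<phi> x * ?\<phi> y = ?\<phi> (x * y)" if "x \<in> M" "y \<in> M" for x y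
    using t that t'x[of "y * t'"] by (simp add: mult_assoc)
  have undo_conj: "t' * ?\<phi> x * t = x" if "x \<in> M" for x
    using t that t'x[of "x * t' * t"] by (simp add: mult_assoc)
  have add: "?\<phi> (x + y) = ?\<phi> x + ?\<phi> y" if "x \<in> M" "y \<in> M" for x y
    using t that by (simp add: distrib_left distrib_right)
  have smult: "?\<phi> (c \<cdot>\<^sub>m x) = c \<cdot>\<^sub>m ?\<phi> x" if "x \<in> M" for x c
    using t that by (simp add: mult_smult smult_mult)
  have clos: "?\<phi> x \<in> M" if "x \<in> M" for x using t that by simp
  have sums: "?\<phi> (mat_sum n f K) = mat_sum n (\<lambda>g. ?\<phi> (f g)) K"
    if "finite K" "\<And>g. g \<in> K \<Longrightarrow> f g \<in> M" for f K
    using mat_sum_additive[of K f M ?\<phi>] that add clos by auto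
  have sub: "mat_subspace n (?A g)" for g
  proof -
    note s = subspaceD[OF gradingD(1)[OF gr, of g]]
    have "\<O> = ?\<phi> \<O>" using t by simp
    then have "\<O> \<in> ?A g" using s by blast
    moreover have "?\<phi> x + ?\<phi> y \<in> ?A g" if "x \<in> A g" "y \<in> A g" for x y
      using add[of x y] s that by (metis image_eqI)
    moreover have "c \<cdot>\<^sub>m ?\<phi> x \<in> ?A g" if "x \<in> A g" for c x
      using smult[of x c] s that by (metis image_eqI)
    ultimately show ?thesis unfolding mat_subspace_def using clos s by blast
  qed
  have lift: "\<exists>f'. (\<forall>g\<in>K. f' g \<in> A g) \<and> (\<forall>g\<in>K. f g = ?\<phi> (f' g))" if "\<forall>g\<in>K. f g \<in> ?A g" for f K
    using that bchoice[of K "\<lambda>g y. y \<in> A g \<and> f g = ?\<phi> y"] by blast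
  have total: "subspace_sum n ?A UNIV = ?\<phi> ` S"
  proof (intro equalityI subsetI)
    fix x assume "x \<in> subspace_sum n ?A UNIV"
    then obtain f K where f: "finite K" "\<forall>g\<in>K. f g \<in> ?A g" "x = mat_sum n f K"
      unfolding subspace_sum_def by blast
    obtain f' where f': "\<forall>g\<in>K. f' g \<in> A g" "\<forall>g\<in>K. f g = ?\<phi> (f' g)" using lift[OF f(2)] by blast
    have fM: "f' g \<in> M" if "g \<in> K" for g using f' gradingD(2)[OF gr] that by blast
    have "x = mat_sum n (\<lambda>g. ?\<phi> (f' g)) K"
      unfolding f(3) by (rule mat_sum_cong) (use f' clos fM in auto)
    then have "x = ?\<phi> (mat_sum n f' K)" using sums[OF f(1) fM] by simp
    then show "x \<in> ?\<phi> ` S" using grading_sum_mem[OF gr f(1), of f'] f' by blast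
  next
    fix y assume "y \<in> ?\<phi> ` S"
    then obtain x where x: "x \<in> S" "y = ?\<phi> x" by blast
    let ?c = "\<lambda>g. component n A g x"
    let ?K = "{g. ?c g \<noteq> \<O>}"
    have fin: "finite ?K" by (rule finite_component_support[OF gr x(1)])
    have "y = mat_sum n (\<lambda>g. ?\<phi> (?c g)) ?K"
      using sums[OF fin, of ?c] component_sum[OF gr x(1) fin] x gr by simp
    then show "y \<in> subspace_sum n ?A UNIV"
      unfolding subspace_sum_def using fin component_mem[OF gr x(1)]
      by (intro CollectI exI[of _ "\<lambda>g. ?\<phi> (?c g)"] exI[of _ ?K]) auto
  qed
  have indep: "independent_family n ?A"
    unfolding independent_family_def
  proof (intro allI impI)
    fix f K assume f: "finite K" "\<forall>g\<in>K. f g \<in> ?A g" "mat_sum n f K = \<O>"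
    obtain f' where f': "\<forall>g\<in>K. f' g \<in> A g" "\<forall>g\<in>K. f g = ?\<phi> (f' g)" using lift[OF f(2)] by blast
    have fM: "f' g \<in> M" if "g \<in> K" for g using f' gradingD(2)[OF gr] that by blast
    have "\<O> = mat_sum n (\<lambda>g. ?\<phi> (f' g)) K"
      unfolding f(3)[symmetric] by (rule mat_sum_cong) (use f' clos fM in auto)
    then have "?\<phi> (mat_sum n f' K) = \<O>" using sums[OF f(1) fM] by simp
    then have "t' * \<O> * t = mat_sum n f' K" using undo_conj[of "mat_sum n f' K"] fM by simp
    then have "mat_sum n f' K = \<O>" using t by simp
    then have "\<forall>g\<in>K. f' g = \<O>"
      using independent_familyD[OF gr f(1)] f' by blast
    then show "\<forall>g\<in>K. f g = \<O>" using f' t by simp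
  qed
  have mem: "x * y \<in> ?A (g + h)" if xy: "x \<in> ?A g" "y \<in> ?A h" for x y g h
  proof -
    obtain u v where "u \<in> A g" "v \<in> A h" "x = ?\<phi> u" "y = ?\<phi> v" using xy by blast
    then show ?thesis using mult[of u v] gradingD(2,4)[OF gr] by blast
  qed
  show ?thesis unfolding is_grading_def using sub total indep mem by blast
qed

text \<open>Applying the projection \<open>p h\<close> to a vanishing sum of homogeneous elements isolates the summand
  of degree \<open>h\<close>; hence the existence of additive projections already makes the sum direct.\<close>

lemma grading_intro:
  assumes S: "mat_subspace n S" and sub: "\<And>g. mat_subspace n (A g)" "\<And>g. A g \<subseteq> S"
    and mult: "\<And>g h x y. x \<in> A g \<Longrightarrow> y \<in> A h \<Longrightarrow> x * y \<in> A (g + h)"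
    and mem: "\<And>x g. x \<in> S \<Longrightarrow> p g x \<in> A g"
    and fin: "\<And>x. x \<in> S \<Longrightarrow> finite (K x)"
    and tot: "\<And>x. x \<in> S \<Longrightarrow> mat_sum n (\<lambda>g. p g x) (K x) = x"
    and add: "\<And>x y g. x \<in> S \<Longrightarrow> y \<in> S \<Longrightarrow> p g (x + y) = p g x + p g y"
    and hom: "\<And>x g h. x \<in> A h \<Longrightarrow> p g x = (if g = h then x else \<O>)"
  shows "is_grading n S A"
proof -
  note Ss = subspaceD[OF S]
  have pM: "p g x \<in> M" if "x \<in> S" for x g using subspaceD(5)[OF sub(1) mem[OF that]] .
  have "subspace_sum n A UNIV = S"
  proof (intro equalityI subsetI)
    fix x assume "x \<in> subspace_sum n A UNIV"
    then obtain f K where "finite K" "\<forall>g\<in>K. f g \<in> A g" "x = mat_sum n f K"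
      unfolding subspace_sum_def by blast
    then show "x \<in> S" using subspace_mat_sum[OF S, of K f] sub(2) by blast
  next
    fix x assume x: "x \<in> S"
    show "x \<in> subspace_sum n A UNIV"
      unfolding subspace_sum_def using fin[OF x] mem[OF x] tot[OF x]
      by (intro CollectI exI[of _ "\<lambda>g. p g x"] exI[of _ "K x"]) auto
  qed
  moreover have "independent_family n A"
    unfolding independent_family_def
  proof (intro allI impI ballI)
    fix f K h assume f: "finite K" "\<forall>g\<in>K. f g \<in> A g" "mat_sum n f K = \<O>" "h \<in> K"
    have fS: "f g \<in> S" if "g \<in> K" for g using that f sub(2) by blast
    have "\<O> \<in> A h" using subspaceD(2)[OF sub(1)] .
    then have "\<O> = p h (mat_sum n f K)" using hom[of \<O> h h] f by simp
    also have "\<dots> = mat_sum n (\<lambda>g. p h (f g)) K"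
      by (rule conjunct2[OF mat_sum_additive[OF f(1) fS Ss(2,1,3) pM add]])
    also have "\<dots> = mat_sum n (\<lambda>g. if g = h then f h else \<O>) K"
      by (rule mat_sum_cong) (use hom f(2) pM fS in auto)
    also have "\<dots> = f h" by (rule mat_sum_single[OF f(1) _ f(4)]) (use fS f(4) Ss in blast)
    finally show "f h = \<O>" by simp
  qed
  ultimately show ?thesis unfolding is_grading_def using sub mult by blast
qed

end

section \<open>Spaces of matrices with prescribed support\<close>

context square_matrices
begin

definition pattern :: "(nat \<Rightarrow> nat \<Rightarrow> bool) \<Rightarrow> 'a::field mat set" where
  "pattern R = {x \<in> M. \<forall>i<n. \<forall>j<n. \<not> R i j \<longrightarrow> x $$ (i, j) = 0}"

definition E :: "nat \<Rightarrow> nat \<Rightarrow> 'a::field mat" where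
  "E i j = mat n n (\<lambda>(a, c). if a = i \<and> c = j then 1 else 0)"

definition diag :: "(nat \<Rightarrow> bool) \<Rightarrow> 'a::field mat" where
  "diag P = mat n n (\<lambda>(i, j). if i = j \<and> P i then 1 else 0)"

lemma patternD: "x \<in> pattern R \<Longrightarrow> x \<in> M"
    "x \<in> pattern R \<Longrightarrow> i < n \<Longrightarrow> j < n \<Longrightarrow> \<not> R i j \<Longrightarrow> x $$ (i, j) = 0"
  by (auto simp: pattern_def)

lemma patternI:
  "x \<in> M \<Longrightarrow> (\<And>i j. i < n \<Longrightarrow> j < n \<Longrightarrow> \<not> R i j \<Longrightarrow> x $$ (i, j) = 0) \<Longrightarrow> x \<in> pattern R"
  by (auto simp: pattern_def)

lemma pattern_subspace: "mat_subspace n (pattern R)"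
  unfolding mat_subspace_def by (auto simp: pattern_def)

lemma pattern_mono:
  "x \<in> pattern R \<Longrightarrow> (\<And>i j. i < n \<Longrightarrow> j < n \<Longrightarrow> R i j \<Longrightarrow> R' i j) \<Longrightarrow> x \<in> pattern R'"
  by (auto simp: pattern_def)

lemma pattern_mult:
  assumes "x \<in> pattern R" "y \<in> pattern R'"
    "\<And>i k j. i < n \<Longrightarrow> k < n \<Longrightarrow> j < n \<Longrightarrow> R i k \<Longrightarrow> R' k j \<Longrightarrow> R'' i j"
  shows "x * y \<in> pattern R''"
proof (rule patternI)
  note M = patternD(1)[OF assms(1)] patternD(1)[OF assms(2)]
  show "x * y \<in> M" using M by simp
  fix i j assume ij: "i < n" "j < n" "\<not> R'' i j"
  have "x $$ (i, k) * y $$ (k, j) = 0" if "k < n" for k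
    using that ij assms(3) patternD(2)[OF assms(1), of i k] patternD(2)[OF assms(2), of k j] by fastforce
  then show "(x * y) $$ (i, j) = 0" unfolding mult_index[OF M ij(1,2)] by (intro sum.neutral) auto
qed

lemma E_closed [simp]: "E i j \<in> M"
  by (simp add: E_def)

lemma E_index [simp]: "a < n \<Longrightarrow> c < n \<Longrightarrow> E i j $$ (a, c) = (if a = i \<and> c = j then 1 else 0)"
  by (simp add: E_def)

lemma E_pattern: "R i j \<Longrightarrow> E i j \<in> pattern R"
  by (rule patternI) auto

lemma E_nonzero: "i < n \<Longrightarrow> j < n \<Longrightarrow> E i j \<noteq> \<O>"
  using E_index[of i j i j] by (metis index_zero_mat(1) zero_neq_one)

lemma E_mult_index:
  assumes "x \<in> M" "a < n" "c < n" "j < n"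
  shows "(E i j * x) $$ (a, c) = (if a = i then x $$ (j, c) else 0)"
  using assms by (auto simp: mult_index if_distrib[of "\<lambda>y. y * _"] cong: if_cong)

lemma mult_E_index:
  assumes "x \<in> M" "a < n" "c < n" "i < n"
  shows "(x * E i j) $$ (a, c) = (if c = j then x $$ (a, i) else 0)"
  using assms by (auto simp: mult_index if_distrib[of "\<lambda>y. _ * y"] cong: if_cong)

lemma E_mult_E:
  assumes "i < n" "j < n" "k < n" "l < n"
  shows "E i j * E k l = (if j = k then E i l else \<O>)"
  by (rule mat_eqI) (use assms in \<open>auto simp: E_mult_index\<close>)

lemma diag_closed [simp]: "diag P \<in> M"
  by (simp add: diag_def)

lemma diag_index [simp]:
  "i < n \<Longrightarrow> j < n \<Longrightarrow> diag P $$ (i, j) = (if i = j \<and> P i then 1 else 0)"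
  by (simp add: diag_def)

lemma diag_mult_index:
  assumes "x \<in> M" "i < n" "j < n"
  shows "(diag P * x) $$ (i, j) = (if P i then x $$ (i, j) else 0)"
proof -
  have "(diag P * x) $$ (i, j) = (\<Sum>k<n. if k = i then (if P i then x $$ (i, j) else 0) else 0)"
    unfolding mult_index[OF diag_closed assms] by (rule sum.cong) (use assms in auto)
  then show ?thesis using assms by simp
qed

lemma mult_diag_index:
  assumes "x \<in> M" "i < n" "j < n"
  shows "(x * diag P) $$ (i, j) = (if P j then x $$ (i, j) else 0)"
proof -
  have "(x * diag P) $$ (i, j) = (\<Sum>k<n. if k = j then (if P j then x $$ (i, j) else 0) else 0)"
    unfolding mult_index[OF assms(1) diag_closed assms(2,3)] by (rule sum.cong) (use assms in auto)
  then show ?thesis using assms by simp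
qed

lemma pattern_induct [consumes 1, case_names zero add unit]:
  assumes x: "x \<in> pattern R" and zero: "P \<O>"
    and add: "\<And>x y. x \<in> pattern R \<Longrightarrow> y \<in> pattern R \<Longrightarrow> P x \<Longrightarrow> P y \<Longrightarrow> P (x + y)"
    and unit: "\<And>c i j. i < n \<Longrightarrow> j < n \<Longrightarrow> R i j \<Longrightarrow> P (c \<cdot>\<^sub>m E i j)"
  shows "P x"
proof -
  note xM = patternD(1)[OF x]
  note s = subspaceD[OF pattern_subspace[of R]]
  let ?f = "\<lambda>(i, j). if R i j then x $$ (i, j) \<cdot>\<^sub>m E i j else \<O>"
  let ?K = "{..<n} \<times> {..<n}"
  have "mat_sum n ?f ?K \<in> {y \<in> pattern R. P y}"
  proof (rule mat_sum_mem)
    show "?f g \<in> {y \<in> pattern R. P y}" if "g \<in> ?K" for g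
      using that zero unit s(2) s(4)[OF E_pattern[of R]] by (cases g) auto
  qed (use zero add s in auto)
  moreover have "mat_sum n ?f ?K = x"
  proof (rule mat_sum_eqI)
    fix i j assume ij: "i < n" "j < n"
    have "(\<Sum>g\<in>?K. ?f g $$ (i, j)) = (\<Sum>g\<in>?K. if g = (i, j) then x $$ (i, j) else 0)"
    proof (rule sum.cong[OF refl])
      fix g assume "g \<in> ?K"
      then obtain k l where g: "g = (k, l)" "k < n" "l < n" by blast
      show "?f g $$ (i, j) = (if g = (i, j) then x $$ (i, j) else 0)"
        using g ij patternD(2)[OF x, of k l] by (cases "R k l") auto
    qed
    then show "(\<Sum>g\<in>?K. ?f g $$ (i, j)) = x $$ (i, j)" using ij by simp
  qed (use xM in auto)
  ultimately show ?thesis by simp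
qed

end

section \<open>Block patterns\<close>

text \<open>The index \<open>i\<close> belongs to the block \<open>b i\<close>. The arguments below use the order of the blocks
  only, so the indices of a block may lie anywhere; surjectivity says that no block is empty.\<close>

locale block_pattern = square_matrices n for n +
  fixes b :: "nat \<Rightarrow> nat" and s :: nat
  assumes blocks: "b ` {..<n} = {..<s}" and s_pos: "0 < s"
begin

text \<open>\<open>J\<close> is the radical of the block-triangular algebra \<open>U\<close>. The left ideals \<open>T q\<close> of \<open>M\<close> form a flag
  with stabiliser \<open>U\<close>; they correspond to the row spaces \<open>{a. \<forall>j. a j \<noteq> 0 \<longrightarrow> q \<le> b j}\<close>.\<close>

definition U :: "'a::field mat set" where "U = pattern (\<lambda>i j. b i \<le> b j)"
definition J :: "'a::field mat set" where "J = pattern (\<lambda>i j. b i < b j)"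
definition L :: "'a::field mat set" where "L = pattern (\<lambda>i j. b i = 0)"
definition T :: "nat \<Rightarrow> 'a::field mat set" where "T q = pattern (\<lambda>i j. q \<le> b j)"
definition \<Delta> :: "int \<Rightarrow> 'a::field mat set" where "\<Delta> m = pattern (\<lambda>i j. int (b j) = int (b i) + m)"

lemma b_less: "i < n \<Longrightarrow> b i < s"
  using blocks by auto

lemma block_nonempty: "q < s \<Longrightarrow> \<exists>i<n. b i = q"
  using blocks by (auto simp: set_eq_iff image_iff) (metis lessThan_iff)

lemma U_carrier: "x \<in> U \<Longrightarrow> x \<in> M" and J_carrier: "x \<in> J \<Longrightarrow> x \<in> M"
  and L_carrier: "x \<in> L \<Longrightarrow> x \<in> M" and T_carrier: "x \<in> T q \<Longrightarrow> x \<in> M"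
  and \<Delta>_carrier: "x \<in> \<Delta> m \<Longrightarrow> x \<in> M"
  by (auto simp: U_def J_def L_def T_def \<Delta>_def patternD)

lemmas U_subspace = pattern_subspace[of "\<lambda>i j. b i \<le> b j", folded U_def]
lemmas J_subspace = pattern_subspace[of "\<lambda>i j. b i < b j", folded J_def]
lemmas L_subspace = pattern_subspace[of "\<lambda>i j. b i = 0", folded L_def]
lemmas T_subspace = pattern_subspace[of "\<lambda>i j. q \<le> b j" for q, folded T_def]
lemmas \<Delta>_subspace = pattern_subspace[of "\<lambda>i j. int (b j) = int (b i) + m" for m, folded \<Delta>_def]

lemma U_mult: "x \<in> U \<Longrightarrow> y \<in> U \<Longrightarrow> x * y \<in> U"
  unfolding U_def by (erule (1) pattern_mult) auto

lemma J_left_ideal: "x \<in> U \<Longrightarrow> y \<in> J \<Longrightarrow> x * y \<in> J"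
  unfolding U_def J_def by (erule (1) pattern_mult) auto

lemma L_right_ideal: "x \<in> L \<Longrightarrow> y \<in> M \<Longrightarrow> x * y \<in> L"
  unfolding L_def by (erule pattern_mult[where R' = "\<lambda>_ _. True"]) (auto simp: pattern_def)

lemma L_left_ideal: "x \<in> U \<Longrightarrow> y \<in> L \<Longrightarrow> x * y \<in> L"
  unfolding L_def U_def by (erule (1) pattern_mult) auto

lemma T_left_ideal: "x \<in> M \<Longrightarrow> y \<in> T q \<Longrightarrow> x * y \<in> T q"
  unfolding T_def by (rule pattern_mult[where R = "\<lambda>_ _. True"]) (auto simp: pattern_def)

lemma J_subset_U: "x \<in> J \<Longrightarrow> x \<in> U"
  unfolding U_def J_def by (erule pattern_mono) auto

lemma L_subset_U: "x \<in> L \<Longrightarrow> x \<in> U"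
  unfolding U_def L_def by (erule pattern_mono) auto

section \<open>The radical and the first block row are graded\<close>

definition block_trace :: "nat \<Rightarrow> 'a::field mat \<Rightarrow> 'a" where
  "block_trace q x = (\<Sum>i | i < n \<and> b i = q. x $$ (i, i))"

lemma block_trace_zero [simp]: "block_trace q \<O> = 0"
  by (simp add: block_trace_def)

lemma block_trace_add: "x \<in> M \<Longrightarrow> y \<in> M \<Longrightarrow> block_trace q (x + y) = block_trace q x + block_trace q y"
  by (simp add: block_trace_def sum.distrib)

text \<open>The diagonal blocks of a product in \<open>U\<close> are the products of the diagonal blocks.\<close>

lemma block_trace_commute:
  fixes x y :: "'a::field mat"
  assumes x: "x \<in> U" and y: "y \<in> U"
  shows "block_trace q (x * y) = block_trace q (y * x)"
proof -
  let ?I = "{i. i < n \<and> b i = q}"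
  have tr: "block_trace q (x * y) = (\<Sum>i\<in>?I. \<Sum>k\<in>?I. x $$ (i, k) * y $$ (k, i))"
    if x: "x \<in> U" and y: "y \<in> U" for x y :: "'a mat"
    unfolding block_trace_def
  proof (rule sum.cong[OF refl])
    fix i assume i: "i \<in> ?I"
    have "(x * y) $$ (i, i) = (\<Sum>k<n. x $$ (i, k) * y $$ (k, i))"
      by (rule mult_index) (use i U_carrier x y in auto)
    also have "\<dots> = (\<Sum>k\<in>?I. x $$ (i, k) * y $$ (k, i))"
    proof (rule sum.mono_neutral_right)
      show "\<forall>k\<in>{..<n} - ?I. x $$ (i, k) * y $$ (k, i) = 0"
        using patternD(2)[OF x[unfolded U_def], of i] patternD(2)[OF y[unfolded U_def], of _ i] i
        by (metis (mono_tags, lifting) DiffE le_antisym lessThan_iff mem_Collect_eq mult_eq_0_iff)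
    qed auto
    finally show "(x * y) $$ (i, i) = (\<Sum>k\<in>?I. x $$ (i, k) * y $$ (k, i))" .
  qed
  show ?thesis
    unfolding tr[OF x y] tr[OF y x] by (subst sum.swap) (simp add: mult.commute)
qed

text \<open>The trace form of a full matrix algebra is nondegenerate in every characteristic. So the
  radical is the largest left ideal of \<open>U\<close> on which all block traces vanish, and this description
  is compatible with gradings.\<close>

lemma radical_iff:
  fixes x :: "'a::field mat"
  shows "x \<in> J \<longleftrightarrow> x \<in> U \<and> (\<forall>a\<in>U. \<forall>q. block_trace q (a * x) = 0)"
proof (intro iffI conjI ballI allI)
  assume x: "x \<in> J"
  show "x \<in> U" by (rule J_subset_U[OF x])
  fix a :: "'a mat" and q assume "a \<in> U"
  then have "a * x \<in> J" using x by (rule J_left_ideal)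
  then show "block_trace q (a * x) = 0"
    unfolding block_trace_def by (intro sum.neutral) (auto simp: J_def pattern_def)
next
  assume x: "x \<in> U \<and> (\<forall>a\<in>U. \<forall>q. block_trace q (a * x) = 0)"
  then have xM: "x \<in> M" using U_carrier by blast
  show "x \<in> J"
    unfolding J_def
  proof (rule patternI[OF xM])
    fix i j assume ij: "i < n" "j < n" "\<not> b i < b j"
    show "x $$ (i, j) = 0"
    proof (cases "b i = b j")
      case True
      have "(E j i :: 'a mat) \<in> U" unfolding U_def using True by (intro E_pattern) simp
      then have "0 = block_trace (b j) (E j i * x)" using x by simp
      also have "\<dots> = (\<Sum>k | k < n \<and> b k = b j. if k = j then x $$ (i, j) else 0)"
        unfolding block_trace_def by (rule sum.cong) (use ij xM in \<open>auto simp: E_mult_index\<close>)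
      finally show ?thesis using ij by simp
    next
      case False
      then show ?thesis using x ij by (auto simp: U_def pattern_def)
    qed
  qed
qed

lemma block_trace_component_add:
  assumes "is_grading n U B" "x \<in> U" "y \<in> U"
  shows "block_trace q (component n B g (x + y))
    = block_trace q (component n B g x) + block_trace q (component n B g y)"
  by (simp add: component_add[OF assms] block_trace_add component_closed[OF assms(1)] assms(2,3))

text \<open>For homogeneous \<open>x\<close> and \<open>y\<close> the products \<open>x * y\<close> and \<open>y * x\<close> have the same degree, because
  the grading group is commutative.\<close>

lemma block_trace_component_commute:
  fixes B :: "'g::ab_group_add \<Rightarrow> 'a::field mat set"
  assumes gr: "is_grading n U B" and x: "x \<in> U" and y: "y \<in> U"
  shows "block_trace q (component n B g (x * y)) = block_trace q (component n B g (y * x))"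
  using gr graded_subspace_whole[OF gr] x
proof (induction rule: homogeneous_induct)
  case zero
  then show ?case using U_carrier[OF y] by simp
next
  case (add u v)
  then have "(u + v) * y = u * y + v * y" "y * (u + v) = y * u + y * v"
    using y by (auto intro: distrib_left distrib_right U_carrier)
  then show ?case
    using block_trace_component_add[OF gr] add y by (simp add: U_mult)
next
  case (homogeneous h u)
  note u = homogeneous
  show ?case
    using gr graded_subspace_whole[OF gr] y
  proof (induction rule: homogeneous_induct)
    case zero
    then show ?case using U_carrier[OF u(1)] by simp
  next
    case (add v w)
    then have "(v + w) * u = v * u + w * u" "u * (v + w) = u * v + u * w"
      using u(1) by (auto intro: distrib_left distrib_right U_carrier)
    then show ?case
      using block_trace_component_add[OF gr] add u(1) by (simp add: U_mult)
  next
    case (homogeneous k v)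
    have "u * v \<in> B (h + k)" "v * u \<in> B (h + k)"
      using gradingD(4)[OF gr u(2) homogeneous(2)] gradingD(4)[OF gr homogeneous(2) u(2)]
      by (simp_all add: add.commute)
    then show ?case
      using component_homogeneous[OF gr] block_trace_commute[OF u(1) homogeneous(1)] by simp
  qed
qed

text \<open>A matrix unit in \<open>J\<close> is its own commutator with the idempotent of its row.\<close>

lemma J_unit_commutator:
  assumes "i < n" "j < n" "b i < b j"
  shows "E i i \<in> U" "c \<cdot>\<^sub>m E i j \<in> U" "E i i * (c \<cdot>\<^sub>m E i j) = c \<cdot>\<^sub>m E i j"
    "(c \<cdot>\<^sub>m E i j) * E i i = \<O>"
proof -
  show "E i i \<in> U" unfolding U_def by (rule E_pattern) simp
  show "c \<cdot>\<^sub>m E i j \<in> U"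
    using subspaceD(4)[OF U_subspace] E_pattern[of "\<lambda>i j. b i \<le> b j" i j] assms by (auto simp: U_def)
  show "E i i * (c \<cdot>\<^sub>m E i j) = c \<cdot>\<^sub>m E i j" "(c \<cdot>\<^sub>m E i j) * E i i = \<O>"
    using assms by (auto simp: mult_smult smult_mult E_mult_E)
qed

text \<open>By the two preceding facts all components of elements of \<open>J\<close> have vanishing block traces.
  For homogeneous \<open>a\<close> the components of \<open>a * x\<close> are the products of \<open>a\<close> with the components of \<open>x\<close>,
  and \<open>a * x\<close> lies in \<open>J\<close>, so the trace criterion applies to the components of \<open>x\<close>.\<close>

lemma J_graded:
  fixes B :: "'g::ab_group_add \<Rightarrow> 'a::field mat set"
  assumes gr: "is_grading n U B"
  shows "graded_subspace n U B J"
  unfolding graded_subspace_def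
proof (intro conjI ballI allI)
  have trace: "block_trace q (component n B g x) = 0" if "x \<in> J" for q g and x :: "'a mat"
    using that unfolding J_def
  proof (induction rule: pattern_induct)
    case zero
    then show ?case by (simp add: component_zero[OF gr])
  next
    case (add x y)
    then have "x \<in> U" "y \<in> U" by (auto simp: J_def[symmetric] intro: J_subset_U)
    then show ?case using add block_trace_component_add[OF gr] by simp
  next
    case (unit c i j)
    note e = J_unit_commutator[OF unit]
    show ?case
      using block_trace_component_commute[OF gr e(1) e(2)[of c], of q g] e(3,4)[of c]
        component_zero[OF gr] by simp
  qed
  fix x :: "'a mat" and g assume x: "x \<in> J"
  have xU: "x \<in> U" by (rule J_subset_U[OF x])
  let ?y = "component n B g x"
  have yU: "?y \<in> U" using homogeneous_subset[OF gr component_mem[OF gr xU]] .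
  have "block_trace q (a * ?y) = 0" if a: "a \<in> U" for a q
    using gr graded_subspace_whole[OF gr] a
  proof (induction rule: homogeneous_induct)
    case zero
    then show ?case using U_carrier[OF yU] by simp
  next
    case (add u v)
    then show ?case using yU by (simp add: distrib_right block_trace_add U_carrier)
  next
    case (homogeneous k u)
    then show ?case
      using trace[OF J_left_ideal[OF homogeneous(1) x], of q "k + g"]
        component_mult_left[OF gr homogeneous(2) xU, of g] by simp
  qed
  then show "?y \<in> J" using radical_iff yU by blast
qed (use J_subspace J_subset_U in auto)

text \<open>As the annihilator of \<open>J\<close> in \<open>U\<close>, the first block row inherits being graded from \<open>J\<close>.\<close>

lemma L_iff:
  fixes x :: "'a::field mat"
  shows "x \<in> L \<longleftrightarrow> x \<in> U \<and> (\<forall>y\<in>J. y * x = \<O>)"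
proof (intro iffI conjI ballI)
  assume x: "x \<in> L"
  show "x \<in> U" by (rule L_subset_U[OF x])
  fix y :: "'a mat" assume "y \<in> J"
  then have "y * x \<in> pattern (\<lambda>_ _. False)"
    using x unfolding J_def L_def by (rule pattern_mult) auto
  then show "y * x = \<O>" by (intro mat_eqI) (auto simp: pattern_def)
next
  assume x: "x \<in> U \<and> (\<forall>y\<in>J. y * x = \<O>)"
  then have xM: "x \<in> M" using U_carrier by blast
  obtain k where k: "k < n" "b k = 0" using block_nonempty[OF s_pos] by blast
  show "x \<in> L"
    unfolding L_def
  proof (rule patternI[OF xM])
    fix i j assume ij: "i < n" "j < n" "b i \<noteq> 0"
    have "(E k i :: 'a mat) \<in> J" unfolding J_def using k ij by (intro E_pattern) simp
    then have "E k i * x = \<O>" using x by blast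
    moreover have "(E k i * x) $$ (k, j) = x $$ (i, j)" using k ij xM by (simp add: E_mult_index)
    ultimately show "x $$ (i, j) = 0" using k ij by simp
  qed
qed

lemma L_graded:
  fixes B :: "'g::ab_group_add \<Rightarrow> 'a::field mat set"
  assumes gr: "is_grading n U B"
  shows "graded_subspace n U B L"
  unfolding graded_subspace_def
proof (intro conjI ballI allI)
  fix x :: "'a mat" and g assume x: "x \<in> L"
  have xU: "x \<in> U" by (rule L_subset_U[OF x])
  let ?y = "component n B g x"
  have yU: "?y \<in> U" using homogeneous_subset[OF gr component_mem[OF gr xU]] .
  have "a * ?y = \<O>" if a: "a \<in> J" for a
    using gr J_graded[OF gr] a
  proof (induction rule: homogeneous_induct)
    case zero
    then show ?case using U_carrier[OF yU] by simp
  next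
    case (add u v)
    then show ?case using yU by (simp add: distrib_right J_carrier U_carrier)
  next
    case (homogeneous k u)
    have "u * ?y = component n B (k + g) (u * x)"
      using component_mult_left[OF gr homogeneous(2) xU, of g] by simp
    also have "u * x = \<O>" using x homogeneous(1) L_iff by blast
    finally show ?case using component_zero[OF gr] by simp
  qed
  then show "?y \<in> L" using L_iff yU by blast
qed (use L_subspace L_subset_U in auto)

section \<open>Extending a grading from \<open>U\<close> to all matrices\<close>

text \<open>The right ideal \<open>L\<close> of \<open>M\<close> lies in \<open>U\<close>, so it carries the grading \<open>B\<close>, and \<open>M\<close> acts on it
  faithfully from the right. A matrix gets degree \<open>g\<close> if it raises the degrees in \<open>L\<close> by \<open>g\<close>.\<close>

definition ext :: "('g::ab_group_add \<Rightarrow> 'a::field mat set) \<Rightarrow> 'g \<Rightarrow> 'a mat set" where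
  "ext B g = {x \<in> M. \<forall>h. \<forall>y\<in>L \<inter> B h. y * x \<in> B (g + h)}"

lemma L_faithful:
  fixes B :: "'g::ab_group_add \<Rightarrow> 'a::field mat set"
  assumes gr: "is_grading n U B" and xx': "x \<in> M" "x' \<in> M"
    and eq: "\<And>h y. y \<in> L \<Longrightarrow> y \<in> B h \<Longrightarrow> y * x = y * x'"
  shows "x = x'"
proof -
  have all: "y * x = y * x'" if "y \<in> L" for y
    using gr L_graded[OF gr] that
    by (induction rule: homogeneous_induct) (use xx' eq in \<open>auto simp: distrib_right L_carrier\<close>)
  obtain k where k: "k < n" "b k = 0" using block_nonempty[OF s_pos] by blast
  show ?thesis
  proof (rule mat_eqI[OF xx'])
    fix i j assume ij: "i < n" "j < n"
    have "(E k i :: 'a mat) \<in> L" unfolding L_def using k by (intro E_pattern) simp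
    then have "(E k i * x) $$ (k, j) = (E k i * x') $$ (k, j)" using all by simp
    then show "x $$ (i, j) = x' $$ (i, j)" using xx' k ij by (simp add: E_mult_index)
  qed
qed

text \<open>The degrees that occur in the finitely many matrix units of \<open>U\<close> suffice.\<close>

lemma finite_grading_support:
  fixes B :: "'g::ab_group_add \<Rightarrow> 'a::field mat set"
  assumes gr: "is_grading n U B"
  shows "\<exists>K. finite K \<and> (\<forall>x\<in>U. \<forall>g. g \<notin> K \<longrightarrow> component n B g x = \<O>)"
proof -
  define I where "I = {(i, j). i < n \<and> j < n \<and> b i \<le> b j}"
  have "I \<subseteq> {..<n} \<times> {..<n}" by (auto simp: I_def)
  then have finI: "finite I" by (rule finite_subset) simp
  have EU: "(E i j :: 'a mat) \<in> U" if "(i, j) \<in> I" for i j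
    unfolding U_def using that by (intro E_pattern) (simp add: I_def)
  let ?K = "\<Union>(i, j)\<in>I. {g. component n B g (E i j) \<noteq> \<O>}"
  have "finite ?K" using finI EU finite_component_support[OF gr] by auto
  moreover have "component n B g x = \<O>" if x: "x \<in> U" and g: "g \<notin> ?K" for x :: "'a mat" and g
    using x unfolding U_def
  proof (induction rule: pattern_induct)
    case zero
    then show ?case by (rule component_zero[OF gr])
  next
    case (add x y)
    then show ?case using component_add[OF gr] by (simp add: U_def)
  next
    case (unit c i j)
    then have ij: "(i, j) \<in> I" by (simp add: I_def)
    then have "component n B g (E i j) = \<O>" using g by auto
    then show ?case using component_smult[OF gr EU[OF ij]] by simp
  qed
  ultimately show ?thesis by blast
qed

text \<open>The map \<open>y \<mapsto> (y x)\<^bsub>g + h\<^esub>\<close> for \<open>y \<in> L\<close> of degree \<open>h\<close> commutes with left multiplication by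
  \<open>U\<close>, and every such endomorphism of the first block row is right multiplication by a matrix.\<close>

lemma ext_component_exists:
  fixes B :: "'g::ab_group_add \<Rightarrow> 'a::field mat set"
  assumes gr: "is_grading n U B" and x: "x \<in> M"
  shows "\<exists>z\<in>M. \<forall>h. \<forall>y\<in>L \<inter> B h. y * z = component n B (g + h) (y * x)"
proof -
  obtain K where K0: "finite K \<and> (\<forall>x\<in>U. \<forall>g. g \<notin> K \<longrightarrow> component n B g x = \<O>)"
    using finite_grading_support[OF gr] ..
  have K: "finite K" "\<And>x g. x \<in> U \<Longrightarrow> g \<notin> K \<Longrightarrow> component n B g x = \<O>"
    using K0 by simp_all
  note Lg = L_graded[OF gr]
  define \<theta> where "\<theta> = (\<lambda>y. mat_sum n (\<lambda>h. component n B (g + h) (component n B h y * x)) K)"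
  have compL: "component n B h y \<in> L" if "y \<in> L" for h y using graded_subspaceD(3)[OF Lg that] .
  have cx: "component n B h y * x \<in> U" if "y \<in> L" for h y
    using L_subset_U[OF L_right_ideal[OF compL[OF that] x]] .
  have cM: "component n B (g + h) (component n B h y * x) \<in> M" if "y \<in> L" for h y
    using component_closed[OF gr cx[OF that]] .
  have \<theta>M: "\<theta> y \<in> M" if "y \<in> L" for y
    unfolding \<theta>_def by (rule mat_sum_closed) (rule cM[OF that])
  have \<theta>_add: "\<theta> (y + z) = \<theta> y + \<theta> z" if yz: "y \<in> L" "z \<in> L" for y z
  proof -
    have "component n B (g + h) (component n B h (y + z) * x)
      = component n B (g + h) (component n B h y * x) + component n B (g + h) (component n B h z * x)" for h
    proof -
      have "component n B h (y + z) * x = component n B h y * x + component n B h z * x"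
        using component_add[OF gr] yz compL x by (simp add: distrib_right L_subset_U L_carrier)
      then show ?thesis using component_add[OF gr cx cx] yz by simp
    qed
    then show ?thesis unfolding \<theta>_def using mat_sum_add[OF K(1) cM cM] yz by simp
  qed
  have \<theta>_zero: "\<theta> \<O> = \<O>"
  proof (rule double_eq_self_imp_zero)
    show "\<theta> \<O> \<in> M" by (rule \<theta>M[OF subspaceD(2)[OF L_subspace]])
    show "\<theta> \<O> = \<theta> \<O> + \<theta> \<O>"
      using \<theta>_add[OF subspaceD(2)[OF L_subspace] subspaceD(2)[OF L_subspace]] by simp
  qed
  have \<theta>_hom: "\<theta> y = component n B (g + h) (y * x)" if y: "y \<in> L" "y \<in> B h" for y h
  proof -
    have yU: "y \<in> U" and yM: "y \<in> M" using y(1) by (auto intro: L_subset_U L_carrier)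
    have z: "component n B k \<O> = \<O>" for k by (rule component_zero[OF gr])
    have c: "component n B k y = (if k = h then y else \<O>)" for k
      by (rule component_homogeneous[OF gr y(2)])
    have w: "component n B (g + h) (y * x) \<in> M" using cM[OF y(1), of h] c by simp
    have "component n B (g + k) (component n B k y * x)
        = (if k = h then component n B (g + h) (y * x) else \<O>)" for k
      using c z x by auto
    then have eq: "\<theta> y = mat_sum n (\<lambda>k. if k = h then component n B (g + h) (y * x) else \<O>) K"
      unfolding \<theta>_def by simp
    show ?thesis
    proof (cases "h \<in> K")
      case True
      then show ?thesis using eq mat_sum_single[OF K(1) w] by simp
    next
      case False
      then have "y = \<O>" using K(2)[OF yU False] c by simp
      then show ?thesis using \<theta>_zero z x by simp
    qed
  qed
  have \<theta>_left: "\<theta> (a * y) = a * \<theta> y" if a: "a \<in> U" and y: "y \<in> L" for a y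
    using gr graded_subspace_whole[OF gr] a
  proof (induction rule: homogeneous_induct)
    case zero
    show ?case using L_carrier[OF y] \<theta>M[OF y] \<theta>_zero by simp
  next
    case (add u v)
    then show ?case using \<theta>_add y L_carrier[OF y] \<theta>M[OF y]
      by (simp add: distrib_right L_left_ideal U_carrier)
  next
    case (homogeneous k u)
    note u = homogeneous
    have uM: "u \<in> M" using U_carrier[OF u(1)] .
    show ?case using gr Lg y
    proof (induction rule: homogeneous_induct)
      case zero
      show ?case using uM \<theta>_zero by simp
    next
      case (add v w)
      then show ?case using \<theta>_add L_left_ideal[OF u(1)] uM \<theta>M by (simp add: distrib_left L_carrier)
    next
      case (homogeneous h v)
      have vx: "v * x \<in> U" using L_subset_U[OF L_right_ideal[OF homogeneous(1) x]] .
      have "\<theta> (u * v) = component n B (g + (k + h)) (u * v * x)"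
        using \<theta>_hom[OF L_left_ideal[OF u(1) homogeneous(1)] gradingD(4)[OF gr u(2) homogeneous(2)]] .
      also have "\<dots> = component n B (k + (g + h)) (u * (v * x))"
        using uM x L_carrier[OF homogeneous(1)] by (simp add: mult_assoc add.left_commute)
      also have "\<dots> = u * \<theta> v"
        using component_mult_left[OF gr u(2) vx] \<theta>_hom[OF homogeneous] by simp
      finally show ?case .
    qed
  qed
  obtain k where k: "k < n" "b k = 0" using block_nonempty[OF s_pos] by blast
  have EkL: "(E k j :: 'a mat) \<in> L" for j unfolding L_def using k by (intro E_pattern) simp
  define z where "z = mat n n (\<lambda>(j, l). \<theta> (E k j) $$ (k, l))"
  have zM: "z \<in> M" by (simp add: z_def)
  have "\<theta> y = y * z" if "y \<in> L" for y
    using that unfolding L_def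
  proof (induction rule: pattern_induct)
    case zero
    show ?case using zM \<theta>_zero by simp
  next
    case (add u v)
    then show ?case using \<theta>_add zM by (simp add: distrib_right L_def[symmetric] L_carrier)
  next
    case (unit c i j)
    have ik: "c \<cdot>\<^sub>m E i k \<in> U"
      unfolding U_def by (rule subspaceD(4)[OF pattern_subspace E_pattern]) (simp add: unit)
    have "c \<cdot>\<^sub>m E i j = (c \<cdot>\<^sub>m E i k) * E k j"
      using unit k by (simp add: smult_mult E_mult_E)
    then have "\<theta> (c \<cdot>\<^sub>m E i j) = c \<cdot>\<^sub>m (E i k * \<theta> (E k j))"
      using \<theta>_left[OF ik EkL] \<theta>M[OF EkL] by (simp add: smult_mult)
    also have "\<dots> = (c \<cdot>\<^sub>m E i j) * z"
    proof (rule mat_eqI)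
      fix l m assume lm: "l < n" "m < n"
      have "(E i k * \<theta> (E k j)) $$ (l, m) = (E i j * z) $$ (l, m)"
        using lm unit k \<theta>M[OF EkL] zM by (auto simp: E_mult_index z_def)
      then show "(c \<cdot>\<^sub>m (E i k * \<theta> (E k j))) $$ (l, m) = (c \<cdot>\<^sub>m E i j * z) $$ (l, m)"
        using lm \<theta>M[OF EkL] zM smult_entry[of "E i k * \<theta> (E k j)" l m c]
          smult_entry[of "E i j * z" l m c] by (simp add: smult_mult)
    qed (use zM \<theta>M[OF EkL] in auto)
    finally show ?case .
  qed
  then show ?thesis using zM \<theta>_hom by (metis IntE)
qed

lemma ext_grading:
  fixes B :: "'g::ab_group_add \<Rightarrow> 'a::field mat set"
  assumes gr: "is_grading n U B"
  shows "is_grading n M (ext B)"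
proof -
  obtain K where K0: "finite K \<and> (\<forall>x\<in>U. \<forall>g. g \<notin> K \<longrightarrow> component n B g x = \<O>)"
    using finite_grading_support[OF gr] ..
  have K: "finite K" "\<And>x g. x \<in> U \<Longrightarrow> g \<notin> K \<Longrightarrow> component n B g x = \<O>"
    using K0 by simp_all
  obtain p where p: "\<And>x g. x \<in> M \<Longrightarrow> p g x \<in> M"
    "\<And>x g h y. x \<in> M \<Longrightarrow> y \<in> L \<Longrightarrow> y \<in> B h \<Longrightarrow> y * p g x = component n B (g + h) (y * x)"
  proof -
    let ?Q = "\<lambda>g x z. z \<in> M \<and> (\<forall>h. \<forall>y\<in>L \<inter> B h. y * z = component n B (g + h) (y * x))"
    have ex: "?Q g x (SOME z. ?Q g x z)" if "x \<in> M" for g x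
      by (rule someI_ex) (use ext_component_exists[OF gr that, of g] in blast)
    show thesis by (rule that[of "\<lambda>g x. SOME z. ?Q g x z"]) (use ex in blast)+
  qed
  have yx: "y * x \<in> U" if "y \<in> L" "x \<in> M" for x y :: "'a mat"
    by (rule L_subset_U[OF L_right_ideal[OF that]])
  have Bs: "mat_subspace n (B g)" for g by (rule gradingD(1)[OF gr])
  define K' where "K' = (\<lambda>(k, h). k - h) ` (K \<times> K)"
  have finK': "finite K'" unfolding K'_def using K(1) by simp
  show ?thesis
  proof (rule grading_intro[where p = p and K = "\<lambda>_. K'"])
    show "mat_subspace n (ext B g)" for g
      unfolding mat_subspace_def ext_def
      using subspaceD[OF Bs] by (auto simp: distrib_left mult_smult L_carrier)
    show "ext B g \<subseteq> M" for g by (auto simp: ext_def)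
    show "x * y \<in> ext B (g + k)" if x: "x \<in> ext B g" and y: "y \<in> ext B k" for g k and x y :: "'a mat"
    proof -
      have xM: "x \<in> M" and yM: "y \<in> M" using x y by (auto simp: ext_def)
      have "u * (x * y) \<in> B (g + k + h)" if u: "u \<in> L" "u \<in> B h" for u h
      proof -
        have "u * x \<in> L" using L_right_ideal[OF u(1) xM] .
        moreover have "u * x \<in> B (g + h)" using x u by (auto simp: ext_def)
        ultimately have "u * x * y \<in> B (k + (g + h))" using y by (auto simp: ext_def)
        then show ?thesis using xM yM L_carrier[OF u(1)] by (simp add: mult_assoc ac_simps)
      qed
      then show ?thesis using xM yM by (auto simp: ext_def)
    qed
    show "p g x \<in> ext B g" if "x \<in> M" for x :: "'a mat" and g
      using that p component_mem[OF gr yx] by (auto simp: ext_def)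
    show "mat_sum n (\<lambda>g. p g x) K' = x" if x: "x \<in> M" for x :: "'a mat"
    proof (rule L_faithful[OF gr _ x])
      show "mat_sum n (\<lambda>g. p g x) K' \<in> M" using p(1)[OF x] by simp
      fix h y assume y: "y \<in> L" "y \<in> B h"
      have yM: "y \<in> M" by (rule L_carrier[OF y(1)])
      show "y * mat_sum n (\<lambda>g. p g x) K' = y * x"
      proof (cases "h \<in> K")
        case False
        then have "y = \<O>"
          using K(2)[OF L_subset_U[OF y(1)]] component_homogeneous[OF gr y(2), of h] by simp
        moreover have "mat_sum n (\<lambda>g. p g x) K' \<in> M" using p(1)[OF x] by simp
        ultimately show ?thesis using x by simp
      next
        case True
        have "y * mat_sum n (\<lambda>g. p g x) K' = mat_sum n (\<lambda>g. y * p g x) K'"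
          by (rule mat_sum_mult_left) (use finK' p(1)[OF x] yM in auto)
        also have "\<dots> = mat_sum n (\<lambda>g. component n B (g + h) (y * x)) K'"
          using p(2)[OF x y] by simp
        also have "\<dots> = mat_sum n (\<lambda>g. component n B g (y * x)) ((\<lambda>g. g + h) ` K')"
          by (rule mat_sum_reindex[symmetric]) (use finK' component_closed[OF gr yx[OF y(1) x]] in auto)
        also have "\<dots> = y * x"
        proof (rule component_sum[OF gr yx[OF y(1) x]])
          show "finite ((\<lambda>g. g + h) ` K')" using finK' by simp
          have "k \<in> (\<lambda>g. g + h) ` K'" if "k \<in> K" for k
          proof -
            have "k - h \<in> K'" unfolding K'_def using that True by force
            then show ?thesis by (metis diff_add_cancel image_eqI)
          qed
          then show "{g. component n B g (y * x) \<noteq> \<O>} \<subseteq> (\<lambda>g. g + h) ` K'"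
            using K(2)[OF yx[OF y(1) x]] by blast
        qed
        finally show ?thesis .
      qed
    qed
    show "p g (x + y) = p g x + p g y" if xy: "x \<in> M" "y \<in> M" for x y :: "'a mat" and g
    proof (rule L_faithful[OF gr])
      fix h u assume u: "u \<in> L" "u \<in> B h"
      have "u * p g (x + y) = component n B (g + h) (u * x + u * y)"
        using p(2)[of "x + y" u h g] u xy by (simp add: distrib_left L_carrier)
      also have "\<dots> = u * (p g x + p g y)"
        using component_add[OF gr] yx u xy p by (simp add: distrib_left L_carrier)
      finally show "u * p g (x + y) = u * (p g x + p g y)" .
    qed (use xy p in auto)
    show "p g x = (if g = k then x else \<O>)" if x: "x \<in> ext B k" for x g k
    proof (rule L_faithful[OF gr])
      have xM: "x \<in> M" using x by (auto simp: ext_def)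
      show "p g x \<in> M" "(if g = k then x else \<O>) \<in> M" using p(1)[OF xM] xM by auto
      fix h u assume u: "u \<in> L" "u \<in> B h"
      have ux: "u * x \<in> B (k + h)" using x u by (auto simp: ext_def)
      show "u * p g x = u * (if g = k then x else \<O>)"
        using p(2)[OF xM u, of g] component_homogeneous[OF gr ux, of "g + h"] L_carrier[OF u(1)]
        by simp
    qed
  qed (use finK' subspace_carrier in auto)
qed

lemma subset_ext:
  assumes gr: "is_grading n U B"
  shows "B g \<subseteq> ext B g"
  using gradingD(2,4)[OF gr] by (auto simp: ext_def add.commute[of g])

text \<open>In any grading of \<open>M\<close> that extends \<open>B\<close>, an element of degree \<open>g\<close> raises the degrees in \<open>L\<close> by \<open>g\<close>,
  hence lies in \<open>ext B g\<close>; and gradings are incomparable.\<close>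

lemma extension_unique:
  assumes B: "is_grading n U B" and D: "is_grading n M D" and le: "\<And>g. B g \<subseteq> D g"
  shows "D = ext B"
proof (rule grading_le_eq[OF D ext_grading[OF B]], rule subsetI)
  fix g x assume x: "x \<in> D g"
  have xM: "x \<in> M" using gradingD(2)[OF D x] .
  have "y * x \<in> B (g + h)" if y: "y \<in> L" "y \<in> B h" for y h
  proof -
    have yxU: "y * x \<in> U" using L_subset_U[OF L_right_ideal[OF y(1) xM]] .
    have "y * x \<in> D (h + g)" using gradingD(4)[OF D _ x] le y by blast
    then have "component n D (g + h) (y * x) = y * x"
      using component_homogeneous[OF D] by (simp add: add.commute)
    then have "component n B (g + h) (y * x) = y * x"
      using component_coarser[OF B D le yxU] by simp
    then show ?thesis using component_mem[OF B yxU, of "g + h"] by simp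
  qed
  then show "x \<in> ext B g" using xM by (auto simp: ext_def)
qed

end

section \<open>Refinements and conjugation of idempotents\<close>

context square_matrices
begin

lemma grading_refine:
  fixes D :: "'g::ab_group_add \<Rightarrow> 'a::field mat set" and Z :: "'h::ab_group_add \<Rightarrow> 'a mat set"
  assumes D: "is_grading n S D" and Z: "is_grading n S Z"
    and DZ: "\<And>m. graded_subspace n S D (Z m)"
  shows "is_grading n S (\<lambda>k. Z (fst k) \<inter> D (snd k))"
proof -
  let ?p = "\<lambda>k x. component n D (snd k) (component n Z (fst k) x)"
  let ?K = "\<lambda>x. SIGMA m:{m. component n Z m x \<noteq> \<O>}. {g. component n D g (component n Z m x) \<noteq> \<O>}"
  have ZS: "component n Z m x \<in> S" if "x \<in> S" for m x
    by (rule homogeneous_subset[OF Z component_mem[OF Z that]])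
  have pM: "?p k x \<in> M" if "x \<in> S" for k x by (rule component_closed[OF D ZS[OF that]])
  have fin: "finite (?K x)" if "x \<in> S" for x
    using finite_component_support[OF Z that] finite_component_support[OF D ZS[OF that]] by auto
  show ?thesis
  proof (rule grading_intro[where p = ?p and K = ?K])
    show "mat_subspace n S" by (rule grading_total_subspace[OF D])
    show "mat_subspace n (Z (fst k) \<inter> D (snd k))" for k
      using gradingD(1)[OF Z, of "fst k"] gradingD(1)[OF D, of "snd k"]
      by (auto simp: mat_subspace_def)
    show "Z (fst k) \<inter> D (snd k) \<subseteq> S" for k using homogeneous_subset[OF Z] by auto
    show "x * y \<in> Z (fst (k + l)) \<inter> D (snd (k + l))"
      if "x \<in> Z (fst k) \<inter> D (snd k)" "y \<in> Z (fst l) \<inter> D (snd l)" for k l x y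
      using that gradingD(4)[OF Z] gradingD(4)[OF D] by simp
    show "?p k x \<in> Z (fst k) \<inter> D (snd k)" if "x \<in> S" for x k
      using component_mem[OF D ZS[OF that]] graded_subspaceD(3)[OF DZ component_mem[OF Z that]] by simp
    show "finite (?K x)" if "x \<in> S" for x by (rule fin[OF that])
    show "mat_sum n (\<lambda>k. ?p k x) (?K x) = x" if x: "x \<in> S" for x
    proof (rule mat_sum_eqI[OF fin[OF x] pM[OF x] grading_carrier[OF D x]])
      fix i j assume ij: "i < n" "j < n"
      note finZ = finite_component_support[OF Z x]
      note finD = finite_component_support[OF D ZS[OF x]]
      have "(\<Sum>k\<in>?K x. ?p k x $$ (i, j)) = (\<Sum>m | component n Z m x \<noteq> \<O>.
          \<Sum>g | component n D g (component n Z m x) \<noteq> \<O>. component n D g (component n Z m x) $$ (i, j))"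
        by (subst sum.Sigma) (use finZ finD in \<open>auto simp: split_def\<close>)
      also have "\<dots> = (\<Sum>m | component n Z m x \<noteq> \<O>. component n Z m x $$ (i, j))"
      proof (rule sum.cong[OF refl])
        fix m
        let ?y = "component n Z m x"
        have "mat_sum n (\<lambda>g. component n D g ?y) {g. component n D g ?y \<noteq> \<O>} $$ (i, j)
            = (\<Sum>g | component n D g ?y \<noteq> \<O>. component n D g ?y $$ (i, j))"
          by (rule mat_sum_index[OF finD component_closed[OF D ZS[OF x]] ij])
        then show "(\<Sum>g | component n D g ?y \<noteq> \<O>. component n D g ?y $$ (i, j)) = ?y $$ (i, j)"
          using component_sum[OF D ZS[OF x] finD subset_refl, of m] by simp
      qed
      also have "\<dots> = mat_sum n (\<lambda>m. component n Z m x) {m. component n Z m x \<noteq> \<O>} $$ (i, j)"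
        by (rule mat_sum_index[OF finZ component_closed[OF Z x] ij, symmetric])
      finally show "(\<Sum>k\<in>?K x. ?p k x $$ (i, j)) = x $$ (i, j)"
        using component_sum[OF Z x finZ subset_refl] by simp
    qed
    show "?p k (x + y) = ?p k x + ?p k y" if "x \<in> S" "y \<in> S" for x y k
      using component_add[OF Z that] component_add[OF D ZS[OF that(1)] ZS[OF that(2)]] by simp
    show "?p k x = (if k = l then x else \<O>)" if "x \<in> Z (fst l) \<inter> D (snd l)" for x k l
      using that component_homogeneous[OF Z, of x "fst l" "fst k"]
        component_homogeneous[OF D, of x "snd l" "snd k"] component_zero[OF D]
      by (auto simp: prod_eq_iff)
  qed
qed

text \<open>For \<open>x\<close> homogeneous of degree \<open>k\<close>, compare the components of degree \<open>k\<close> in \<open>x * f = x\<close>.\<close>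

lemma homogeneous_right_identity:
  fixes D :: "'g::ab_group_add \<Rightarrow> 'a::field mat set"
  assumes D: "is_grading n S D" and V: "graded_subspace n S D V"
    and f: "f \<in> V" and id: "\<And>x. x \<in> V \<Longrightarrow> x * f = x" and x: "x \<in> V"
  shows "x * component n D 0 f = x"
proof -
  have fS: "f \<in> S" by (rule graded_subspaceD(2)[OF V f])
  have rM: "component n D 0 f \<in> M" by (rule component_closed[OF D fS])
  have VM: "x \<in> M" if "x \<in> V" for x using subspaceD(5)[OF graded_subspaceD(1)[OF V] that] .
  show ?thesis
    using D V x
  proof (induction rule: homogeneous_induct)
    case zero
    then show ?case using rM by simp
  next
    case (add x y)
    then show ?case using rM VM by (simp add: distrib_right)
  next
    case (homogeneous k x)
    have "x * component n D 0 f = component n D (k + 0) (x * f)"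
      by (rule component_mult_left[OF D homogeneous(2) fS, symmetric])
    also have "\<dots> = x"
      using id[OF homogeneous(1)] component_homogeneous[OF D homogeneous(2), of k] by simp
    finally show ?case .
  qed
qed

text \<open>The change of basis between two decompositions of \<open>1\<close> into orthogonal idempotents. It is
  invertible when \<open>e q\<close> and \<open>e' q\<close> restrict to inverse isomorphisms between their images.\<close>

definition intertwiner :: "nat \<Rightarrow> (nat \<Rightarrow> 'a::field mat) \<Rightarrow> (nat \<Rightarrow> 'a mat) \<Rightarrow> 'a mat" where
  "intertwiner s e e' = mat_sum n (\<lambda>q. e q * e' q) {..<s}"

lemma intertwiner:
  fixes e e' :: "nat \<Rightarrow> 'a::field mat"
  assumes M: "\<And>q. q < s \<Longrightarrow> e q \<in> M" "\<And>q. q < s \<Longrightarrow> e' q \<in> M"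
    and orth: "\<And>p q. p < s \<Longrightarrow> q < s \<Longrightarrow> e p * e q = (if p = q then e q else \<O>)"
      "\<And>p q. p < s \<Longrightarrow> q < s \<Longrightarrow> e' p * e' q = (if p = q then e' q else \<O>)"
  shows intertwiner_closed: "intertwiner s e e' \<in> M"
    and intertwiner_left: "q < s \<Longrightarrow> e q * intertwiner s e e' = e q * e' q"
    and intertwiner_right: "q < s \<Longrightarrow> intertwiner s e e' * e' q = e q * e' q"
proof -
  let ?t = "intertwiner s e e'"
  have ee: "e q * e' q \<in> M" if "q < s" for q using M that by simp
  show "?t \<in> M" unfolding intertwiner_def by (rule mat_sum_closed) (use ee in auto)
  assume q: "q < s"
  have "e q * ?t = mat_sum n (\<lambda>p. e q * (e p * e' p)) {..<s}"
    unfolding intertwiner_def by (rule mat_sum_mult_left) (use ee M q in auto)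
  also have "\<dots> = mat_sum n (\<lambda>p. if p = q then e q * e' q else \<O>) {..<s}"
  proof (rule mat_sum_cong[OF refl])
    fix p assume "p \<in> {..<s}"
    then have p: "p < s" by simp
    have "e q * (e p * e' p) = (e q * e p) * e' p" using M p q by (simp add: mult_assoc)
    then show "e q * (e p * e' p) = (if p = q then e q * e' q else \<O>)" using orth(1)[OF q p] M p by auto
    show "e q * (e p * e' p) \<in> M" using M p q by simp
  qed
  also have "\<dots> = e q * e' q" by (rule mat_sum_single) (use q ee in auto)
  finally show "e q * ?t = e q * e' q" .
  have "?t * e' q = mat_sum n (\<lambda>p. (e p * e' p) * e' q) {..<s}"
    unfolding intertwiner_def by (rule mat_sum_mult_right) (use ee M q in auto)
  also have "\<dots> = mat_sum n (\<lambda>p. if p = q then e q * e' q else \<O>) {..<s}"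
  proof (rule mat_sum_cong[OF refl])
    fix p assume "p \<in> {..<s}"
    then have p: "p < s" by simp
    have "(e p * e' p) * e' q = e p * (e' p * e' q)" using M p q by (simp add: mult_assoc)
    then show "(e p * e' p) * e' q = (if p = q then e q * e' q else \<O>)" using orth(2)[OF p q] M p by auto
    show "(e p * e' p) * e' q \<in> M" using M p q by simp
  qed
  also have "\<dots> = e q * e' q" by (rule mat_sum_single) (use q ee in auto)
  finally show "?t * e' q = e q * e' q" .
qed

lemma intertwiner_inverse:
  fixes e e' :: "nat \<Rightarrow> 'a::field mat"
  assumes M: "\<And>q. q < s \<Longrightarrow> e q \<in> M" "\<And>q. q < s \<Longrightarrow> e' q \<in> M"
    and orth: "\<And>p q. p < s \<Longrightarrow> q < s \<Longrightarrow> e p * e q = (if p = q then e q else \<O>)"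
      "\<And>p q. p < s \<Longrightarrow> q < s \<Longrightarrow> e' p * e' q = (if p = q then e' q else \<O>)"
    and one: "mat_sum n e {..<s} = 1\<^sub>m n"
    and cross: "\<And>q. q < s \<Longrightarrow> e q * e' q * e q = e q"
  shows "intertwiner s e e' * intertwiner s e' e = 1\<^sub>m n"
proof -
  let ?t = "intertwiner s e e'"
  have tM: "?t \<in> M" by (rule intertwiner_closed[OF M orth])
  have "?t * intertwiner s e' e = mat_sum n (\<lambda>q. ?t * (e' q * e q)) {..<s}"
    unfolding intertwiner_def[of s e' e] by (rule mat_sum_mult_left) (use M tM in auto)
  also have "\<dots> = mat_sum n e {..<s}"
  proof (rule mat_sum_cong[OF refl])
    fix q assume "q \<in> {..<s}"
    then have q: "q < s" by simp
    have "?t * (e' q * e q) = (?t * e' q) * e q" using M q tM by (simp add: mult_assoc)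
    also have "?t * e' q = e q * e' q" by (rule intertwiner_right[OF M orth q])
    finally show "?t * (e' q * e q) = e q" using cross[OF q] by simp
    show "?t * (e' q * e q) \<in> M" using M q tM by simp
  qed
  finally show ?thesis using one by simp
qed

end

context block_pattern
begin

section \<open>The flag of left ideals and its splittings\<close>

lemma T_mono: "x \<in> T q \<Longrightarrow> p \<le> q \<Longrightarrow> x \<in> T p"
  unfolding T_def by (erule pattern_mono) simp

lemma zero_mem_T [simp]: "\<O> \<in> T q"
  by (rule subspaceD(2)[OF T_subspace])

lemma T_zero: "x \<in> M \<Longrightarrow> x \<in> T 0"
  unfolding T_def by (rule patternI) auto

lemma T_last: "x \<in> T s \<Longrightarrow> x = \<O>"
proof (rule mat_eqI)
  fix i j assume x: "x \<in> T s" and ij: "i < n" "j < n"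
  show "x $$ (i, j) = \<O> $$ (i, j)"
    using patternD(2)[OF x[unfolded T_def] ij] b_less[OF ij(2)] ij by simp
qed (simp_all add: T_carrier)

text \<open>Starting from \<open>T s = {\<O>}\<close> this recursion recovers the flag from \<open>J\<close> alone. Whatever respects
  \<open>J\<close>, be it a grading or a conjugation, therefore respects the flag.\<close>

lemma T_step:
  fixes x :: "'a::field mat"
  assumes q: "q < s"
  shows "x \<in> T q \<longleftrightarrow> x \<in> M \<and> (\<forall>y\<in>J. x * y \<in> T (Suc q))"
proof (intro iffI conjI ballI)
  assume x: "x \<in> T q"
  show "x \<in> M" by (rule T_carrier[OF x])
  fix y :: "'a mat" assume "y \<in> J"
  with x show "x * y \<in> T (Suc q)"
    unfolding T_def J_def by (rule pattern_mult) auto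
next
  assume x: "x \<in> M \<and> (\<forall>y\<in>J. x * y \<in> T (Suc q))"
  obtain k where k: "k < n" "b k = q" using block_nonempty[OF q] by blast
  show "x \<in> T q"
    unfolding T_def
  proof (rule patternI)
    show "x \<in> M" using x by simp
    fix i j assume ij: "i < n" "j < n" "\<not> q \<le> b j"
    have "(E j k :: 'a mat) \<in> J" unfolding J_def using k ij by (intro E_pattern) simp
    then have "x * E j k \<in> T (Suc q)" using x by blast
    then have "(x * E j k) $$ (i, k) = 0" using k ij by (auto simp: T_def pattern_def)
    then show "x $$ (i, j) = 0" using k ij x by (simp add: mult_E_index)
  qed
qed

lemma T_graded:
  fixes D :: "'g::ab_group_add \<Rightarrow> 'a::field mat set"
  assumes D: "is_grading n M D" and J: "graded_subspace n M D J" and q: "q \<le> s"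
  shows "graded_subspace n M D (T q)"
  using q
proof (induction q rule: inc_induct)
  case base
  have "component n D g x \<in> T s" if "x \<in> T s" for x :: "'a mat" and g
  proof -
    have "x = \<O>" by (rule T_last[OF that])
    then show ?thesis using component_zero[OF D] by simp
  qed
  then show ?case unfolding graded_subspace_def by (auto intro: T_carrier T_subspace)
next
  case (step q)
  have "component n D g x \<in> T q" if x: "x \<in> T q" for x :: "'a mat" and g
  proof -
    have xM: "x \<in> M" by (rule T_carrier[OF x])
    have cM: "component n D g x \<in> M" by (rule component_closed[OF D xM])
    have "component n D g x * y \<in> T (Suc q)" if "y \<in> J" for y :: "'a mat"
      using D J that
    proof (induction rule: homogeneous_induct)
      case zero
      then show ?case using cM by simp
    next
      case (add y z)
      then show ?case using cM by (simp add: distrib_left J_carrier subspaceD(3)[OF T_subspace])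
    next
      case (homogeneous k y)
      have "component n D g x * y = component n D (g + k) (x * y)"
        by (rule component_mult_right[OF D homogeneous(2) xM, symmetric])
      moreover have "x * y \<in> T (Suc q)" using T_step[OF step.hyps(2)] x homogeneous(1) by blast
      ultimately show ?case using graded_subspaceD(3)[OF step.IH] by simp
    qed
    then show ?thesis using T_step[OF step.hyps(2)] cM by blast
  qed
  then show ?case unfolding graded_subspace_def by (auto intro: T_carrier T_subspace)
qed

lemma J_graded_extension:
  fixes D :: "'g::ab_group_add \<Rightarrow> 'a::field mat set"
  assumes B: "is_grading n U B" and D: "is_grading n M D" and le: "\<And>g. B g \<subseteq> D g"
  shows "graded_subspace n M D J"
  unfolding graded_subspace_def
  using graded_subspaceD(3)[OF J_graded[OF B]]
  by (auto simp: component_coarser[OF B D le] J_subset_U intro: J_subspace J_carrier)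

lemma T_conj:
  fixes t t' :: "'a::field mat"
  assumes t: "t \<in> M" "t' \<in> M" "t * t' = 1\<^sub>m n"
    and J: "\<And>y. y \<in> J \<Longrightarrow> t' * y * t \<in> J" and q: "q \<le> s" and x: "x \<in> T q"
  shows "t * x * t' \<in> T q"
  using q x
proof (induction q arbitrary: x rule: inc_induct)
  case base
  then have "x = \<O>" by (rule T_last)
  then show ?case using t by simp
next
  case (step q)
  have xM: "x \<in> M" by (rule T_carrier[OF step.prems])
  have "t * x * t' * y \<in> T (Suc q)" if y: "y \<in> J" for y :: "'a mat"
  proof -
    have yM: "y \<in> M" by (rule J_carrier[OF y])
    have "x * (t' * y * t) \<in> T (Suc q)" using T_step[OF step.hyps(2)] step.prems J[OF y] by blast
    then have "t * (x * (t' * y * t)) * t' \<in> T (Suc q)" by (rule step.IH)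
    moreover have "t * (x * (t' * y * t)) * t' = t * x * t' * y"
      using t xM yM by (simp add: mult_assoc)
    ultimately show ?thesis by simp
  qed
  moreover have "t * x * t' \<in> M" using t xM by simp
  ultimately show ?case using T_step[OF step.hyps(2)] by blast
qed

text \<open>In terms of the flag of row spaces stabilised by \<open>U\<close>, a splitting is a chain of projections onto
  its members, and the differences \<open>piece F q\<close> project onto complements of each member in the
  previous one. For the splitting \<open>std\<close> these are the identities of the diagonal blocks.\<close>

definition splitting :: "(nat \<Rightarrow> 'a::field mat) \<Rightarrow> bool" where
  "splitting F \<longleftrightarrow> (\<forall>q\<le>s. F q \<in> T q \<and> (\<forall>x\<in>T q. x * F q = x)) \<and>
     (\<forall>p q. p \<le> q \<longrightarrow> q \<le> s \<longrightarrow> F p * F q = F q)"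

definition piece :: "(nat \<Rightarrow> 'a::field mat) \<Rightarrow> nat \<Rightarrow> 'a mat" where
  "piece F q = F q - F (Suc q)"

definition std :: "nat \<Rightarrow> 'a::field mat" where
  "std q = diag (\<lambda>i. q \<le> b i)"

lemma splittingD:
  assumes "splitting F"
  shows "q \<le> s \<Longrightarrow> F q \<in> T q" "q \<le> s \<Longrightarrow> x \<in> T q \<Longrightarrow> x * F q = x"
    "p \<le> q \<Longrightarrow> q \<le> s \<Longrightarrow> F p * F q = F q" "q \<le> s \<Longrightarrow> F q \<in> M"
  using assms by (auto simp: splitting_def intro: T_carrier)

lemma splitting_cross:
  assumes "splitting F" "splitting G" "p \<le> q" "q \<le> s"
  shows "F q * G p = F q"
  by (rule splittingD(2)[OF assms(2)]) (use assms T_mono splittingD(1)[OF assms(1)] in auto)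

lemma splitting_ends:
  assumes "splitting F"
  shows "F 0 = 1\<^sub>m n" "F s = \<O>"
proof -
  have "1\<^sub>m n * F 0 = 1\<^sub>m n" by (rule splittingD(2)[OF assms]) (auto intro: T_zero)
  then show "F 0 = 1\<^sub>m n" using splittingD(4)[OF assms, of 0] by simp
  show "F s = \<O>" by (rule T_last) (rule splittingD(1)[OF assms order_refl])
qed

lemma piece_closed: "splitting F \<Longrightarrow> q < s \<Longrightarrow> piece F q \<in> M"
  using splittingD(4)[of F q] splittingD(4)[of F "Suc q"] by (simp add: piece_def)

lemma diff_mult_diff:
  "x \<in> M \<Longrightarrow> y \<in> M \<Longrightarrow> z \<in> M \<Longrightarrow> w \<in> M \<Longrightarrow> (x - y) * (z - w) = (x * z - x * w) - (y * z - y * w)"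
  by (subst diff_right) (simp_all add: diff_left)

lemma piece_orthogonal:
  fixes F :: "nat \<Rightarrow> 'a::field mat"
  assumes F: "splitting F" and p: "p < s" and q: "q < s"
  shows "piece F p * piece F q = (if p = q then piece F q else \<O>)"
proof -
  have FM: "F p \<in> M" "F (Suc p) \<in> M" "F q \<in> M" "F (Suc q) \<in> M"
    using splittingD(4)[OF F] p q by auto
  have eq: "piece F p * piece F q
      = (F p * F q - F p * F (Suc q)) - (F (Suc p) * F q - F (Suc p) * F (Suc q))"
    unfolding piece_def by (rule diff_mult_diff) (use FM in auto)
  have up: "F k * F l = F l" if "k \<le> l" "l \<le> s" for k l by (rule splittingD(3)[OF F that])
  have down: "F l * F k = F l" if "k \<le> l" "l \<le> s" for k l by (rule splitting_cross[OF F F that])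
  consider "p = q" | "p < q" | "q < p" by linarith
  then show ?thesis
  proof cases
    case 1
    then show ?thesis
      unfolding eq using p q FM up[of q q] up[of q "Suc q"] down[of q "Suc q"] up[of "Suc q" "Suc q"]
      by (intro mat_eqI) (auto simp: piece_def)
  next
    case 2
    then show ?thesis
      unfolding eq using p q FM up[of p q] up[of p "Suc q"] up[of "Suc p" q] up[of "Suc p" "Suc q"]
      by (intro mat_eqI) auto
  next
    case 3
    then show ?thesis
      unfolding eq using p q FM down[of q p] down[of "Suc q" p] down[of q "Suc p"] down[of "Suc q" "Suc p"]
      by (intro mat_eqI) auto
  qed
qed

lemma piece_sum:
  fixes F :: "nat \<Rightarrow> 'a::field mat"
  assumes F: "splitting F"
  shows "mat_sum n (piece F) {..<s} = 1\<^sub>m n"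
proof (rule mat_sum_eqI)
  have FM: "F q \<in> M" if "q \<le> s" for q by (rule splittingD(4)[OF F that])
  show "piece F q \<in> M" if "q \<in> {..<s}" for q using piece_closed[OF F] that by simp
  fix i j assume ij: "i < n" "j < n"
  have "(\<Sum>q<s. piece F q $$ (i, j)) = (\<Sum>q<s. F q $$ (i, j) - F (Suc q) $$ (i, j))"
    by (rule sum.cong) (use FM ij in \<open>auto simp: piece_def\<close>)
  also have "\<dots> = F 0 $$ (i, j) - F s $$ (i, j)" by (rule sum_lessThan_telescope')
  finally show "(\<Sum>q<s. piece F q $$ (i, j)) = 1\<^sub>m n $$ (i, j)" using splitting_ends[OF F] ij by simp
qed auto

text \<open>Modulo \<open>T (Suc q)\<close>, right multiplication by \<open>piece F q\<close> and by \<open>piece G q\<close> is the identity on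
  \<open>T q\<close>.\<close>

lemma piece_cross:
  fixes F G :: "nat \<Rightarrow> 'a::field mat"
  assumes F: "splitting F" and G: "splitting G" and q: "q < s"
  shows "piece F q * piece G q * piece F q = piece F q"
proof -
  let ?q = "Suc q"
  have M: "F q \<in> M" "F ?q \<in> M" "G q \<in> M" "G ?q \<in> M"
    using splittingD(4)[OF F] splittingD(4)[OF G] q by auto
  have FG: "F q * G q = F q" "F ?q * G q = F ?q" "F ?q * G ?q = F ?q"
    and GF: "G ?q * F q = G ?q" "G ?q * F ?q = G ?q"
    and FF: "F q * F q = F q" "F q * F ?q = F ?q"
    using splitting_cross[OF F G] splitting_cross[OF G F] splittingD(3)[OF F] q by auto
  have "piece F q * piece G q = (F q * G q - F q * G ?q) - (F ?q * G q - F ?q * G ?q)"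
    unfolding piece_def by (rule diff_mult_diff) (use M in auto)
  also have "\<dots> = F q - F q * G ?q" unfolding FG using M by (intro mat_eqI) auto
  finally have "piece F q * piece G q * piece F q = (F q - F q * G ?q) * (F q - F ?q)"
    by (simp add: piece_def)
  also have "\<dots> = (F q * F q - F q * F ?q) - (F q * G ?q * F q - F q * G ?q * F ?q)"
    by (rule diff_mult_diff) (use M in auto)
  also have "\<dots> = (F q - F ?q) - (F q * G ?q - F q * G ?q)"
    using M GF FF by (simp add: mult_assoc)
  also have "\<dots> = piece F q" unfolding piece_def using M by (intro mat_eqI) auto
  finally show ?thesis .
qed

text \<open>Two splittings of the same flag are conjugate, because by \<open>piece_cross\<close> the two projections onto
  complements of \<open>T (Suc q)\<close> in \<open>T q\<close> identify these complements with each other.\<close>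

lemma splitting_conjugate:
  fixes F G :: "nat \<Rightarrow> 'a::field mat"
  assumes F: "splitting F" and G: "splitting G"
  defines "t \<equiv> intertwiner s (piece F) (piece G)"
  shows "t \<in> M" "t * intertwiner s (piece G) (piece F) = 1\<^sub>m n"
    "q < s \<Longrightarrow> piece F q * t = t * piece G q"
proof -
  note M = piece_closed[OF F] piece_closed[OF G]
  note orth = piece_orthogonal[OF F] piece_orthogonal[OF G]
  show "t \<in> M" unfolding t_def by (rule intertwiner_closed[OF M orth])
  show "t * intertwiner s (piece G) (piece F) = 1\<^sub>m n"
    unfolding t_def by (rule intertwiner_inverse[OF M orth piece_sum[OF F] piece_cross[OF F G]])
  show "piece F q * t = t * piece G q" if "q < s"
    unfolding t_def using intertwiner_left[OF M orth that] intertwiner_right[OF M orth that] by simp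
qed

lemma splitting_std: "splitting (std :: nat \<Rightarrow> 'a::field mat)"
  unfolding splitting_def
proof (intro conjI allI impI ballI)
  show "(std q :: 'a mat) \<in> T q" for q unfolding T_def std_def by (rule patternI) auto
  show "x * std q = x" if "x \<in> T q" for q and x :: "'a mat"
    by (rule mat_eqI) (use that in \<open>auto simp: T_def pattern_def std_def mult_diag_index\<close>)
  show "(std p * std q :: 'a mat) = std q" if "p \<le> q" for p q
    by (rule mat_eqI) (use that in \<open>auto simp: std_def diag_mult_index\<close>)
qed

lemma std_U: "std q \<in> U"
  unfolding U_def std_def by (rule patternI) auto

lemma piece_std: "piece std q = diag (\<lambda>i. b i = q)"
  by (rule mat_eqI) (auto simp: piece_def std_def)

text \<open>The components \<open>r q\<close> of degree zero of the idempotents \<open>std q\<close> are right identities of the left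
  ideals \<open>T q\<close>, but need not form a chain. The products \<open>r 0 * \<dots> * r q\<close> do.\<close>

lemma homogeneous_splitting:
  fixes D :: "'g::ab_group_add \<Rightarrow> 'a::field mat set"
  assumes D: "is_grading n M D" and J: "graded_subspace n M D J"
    and U: "\<And>x g. x \<in> U \<Longrightarrow> component n D g x \<in> U"
  shows "\<exists>F. splitting F \<and> (\<forall>q\<le>s. F q \<in> D 0 \<and> F q \<in> U)"
proof -
  define r where "r = (\<lambda>q. component n D 0 (std q))"
  note std = splittingD[OF splitting_std]
  have stdM: "(std q :: 'a mat) \<in> M" for q by (simp add: std_def)
  have r: "r q \<in> T q" "\<And>x. x \<in> T q \<Longrightarrow> x * r q = x" if "q \<le> s" for q
    using graded_subspaceD(3)[OF T_graded[OF D J that] std(1)[OF that]]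
      homogeneous_right_identity[OF D T_graded[OF D J that] std(1)[OF that] std(2)[OF that]]
    by (auto simp: r_def)
  have rD: "r q \<in> D 0" for q unfolding r_def by (rule component_mem[OF D stdM])
  have rU: "r q \<in> U" for q unfolding r_def by (rule U[OF std_U])
  have rM: "r q \<in> M" for q using gradingD(2)[OF D rD] .
  define F where "F = rec_nat (r 0) (\<lambda>q y. y * r (Suc q))"
  have F0: "F 0 = r 0" and FS: "\<And>q. F (Suc q) = F q * r (Suc q)" by (simp_all add: F_def)
  have FD: "F q \<in> D 0 \<and> F q \<in> U" for q
  proof (induction q)
    case (Suc q)
    then show ?case using gradingD(4)[OF D, of "F q" 0 "r (Suc q)" 0] rD rU by (auto simp: FS intro: U_mult)
  qed (use rD rU F0 in auto)
  then have FM: "F q \<in> M" for q using gradingD(2)[OF D] by blast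
  have FT: "F q \<in> T q \<and> (\<forall>x\<in>T q. x * F q = x)" if "q \<le> s" for q
    using that
  proof (induction q)
    case 0
    then show ?case using r[of 0] F0 by simp
  next
    case (Suc q)
    have "x * F (Suc q) = x" if x: "x \<in> T (Suc q)" for x :: "'a mat"
    proof -
      have xM: "x \<in> M" by (rule T_carrier[OF x])
      have "x * F (Suc q) = (x * F q) * r (Suc q)" using xM FM rM by (simp add: FS mult_assoc)
      also have "x * F q = x" using Suc T_mono[OF x, of q] by simp
      finally show ?thesis using r(2)[OF Suc.prems x] by simp
    qed
    then show ?case using T_left_ideal[OF FM r(1)[OF Suc.prems]] by (simp add: FS)
  qed
  have "F p * F q = F q" if "p \<le> q" "q \<le> s" for p q
    using that
  proof (induction q rule: dec_induct)
    case base
    then show ?case using FT by blast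
  next
    case (step q)
    have "F p * F (Suc q) = (F p * F q) * r (Suc q)" using FM rM by (simp add: FS mult_assoc)
    then show ?case using step by (simp add: FS)
  qed
  then have "splitting F" unfolding splitting_def using FT by blast
  then show ?thesis using FD by blast
qed

section \<open>Block diagonals\<close>

lemma \<Delta>_grading: "is_grading n M (\<Delta> :: int \<Rightarrow> 'a::field mat set)"
proof (rule grading_intro[where p = "\<lambda>m x. mat n n (\<lambda>(i, j). if int (b j) = int (b i) + m then x $$ (i, j) else 0)"
      and K = "\<lambda>_. {- int s..int s}"])
  show "mat_subspace n (\<Delta> m :: 'a mat set)" for m by (rule \<Delta>_subspace)
  show "\<Delta> m \<subseteq> (M :: 'a mat set)" for m by (auto intro: \<Delta>_carrier)
  show "x * y \<in> \<Delta> (m + k)" if "x \<in> \<Delta> m" "y \<in> \<Delta> k" for m k and x y :: "'a mat"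
    using that unfolding \<Delta>_def by (rule pattern_mult) auto
  show "mat n n (\<lambda>(i, j). if int (b j) = int (b i) + m then x $$ (i, j) else 0) \<in> \<Delta> m"
    for m and x :: "'a mat"
    unfolding \<Delta>_def by (rule patternI) auto
  show "mat_sum n (\<lambda>m. mat n n (\<lambda>(i, j). if int (b j) = int (b i) + m then x $$ (i, j) else 0)) {- int s..int s} = x"
    if x: "x \<in> M" for x :: "'a mat"
  proof (rule mat_sum_eqI)
    fix i j assume ij: "i < n" "j < n"
    have "(\<Sum>m\<in>{- int s..int s}. mat n n (\<lambda>(i, j). if int (b j) = int (b i) + m then x $$ (i, j) else 0) $$ (i, j))
        = (\<Sum>m\<in>{- int s..int s}. if m = int (b j) - int (b i) then x $$ (i, j) else 0)"
      by (rule sum.cong) (use ij in auto)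
    also have "\<dots> = x $$ (i, j)" using b_less[OF ij(1)] b_less[OF ij(2)] by simp
    finally show "(\<Sum>m\<in>{- int s..int s}. mat n n (\<lambda>(i, j). if int (b j) = int (b i) + m then x $$ (i, j) else 0) $$ (i, j)) = x $$ (i, j)" .
  qed (use x in auto)
  show "mat n n (\<lambda>(i, j). if int (b j) = int (b i) + m then x $$ (i, j) else 0)
      = (if m = k then x else \<O>)" if "x \<in> \<Delta> k" for m k and x :: "'a mat"
    by (rule mat_eqI) (use that \<Delta>_carrier[OF that] in \<open>auto simp: \<Delta>_def pattern_def\<close>)
  show "mat n n (\<lambda>(i, j). if int (b j) = int (b i) + m then (x + y) $$ (i, j) else 0)
      = mat n n (\<lambda>(i, j). if int (b j) = int (b i) + m then x $$ (i, j) else 0)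
        + mat n n (\<lambda>(i, j). if int (b j) = int (b i) + m then y $$ (i, j) else 0)"
    if "x \<in> M" "y \<in> M" for m and x y :: "'a mat"
    by (rule mat_eqI) (use that in auto)
qed (simp_all add: subspace_carrier)

lemma \<Delta>_iff:
  fixes x :: "'a::field mat"
  shows "x \<in> \<Delta> m \<longleftrightarrow> x \<in> M \<and>
    (\<forall>p<s. \<forall>q<s. int q \<noteq> int p + m \<longrightarrow> piece std p * x * piece std q = \<O>)"
proof -
  have entry: "(diag (\<lambda>i. b i = p) * x * diag (\<lambda>i. b i = q)) $$ (i, j)
      = (if b i = p \<and> b j = q then x $$ (i, j) else 0)" if "x \<in> M" "i < n" "j < n" for p q i j and x :: "'a mat"
    using that by (simp add: mult_diag_index diag_mult_index)
  show ?thesis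
    unfolding piece_std
  proof (intro iffI conjI allI impI)
    assume x: "x \<in> \<Delta> m"
    show xM: "x \<in> M" by (rule \<Delta>_carrier[OF x])
    show "diag (\<lambda>i. b i = p) * x * diag (\<lambda>i. b i = q) = \<O>" if "int q \<noteq> int p + m" for p q
      by (rule mat_eqI) (use xM entry[OF xM] x that in \<open>auto simp: \<Delta>_def pattern_def\<close>)
  next
    assume x: "x \<in> M \<and> (\<forall>p<s. \<forall>q<s. int q \<noteq> int p + m \<longrightarrow>
      diag (\<lambda>i. b i = p) * x * diag (\<lambda>i. b i = q) = \<O>)"
    then have xM: "x \<in> M" by simp
    show "x \<in> \<Delta> m"
      unfolding \<Delta>_def
    proof (rule patternI[OF xM])
      fix i j assume ij: "i < n" "j < n" "int (b j) \<noteq> int (b i) + m"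
      then have "diag (\<lambda>k. b k = b i) * x * diag (\<lambda>k. b k = b j) = \<O>" using x b_less by blast
      then show "x $$ (i, j) = 0" using entry[OF xM ij(1,2), of "b i" "b j"] ij by simp
    qed
  qed
qed

lemma \<Delta>_graded:
  fixes D :: "'g::ab_group_add \<Rightarrow> 'a::field mat set"
  assumes D: "is_grading n M D" and e: "\<And>q. q < s \<Longrightarrow> piece std q \<in> D 0"
  shows "graded_subspace n M D (\<Delta> m)"
proof -
  have "component n D g x \<in> \<Delta> m" if x: "x \<in> \<Delta> m" for x :: "'a mat" and g
  proof -
    have xM: "x \<in> M" by (rule \<Delta>_carrier[OF x])
    have "piece std p * component n D g x * piece std q = \<O>"
      if pq: "p < s" "q < s" "int q \<noteq> int p + m" for p q
    proof -
      have eM: "(piece std p :: 'a mat) \<in> M" using gradingD(2)[OF D e[OF pq(1)]] .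
      have "piece std p * component n D g x * piece std q
          = component n D (0 + g) (piece std p * x) * piece std q"
        using component_mult_left[OF D e[OF pq(1)] xM, of g] by simp
      also have "\<dots> = component n D (0 + g + 0) (piece std p * x * piece std q)"
        by (rule component_mult_right[OF D e[OF pq(2)], symmetric]) (use eM xM in simp)
      also have "piece std p * x * piece std q = \<O>" using x pq \<Delta>_iff by blast
      finally show ?thesis using component_zero[OF D] by simp
    qed
    then show ?thesis using \<Delta>_iff component_closed[OF D xM] by blast
  qed
  then show ?thesis unfolding graded_subspace_def by (auto intro: \<Delta>_carrier \<Delta>_subspace)
qed

end

section \<open>Automorphisms\<close>

context square_matrices
begin

lemma conj_conj:
  assumes "t \<in> M" "t' \<in> M" "t * t' = 1\<^sub>m n" "x \<in> M"
  shows "t * (t' * x * t) * t' = x"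
proof -
  have "t * (t' * x * t) * t' = (t * t') * x * (t * t')" using assms(1,2,4) by (simp add: mult_assoc)
  then show ?thesis using assms by simp
qed

lemma conj_mult:
  assumes "t \<in> M" "t' \<in> M" "t' * t = 1\<^sub>m n" "x \<in> M" "y \<in> M"
  shows "(t * x * t') * (t * y * t') = t * (x * y) * t'"
proof -
  have "(t * x * t') * (t * y * t') = t * x * (t' * t) * y * t'"
    using assms(1,2,4,5) by (simp add: mult_assoc)
  then show ?thesis using assms by (simp add: mult_assoc)
qed

lemma automorphism_conj:
  assumes t: "t \<in> M" "t' \<in> M" "t * t' = 1\<^sub>m n" "t' * t = 1\<^sub>m n" and S: "S \<subseteq> M"
    and stable: "\<And>x. x \<in> S \<Longrightarrow> t * x * t' \<in> S" "\<And>x. x \<in> S \<Longrightarrow> t' * x * t \<in> S"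
  shows "algebra_automorphism S (\<lambda>x. t * x * t')"
proof -
  have SM: "x \<in> M" if "x \<in> S" for x using S that by blast
  have "bij_betw (\<lambda>x. t * x * t') S S"
    by (rule bij_betw_byWitness[where f' = "\<lambda>x. t' * x * t"])
       (use stable conj_conj[OF t(2,1,4)] conj_conj[OF t(1,2,3)] SM in auto)
  moreover have "t * (x + y) * t' = t * x * t' + t * y * t'" if "x \<in> S" "y \<in> S" for x y
    using t SM that by (simp add: distrib_left distrib_right)
  moreover have "t * (c \<cdot>\<^sub>m x) * t' = c \<cdot>\<^sub>m (t * x * t')" if "x \<in> S" for c x
    using t SM that by (simp add: mult_smult smult_mult)
  moreover have "t * (x * y) * t' = t * x * t' * (t * y * t')" if "x \<in> S" "y \<in> S" for x y
    by (rule conj_mult[OF t(1,2,4), symmetric]) (use SM that in auto)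
  ultimately show ?thesis unfolding algebra_automorphism_def by blast
qed

lemma automorphism_subspace_sum:
  assumes \<phi>: "algebra_automorphism S \<phi>" and A: "is_grading n S A" and A': "is_grading n S A'"
    and im: "\<And>g. \<phi> ` A g = A' g"
  shows "\<phi> ` subspace_sum n A I = subspace_sum n A' I"
proof -
  note Ss = subspaceD[OF grading_total_subspace[OF A]]
  have \<phi>S: "\<phi> x \<in> S" if "x \<in> S" for x
    using \<phi> that by (auto simp: algebra_automorphism_def bij_betw_def)
  have sums: "\<phi> (mat_sum n f K) = mat_sum n (\<lambda>g. \<phi> (f g)) K"
    if "finite K" "\<And>g. g \<in> K \<Longrightarrow> f g \<in> S" for f K
    by (rule conjunct2[OF mat_sum_additive[OF that Ss(2,1,3)]])
       (use \<phi> \<phi>S Ss(5) in \<open>auto simp: algebra_automorphism_def\<close>)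
  show ?thesis
  proof (intro equalityI subsetI)
    fix y assume "y \<in> \<phi> ` subspace_sum n A I"
    then obtain f K where f: "finite K" "K \<subseteq> I" "\<forall>g\<in>K. f g \<in> A g" "y = \<phi> (mat_sum n f K)"
      unfolding subspace_sum_def by blast
    have fS: "f g \<in> S" if "g \<in> K" for g using f(3) that homogeneous_subset[OF A] by blast
    have "y = mat_sum n (\<lambda>g. \<phi> (f g)) K" unfolding f(4) by (rule sums[OF f(1) fS])
    moreover have "\<forall>g\<in>K. \<phi> (f g) \<in> A' g" using f(3) im by blast
    ultimately show "y \<in> subspace_sum n A' I"
      unfolding subspace_sum_def using f(1,2)
      by (intro CollectI exI[of _ "\<lambda>g. \<phi> (f g)"] exI[of _ K]) auto
  next
    fix y assume "y \<in> subspace_sum n A' I"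
    then obtain f K where f: "finite K" "K \<subseteq> I" "\<forall>g\<in>K. f g \<in> A' g" "y = mat_sum n f K"
      unfolding subspace_sum_def by blast
    have "\<forall>g\<in>K. \<exists>x. x \<in> A g \<and> f g = \<phi> x"
    proof
      fix g assume "g \<in> K"
      then have "f g \<in> \<phi> ` A g" using f(3) im[of g] by simp
      then show "\<exists>x. x \<in> A g \<and> f g = \<phi> x" by blast
    qed
    then obtain h where h: "\<forall>g\<in>K. h g \<in> A g \<and> f g = \<phi> (h g)" using bchoice by metis
    have hS: "h g \<in> S" if "g \<in> K" for g using h that homogeneous_subset[OF A] by blast
    have "y = mat_sum n (\<lambda>g. \<phi> (h g)) K"
      unfolding f(4) by (rule mat_sum_cong) (use h f(3) gradingD(2)[OF A'] in auto)
    then have "y = \<phi> (mat_sum n h K)" using sums[OF f(1) hS] by simp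
    moreover have "mat_sum n h K \<in> subspace_sum n A I"
      unfolding subspace_sum_def using f(1,2) h by blast
    ultimately show "y \<in> \<phi> ` subspace_sum n A I" by blast
  qed
qed

lemma invertible_if_left_kernel_trivial:
  fixes v :: "'a::field mat"
  assumes v: "v \<in> M"
    and ker: "\<And>a. (\<And>k. k < n \<Longrightarrow> (\<Sum>j<n. a j * v $$ (j, k)) = 0) \<Longrightarrow> \<forall>j<n. a j = 0"
  shows "\<exists>v'\<in>M. v * v' = 1\<^sub>m n \<and> v' * v = 1\<^sub>m n"
proof -
  have "det v \<noteq> 0"
  proof
    assume "det v = 0"
    then have "det (transpose_mat v) = 0" using det_transpose[OF v] by simp
    then obtain a where a: "a \<in> carrier_vec n" "a \<noteq> 0\<^sub>v n" "transpose_mat v *\<^sub>v a = 0\<^sub>v n"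
      using det_0_iff_vec_prod_zero_field[of "transpose_mat v" n] v by auto
    have "(\<Sum>j<n. a $ j * v $$ (j, k)) = 0" if k: "k < n" for k
    proof -
      have "0 = (transpose_mat v *\<^sub>v a) $ k" using a k by simp
      also have "\<dots> = (\<Sum>j<n. a $ j * v $$ (j, k))"
        using v a(1) k by (auto simp: scalar_prod_def atLeast0LessThan mult.commute intro!: sum.cong)
      finally show ?thesis by simp
    qed
    then have "\<forall>j<n. a $ j = 0" by (rule ker)
    then have "a = 0\<^sub>v n" using a(1) by (intro eq_vecI) auto
    then show False using a(2) by simp
  qed
  then have "v \<in> Units (ring_mat TYPE('a) n ())" by (rule det_non_zero_imp_unit[OF v])
  then show ?thesis unfolding Units_def ring_mat_def by auto
qed

end

context block_pattern
begin

text \<open>For \<open>k\<close> in the first block, \<open>U\<close> acts on the matrix units \<open>E k j\<close> from the right as on the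
  standard row vectors. Taking the row \<open>r\<close> of \<open>\<psi> (E k j)\<close> as the row \<open>j\<close> of \<open>v\<close>, for any fixed \<open>r\<close>,
  gives \<open>x * v = v * \<psi> x\<close>. If the row \<open>r\<close> of \<open>\<psi> (E k l)\<close> is nonzero for some \<open>l\<close> in the last
  block, then \<open>v\<close> is invertible: its left kernel is stable under \<open>U\<close>, and every nonzero space of
  row vectors stable under \<open>U\<close> contains the standard row vector of \<open>l\<close>.\<close>

lemma automorphism_inner:
  fixes \<psi> :: "'a::field mat \<Rightarrow> 'a mat"
  assumes \<psi>: "algebra_automorphism U \<psi>"
  shows "\<exists>v\<in>M. \<exists>v'\<in>M. v * v' = 1\<^sub>m n \<and> v' * v = 1\<^sub>m n \<and> (\<forall>x\<in>U. \<psi> x = v' * x * v)"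
proof -
  have bij: "bij_betw \<psi> U U" and add: "\<And>x y. x \<in> U \<Longrightarrow> y \<in> U \<Longrightarrow> \<psi> (x + y) = \<psi> x + \<psi> y"
    and smult: "\<And>c x. x \<in> U \<Longrightarrow> \<psi> (c \<cdot>\<^sub>m x) = c \<cdot>\<^sub>m \<psi> x"
    and mult: "\<And>x y. x \<in> U \<Longrightarrow> y \<in> U \<Longrightarrow> \<psi> (x * y) = \<psi> x * \<psi> y"
    using \<psi> by (auto simp: algebra_automorphism_def)
  have \<psi>U: "\<psi> x \<in> U" if "x \<in> U" for x using bij that by (auto simp: bij_betw_def)
  have \<psi>M: "\<psi> x \<in> M" if "x \<in> U" for x by (rule U_carrier[OF \<psi>U[OF that]])
  have "mat_subspace n (U :: 'a mat set)" by (rule U_subspace)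
  note Us = subspaceD[OF this]
  obtain k where k: "k < n" "b k = 0" using block_nonempty[OF s_pos] by blast
  obtain l where l: "l < n" "b l = s - 1" using block_nonempty[of "s - 1"] s_pos by auto
  have EU: "(E k j :: 'a mat) \<in> U" for j unfolding U_def using k by (intro E_pattern) simp
  have \<psi>0: "\<psi> \<O> = \<O>"
  proof (rule double_eq_self_imp_zero)
    show "\<psi> \<O> \<in> M" by (rule \<psi>M[OF Us(2)])
    show "\<psi> \<O> = \<psi> \<O> + \<psi> \<O>" using add[OF Us(2) Us(2)] by simp
  qed
  have "\<psi> (E k l) \<noteq> \<O>"
  proof
    assume "\<psi> (E k l) = \<O>"
    then have "\<psi> (E k l) = \<psi> \<O>" using \<psi>0 by simp
    moreover have "inj_on \<psi> U" using bij by (simp add: bij_betw_def)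
    ultimately have "E k l = (\<O> :: 'a mat)" using EU[of l] Us(2) by (blast dest: inj_onD)
    then show False using E_nonzero[OF k(1) l(1)] by blast
  qed
  then have "\<exists>r<n. \<exists>c<n. \<psi> (E k l) $$ (r, c) \<noteq> 0"
    using mat_eqI[OF \<psi>M[OF EU[of l]] zero_carrier_mat] by (metis index_zero_mat(1))
  then obtain r c where rc: "r < n" "c < n" "\<psi> (E k l) $$ (r, c) \<noteq> 0" by blast
  define v where "v = mat n n (\<lambda>(j, c). \<psi> (E k j) $$ (r, c))"
  have vM: "v \<in> M" by (simp add: v_def)
  have intertwine: "v * \<psi> x = x * v" if x: "x \<in> U" for x
  proof (rule mat_eqI)
    have xM: "x \<in> M" by (rule U_carrier[OF x])
    show "v * \<psi> x \<in> M" "x * v \<in> M" using vM xM \<psi>M[OF x] by auto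
    fix j c assume jc: "j < n" "c < n"
    have "E k j * x = mat_sum n (\<lambda>i. x $$ (j, i) \<cdot>\<^sub>m E k i) {..<n}"
      by (rule sym, rule mat_sum_eqI)
         (use xM jc in \<open>auto simp: E_mult_index if_distrib[of "\<lambda>y. _ * y"] cong: if_cong\<close>)
    then have "\<psi> (E k j) * \<psi> x = \<psi> (mat_sum n (\<lambda>i. x $$ (j, i) \<cdot>\<^sub>m E k i) {..<n})"
      using mult[OF EU x, of j] by simp
    also have "\<dots> = mat_sum n (\<lambda>i. \<psi> (x $$ (j, i) \<cdot>\<^sub>m E k i)) {..<n}"
      by (rule conjunct2[OF mat_sum_additive[where V = U]]) (use Us EU add \<psi>M in auto)
    finally have "(\<psi> (E k j) * \<psi> x) $$ (r, c)
        = mat_sum n (\<lambda>i. \<psi> (x $$ (j, i) \<cdot>\<^sub>m E k i)) {..<n} $$ (r, c)" by simp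
    also have "\<dots> = (\<Sum>i<n. \<psi> (x $$ (j, i) \<cdot>\<^sub>m E k i) $$ (r, c))"
      by (rule mat_sum_index) (use \<psi>M Us(4)[OF EU] rc jc in auto)
    also have "\<dots> = (\<Sum>i<n. x $$ (j, i) * v $$ (i, c))"
      by (rule sum.cong) (use \<psi>M[OF EU] rc jc in \<open>auto simp: smult[OF EU] v_def\<close>)
    also have "\<dots> = (x * v) $$ (j, c)" by (rule mult_index[symmetric]) (use xM vM jc in auto)
    also have "(\<psi> (E k j) * \<psi> x) $$ (r, c) = (\<Sum>i<n. \<psi> (E k j) $$ (r, i) * \<psi> x $$ (i, c))"
      by (rule mult_index) (use \<psi>M[OF EU] \<psi>M[OF x] rc jc in auto)
    also have "\<dots> = (\<Sum>i<n. v $$ (j, i) * \<psi> x $$ (i, c))"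
      by (rule sum.cong) (use jc in \<open>auto simp: v_def\<close>)
    also have "\<dots> = (v * \<psi> x) $$ (j, c)"
      by (rule mult_index[symmetric]) (use \<psi>M[OF x] vM jc in auto)
    finally show "(v * \<psi> x) $$ (j, c) = (x * v) $$ (j, c)" .
  qed
  have "\<exists>v'\<in>M. v * v' = 1\<^sub>m n \<and> v' * v = 1\<^sub>m n"
  proof (rule invertible_if_left_kernel_trivial[OF vM])
    fix a assume a: "\<And>c. c < n \<Longrightarrow> (\<Sum>j<n. a j * v $$ (j, c)) = 0"
    show "\<forall>j<n. a j = 0"
    proof (intro allI impI)
      fix j assume j: "j < n"
      \<comment> \<open>Multiplying the kernel vector \<open>a\<close> by \<open>E j l\<close> gives \<open>a j\<close> times the row vector of \<open>l\<close>.\<close>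
      have x: "(E j l :: 'a mat) \<in> U"
        unfolding U_def using b_less[OF j] l by (intro E_pattern) simp
      let ?y = "\<psi> (E j l)"
      have yM: "?y \<in> M" by (rule \<psi>M[OF x])
      have "(\<Sum>i<n. a i * (v * ?y) $$ (i, c)) = (\<Sum>i<n. \<Sum>m<n. a i * (v $$ (i, m) * ?y $$ (m, c)))"
        by (rule sum.cong) (use vM yM rc in \<open>auto simp: mult_index sum_distrib_left simp del: index_mult_mat\<close>)
      also have "\<dots> = (\<Sum>m<n. (\<Sum>i<n. a i * v $$ (i, m)) * ?y $$ (m, c))"
        by (subst sum.swap) (simp add: sum_distrib_right mult.assoc)
      also have "\<dots> = 0" using a by simp
      finally have "0 = (\<Sum>i<n. a i * (E j l * v) $$ (i, c))" using intertwine[OF x] by simp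
      also have "\<dots> = (\<Sum>i<n. if i = j then a j * v $$ (l, c) else 0)"
        by (rule sum.cong) (use vM rc l in \<open>auto simp: E_mult_index\<close>)
      also have "\<dots> = a j * \<psi> (E k l) $$ (r, c)" using j l rc by (simp add: v_def)
      finally show "a j = 0" using rc by simp
    qed
  qed
  then obtain v' where v': "v' \<in> M" "v * v' = 1\<^sub>m n" "v' * v = 1\<^sub>m n" by blast
  have "\<psi> x = v' * x * v" if x: "x \<in> U" for x
  proof -
    have "v' * (v * \<psi> x) = v' * (x * v)" using intertwine[OF x] by simp
    moreover have "v' * (v * \<psi> x) = (v' * v) * \<psi> x"
      by (rule mult_assoc[OF v'(1) vM \<psi>M[OF x], symmetric])
    moreover have "v' * (x * v) = v' * x * v"
      by (rule mult_assoc[OF v'(1) U_carrier[OF x] vM, symmetric])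
    ultimately show ?thesis using v' \<psi>M[OF x] by simp
  qed
  then show ?thesis using vM v' by blast
qed

text \<open>Conjugation stabilises \<open>U\<close> and preserves commutators, so block traces still vanish on the
  conjugates of elements of \<open>J\<close>, and the trace criterion for \<open>J\<close> applies.\<close>

lemma J_conj:
  fixes t t' :: "'a::field mat"
  assumes t: "t \<in> M" "t' \<in> M" "t * t' = 1\<^sub>m n" "t' * t = 1\<^sub>m n"
    and stable: "\<And>x. x \<in> U \<Longrightarrow> t * x * t' \<in> U" "\<And>x. x \<in> U \<Longrightarrow> t' * x * t \<in> U"
    and x: "x \<in> J"
  shows "t * x * t' \<in> J"
proof -
  note cm = conj_mult[OF t(1,2,4)]
  have trace: "block_trace q (t * y * t') = 0" if "y \<in> J" for y q
    using that unfolding J_def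
  proof (induction rule: pattern_induct)
    case zero
    then show ?case using t by simp
  next
    case (add y z)
    have yz: "y \<in> M" "z \<in> M" using add patternD(1) by blast+
    then have "t * (y + z) * t' = t * y * t' + t * z * t'"
      using t(1,2) by (simp add: distrib_left distrib_right)
    then show ?case using add yz t(1,2) by (simp add: block_trace_add)
  next
    case (unit c i j)
    let ?e = "c \<cdot>\<^sub>m E i j :: 'a mat" and ?d = "E i i :: 'a mat"
    have eU: "?d \<in> U" "?e \<in> U" and mul: "?d * ?e = ?e" "?e * ?d = \<O>"
      using J_unit_commutator[OF unit] by auto
    have M: "?d \<in> M" "?e \<in> M" by auto
    have "block_trace q (t * ?e * t') = block_trace q ((t * ?d * t') * (t * ?e * t'))"
      using cm[OF M] mul by simp
    also have "\<dots> = block_trace q ((t * ?e * t') * (t * ?d * t'))"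
      by (rule block_trace_commute[OF stable(1)[OF eU(1)] stable(1)[OF eU(2)]])
    also have "\<dots> = 0" using cm[OF M(2,1)] mul t by simp
    finally show ?case .
  qed
  have xU: "x \<in> U" by (rule J_subset_U[OF x])
  have "block_trace q (a * (t * x * t')) = 0" if a: "a \<in> U" for a q
  proof -
    have a': "t' * a * t \<in> U" by (rule stable(2)[OF a])
    have "t * ((t' * a * t) * x) * t' = t * (t' * a * t) * t' * (t * x * t')"
      using cm[OF U_carrier[OF a'] U_carrier[OF xU]] by simp
    also have "t * (t' * a * t) * t' = a" by (rule conj_conj[OF t(1-3) U_carrier[OF a]])
    finally show ?thesis using trace[OF J_left_ideal[OF a' x], of q] by simp
  qed
  then show ?thesis using radical_iff stable(1)[OF xU] by blast
qed

lemma \<Delta>_conj: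
  fixes w w' :: "'a::field mat"
  assumes w: "w \<in> M" "w' \<in> M" "w * w' = 1\<^sub>m n" "w' * w = 1\<^sub>m n"
    and comm: "\<And>q. q < s \<Longrightarrow> piece std q * w = w * piece std q" and x: "x \<in> \<Delta> m"
  shows "w * x * w' \<in> \<Delta> m"
proof -
  have xM: "x \<in> M" by (rule \<Delta>_carrier[OF x])
  have eM: "(piece std q :: 'a mat) \<in> M" if "q < s" for q by (rule piece_closed[OF splitting_std that])
  have comm': "w' * piece std q = piece std q * w'" if q: "q < s" for q
  proof -
    have "w' * piece std q = w' * (piece std q * w) * w'"
      using w eM[OF q] by (simp add: mult_assoc)
    also have "\<dots> = (w' * w) * piece std q * w'"
      using comm[OF q] w(1,2) eM[OF q] by (simp add: mult_assoc)
    finally show ?thesis using w eM[OF q] by simp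
  qed
  have "piece std p * (w * x * w') * piece std q = \<O>"
    if pq: "p < s" "q < s" "int q \<noteq> int p + m" for p q
  proof -
    have "piece std p * (w * x * w') * piece std q = (piece std p * w) * x * (w' * piece std q)"
      using w(1,2) xM eM[OF pq(1)] eM[OF pq(2)] by (simp add: mult_assoc)
    also have "\<dots> = w * (piece std p * x * piece std q) * w'"
      unfolding comm[OF pq(1)] comm'[OF pq(2)]
      using w(1,2) xM eM[OF pq(1)] eM[OF pq(2)] by (simp add: mult_assoc)
    also have "piece std p * x * piece std q = \<O>" using \<Delta>_iff x pq by blast
    finally show ?thesis using w by simp
  qed
  then show ?thesis using \<Delta>_iff w xM by (metis mult_closed)
qed

section \<open>Admissible gradings\<close>

text \<open>Admissibility, expressed by the block function \<open>b\<close>.\<close>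

definition compatible :: "(int \<times> 'g::ab_group_add \<Rightarrow> 'a::field mat set) \<Rightarrow> bool" where
  "compatible A \<longleftrightarrow> is_grading n M A \<and> (\<forall>m\<ge>0. \<Delta> m \<subseteq> coarsening n fst A m)"

lemma compatible_grading: "compatible A \<Longrightarrow> is_grading n M A"
  by (simp add: compatible_def)

lemma compatible_coarsenings:
  assumes "compatible A"
  shows "is_grading n M (coarsening n fst A)" "is_grading n M (coarsening n snd A)"
  using grading_coarsening[OF compatible_grading[OF assms], of fst]
    grading_coarsening[OF compatible_grading[OF assms], of snd] by auto

text \<open>The idempotents \<open>E i i\<close> have degree zero, which makes every matrix unit homogeneous. The
  degrees of those in \<open>U\<close> are given, and \<open>E i j * E j i = E i i\<close> yields the others.\<close>

lemma compatible_coarsening_fst: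
  fixes A :: "int \<times> 'g::ab_group_add \<Rightarrow> 'a::field mat set"
  assumes A: "compatible A"
  shows "coarsening n fst A = \<Delta>"
proof (rule grading_le_eq[OF compatible_coarsenings(1)[OF A] \<Delta>_grading], rule subsetI)
  let ?Z = "coarsening n fst A"
  note Z = compatible_coarsenings(1)[OF A]
  have le: "x \<in> ?Z m" if "0 \<le> m" "x \<in> \<Delta> m" for m x using A that by (auto simp: compatible_def)
  have E\<Delta>: "(E i j :: 'a mat) \<in> \<Delta> (int (b j) - int (b i))" for i j
    unfolding \<Delta>_def by (rule E_pattern) simp
  have E0: "(E i i :: 'a mat) \<in> ?Z 0" for i using le[of 0] E\<Delta>[of i i] by simp
  have inj: "m = k" if "x \<in> ?Z m" "x \<in> ?Z k" "x \<noteq> \<O>" for x m k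
    using component_homogeneous[OF Z that(1), of k] component_homogeneous[OF Z that(2), of k] that(3)
    by (auto split: if_splits)
  fix m x assume x: "x \<in> ?Z m"
  have xM: "x \<in> M" by (rule gradingD(2)[OF Z x])
  show "x \<in> \<Delta> m"
    unfolding \<Delta>_def
  proof (rule patternI[OF xM], rule ccontr)
    fix i j assume ij: "i < n" "j < n" and ne: "int (b j) \<noteq> int (b i) + m" and nz: "x $$ (i, j) \<noteq> 0"
    have "E i i * x * E j j \<in> ?Z (0 + m + 0)"
      by (rule gradingD(4)[OF Z gradingD(4)[OF Z E0 x] E0])
    moreover have "E i i * x * E j j = x $$ (i, j) \<cdot>\<^sub>m E i j"
      by (rule mat_eqI) (use ij xM in \<open>auto simp: mult_E_index E_mult_index\<close>)
    ultimately have "inverse (x $$ (i, j)) \<cdot>\<^sub>m (x $$ (i, j) \<cdot>\<^sub>m E i j) \<in> ?Z m"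
      using subspaceD(4)[OF gradingD(1)[OF Z]] by simp
    moreover have "inverse (x $$ (i, j)) \<cdot>\<^sub>m (x $$ (i, j) \<cdot>\<^sub>m E i j) = E i j"
      by (rule mat_eqI) (use nz in auto)
    ultimately have Em: "E i j \<in> ?Z m" by simp
    show False
    proof (cases "b i \<le> b j")
      case True
      then have "E i j \<in> ?Z (int (b j) - int (b i))" using le E\<Delta>[of i j] by simp
      then show False using inj[OF Em _ E_nonzero[OF ij]] ne by simp
    next
      case False
      then have "E j i \<in> ?Z (int (b i) - int (b j))" using le E\<Delta>[of j i] by simp
      then have "E i j * E j i \<in> ?Z (m + (int (b i) - int (b j)))" by (rule gradingD(4)[OF Z Em])
      then have "E i i \<in> ?Z (m + (int (b i) - int (b j)))" using ij by (simp add: E_mult_E)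
      then show False using inj[OF E0 _ E_nonzero[OF ij(1,1)]] ne by force
    qed
  qed
qed

lemma compatible_upper:
  fixes A :: "int \<times> 'g::ab_group_add \<Rightarrow> 'a::field mat set"
  assumes A: "compatible A"
  shows "subspace_sum n A {k. 0 \<le> fst k} = U"
proof (intro equalityI subsetI)
  note gr = compatible_grading[OF A]
  note Z = compatible_coarsening_fst[OF A]
  fix x assume "x \<in> subspace_sum n A {k. 0 \<le> fst k}"
  with gr show "x \<in> U"
  proof (induction rule: subspace_sum_induct)
    case zero
    show ?case by (rule subspaceD(2)[OF U_subspace])
  next
    case (add x y)
    then show ?case by (intro subspaceD(3)[OF U_subspace])
  next
    case (homogeneous k x)
    have "x \<in> coarsening n fst A (fst k)"
      unfolding coarsening_def by (rule homogeneous_in_subspace_sum[OF gr homogeneous(2)]) simp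
    then have "x \<in> \<Delta> (fst k)" by (simp add: Z)
    then show ?case using homogeneous(1) unfolding U_def \<Delta>_def by (elim pattern_mono) auto
  qed
next
  note gr = compatible_grading[OF A]
  note Z = compatible_coarsening_fst[OF A]
  note sub = subspaceD[OF subspace_sum_subspace[OF gr, of "{k. 0 \<le> fst k}"]]
  fix x :: "'a mat" assume "x \<in> U"
  then show "x \<in> subspace_sum n A {k. 0 \<le> fst k}"
    unfolding U_def
  proof (induction rule: pattern_induct)
    case zero
    show ?case by (rule sub(2))
  next
    case (add x y)
    then show ?case by (intro sub(3))
  next
    case (unit c i j)
    let ?I = "fst -` {int (b j) - int (b i)} :: (int \<times> 'g) set"
    have "(E i j :: 'a mat) \<in> \<Delta> (int (b j) - int (b i))" unfolding \<Delta>_def by (rule E_pattern) simp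
    then have "E i j \<in> subspace_sum n A ?I"
      unfolding Z[symmetric] coarsening_def .
    moreover have "?I \<subseteq> {k. 0 \<le> fst k}" using unit by auto
    ultimately have "E i j \<in> subspace_sum n A {k. 0 \<le> fst k}" using subspace_sum_mono by blast
    then show ?case by (rule sub(4))
  qed
qed

lemma restrict_grading:
  fixes A :: "int \<times> 'g::ab_group_add \<Rightarrow> 'a::field mat set"
  assumes A: "compatible A"
  shows "is_grading n U (restrict_coarsen n A)"
proof -
  have "is_grading n (subspace_sum n A {k. 0 \<le> fst k}) (\<lambda>h. subspace_sum n A {g \<in> {k. 0 \<le> fst k}. snd g = h})"
    by (rule grading_coarsen[OF compatible_grading[OF A]]) auto
  moreover have "(\<lambda>h. subspace_sum n A {g \<in> {k. 0 \<le> fst k}. snd g = h}) = restrict_coarsen n A"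
  proof
    fix h :: 'g
    have "{g \<in> {k. 0 \<le> fst k}. snd g = h} = {(m, h) | m. (0::int) \<le> m}" by auto
    then show "subspace_sum n A {g \<in> {k. 0 \<le> fst k}. snd g = h} = restrict_coarsen n A h"
      by (simp add: restrict_coarsen_def)
  qed
  ultimately show ?thesis using compatible_upper[OF A] by simp
qed

lemma restrict_le: "restrict_coarsen n A g \<subseteq> coarsening n snd A g"
  unfolding restrict_coarsen_def coarsening_def by (rule subspace_sum_mono) auto

lemma compatible_J_graded:
  "compatible A \<Longrightarrow> graded_subspace n M (coarsening n snd A) J"
  by (rule J_graded_extension[OF restrict_grading compatible_coarsenings(2) restrict_le])

text \<open>The \<open>int \<times> G\<close>-grading is the common refinement of its two coarsenings, of which the first is
  the natural one; so only the second can vary.\<close>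

lemma compatible_iff:
  fixes A :: "int \<times> 'g::ab_group_add \<Rightarrow> 'a::field mat set"
  assumes A: "compatible A"
  shows "x \<in> A k \<longleftrightarrow> x \<in> \<Delta> (fst k) \<and> x \<in> coarsening n snd A (snd k)"
proof -
  note gr = compatible_grading[OF A]
  show ?thesis
    unfolding compatible_coarsening_fst[OF A, symmetric] homogeneous_iff[OF gr, of x k]
      coarsening_def subspace_sum_iff[OF gr]
    by (auto simp: prod_eq_iff)
qed

lemma compatible_std:
  fixes A :: "int \<times> 'g::ab_group_add \<Rightarrow> 'a::field mat set"
  assumes A: "compatible A" and q: "q \<le> s"
  shows "std q \<in> coarsening n snd A 0"
proof -
  let ?D = "coarsening n snd A" and ?f = "std q :: 'a mat"
  note gr = compatible_grading[OF A]
  note D = compatible_coarsenings(2)[OF A]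
  have f\<Delta>: "?f \<in> \<Delta> 0" unfolding \<Delta>_def std_def by (rule patternI) auto
  have fM: "?f \<in> M" by (simp add: std_def)
  have "?f \<in> coarsening n fst A 0" using f\<Delta> compatible_coarsening_fst[OF A] by simp
  then have "\<forall>k. k \<notin> fst -` {0} \<longrightarrow> component n A k ?f = \<O>"
    unfolding coarsening_def subspace_sum_iff[OF gr] by simp
  then have out: "component n A k ?f = \<O>" if "fst k \<noteq> 0" for k
    using that by (metis vimage_singleton_eq)
  let ?r = "component n ?D 0 ?f"
  let ?K = "snd ` {k. component n A k ?f \<noteq> \<O>}"
  have fin: "finite ?K" using finite_component_support[OF gr fM] by simp
  have r: "?r = component n A (0, 0) ?f"
  proof (rule component_unique[OF D fin])
    show "component n A (0, g) ?f \<in> ?D g" for g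
      unfolding coarsening_def
      by (rule homogeneous_in_subspace_sum[OF gr component_mem[OF gr fM]]) simp
    show "component n A (0, g) ?f = \<O>" if g: "g \<notin> ?K" for g
    proof (rule ccontr)
      assume "component n A (0, g) ?f \<noteq> \<O>"
      then have "(0, g) \<in> {k. component n A k ?f \<noteq> \<O>}" by simp
      then have "snd (0 :: int, g) \<in> ?K" by (rule imageI)
      then show False using g by simp
    qed
    have "mat_sum n (\<lambda>g. component n A (0, g) ?f) ?K = mat_sum n (\<lambda>k. component n A k ?f) (Pair 0 ` ?K)"
      by (rule mat_sum_reindex[symmetric])
         (use fin component_closed[OF gr fM] in \<open>auto simp: inj_on_def\<close>)
    also have "\<dots> = ?f"
    proof (rule component_sum[OF gr fM])
      show "finite (Pair 0 ` ?K)" using fin by simp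
      show "{k. component n A k ?f \<noteq> \<O>} \<subseteq> Pair 0 ` ?K"
      proof
        fix k assume k: "k \<in> {k. component n A k ?f \<noteq> \<O>}"
        then have "fst k = 0" using out by blast
        then have "k = Pair 0 (snd k)" by (simp add: prod_eq_iff)
        then show "k \<in> Pair 0 ` ?K" using k by blast
      qed
    qed
    finally show "mat_sum n (\<lambda>g. component n A (0, g) ?f) ?K = ?f" .
  qed
  then have r\<Delta>: "?r \<in> \<Delta> 0"
    using component_mem[OF gr fM, of "(0, 0)"] compatible_iff[OF A, of ?r "(0, 0)"] by simp
  note Tg = T_graded[OF D compatible_J_graded[OF A] q]
  note std = splittingD(1,2)[OF splitting_std q]
  have rT: "?r \<in> T q" by (rule graded_subspaceD(3)[OF Tg std(1)])
  have rM: "?r \<in> M" by (rule T_carrier[OF rT])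
  \<comment> \<open>Both \<open>std q\<close> and its component are right identities of \<open>T q\<close>, and they commute.\<close>
  have "?f = ?f * ?r" using homogeneous_right_identity[OF D Tg std(1) std(2) std(1)] by simp
  also have "\<dots> = ?r * ?f"
    by (rule mat_eqI) (use rM fM r\<Delta> in \<open>auto simp: std_def diag_mult_index mult_diag_index \<Delta>_def pattern_def\<close>)
  also have "\<dots> = ?r" by (rule std(2)[OF rT])
  finally show ?thesis using component_mem[OF D fM, of 0] by simp
qed

lemma compatible_piece_std:
  fixes A :: "int \<times> 'g::ab_group_add \<Rightarrow> 'a::field mat set"
  assumes A: "compatible A" and q: "q < s"
  shows "piece std q \<in> coarsening n snd A 0"
  unfolding piece_def
  using subspace_diff[OF gradingD(1)[OF compatible_coarsenings(2)[OF A]]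
      compatible_std[OF A] compatible_std[OF A]] q by simp

section \<open>Restriction is injective on isomorphism classes\<close>

lemma restrict_iso:
  fixes A A' :: "int \<times> 'g::ab_group_add \<Rightarrow> 'a::field mat set"
  assumes A: "compatible A" and A': "compatible A'"
    and \<phi>: "algebra_automorphism M \<phi>" and im: "\<And>k. \<phi> ` A k = A' k"
  shows "algebra_automorphism U \<phi>" "\<phi> ` restrict_coarsen n A g = restrict_coarsen n A' g"
proof -
  note sum = automorphism_subspace_sum[OF \<phi> compatible_grading[OF A] compatible_grading[OF A'] im]
  show "\<phi> ` restrict_coarsen n A g = restrict_coarsen n A' g"
    unfolding restrict_coarsen_def by (rule sum)
  have "\<phi> ` U = U" using sum[of "{k. 0 \<le> fst k}"] by (simp add: compatible_upper A A')
  moreover have UM: "U \<subseteq> (M :: 'a mat set)" by (auto intro: U_carrier)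
  ultimately have "bij_betw \<phi> U U"
    using \<phi> by (auto simp: algebra_automorphism_def bij_betw_def intro: inj_on_subset)
  then show "algebra_automorphism U \<phi>"
    using \<phi> UM unfolding algebra_automorphism_def by blast
qed

lemma conj_image_whole:
  fixes t t' :: "'a::field mat"
  assumes "t \<in> M" "t' \<in> M" "t * t' = 1\<^sub>m n"
  shows "(\<lambda>x. t * x * t') ` M = M"
proof (intro equalityI subsetI)
  fix x :: "'a mat" assume x: "x \<in> M"
  have "x = t * (t' * x * t) * t'" by (rule conj_conj[OF assms x, symmetric])
  moreover have "t' * x * t \<in> M" using assms x by simp
  ultimately show "x \<in> (\<lambda>x. t * x * t') ` M" by (rule image_eqI)
qed (use assms in auto)

lemma splitting_conj:
  fixes v v' :: "'a::field mat"
  assumes v: "v \<in> M" "v' \<in> M" "v * v' = 1\<^sub>m n" "v' * v = 1\<^sub>m n"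
    and J: "\<And>y. y \<in> J \<Longrightarrow> v * y * v' \<in> J" "\<And>y. y \<in> J \<Longrightarrow> v' * y * v \<in> J"
    and F: "splitting F"
  shows "splitting (\<lambda>q. v' * F q * v)"
  unfolding splitting_def
proof (intro conjI allI impI ballI)
  fix q assume q: "q \<le> s"
  show "v' * F q * v \<in> T q" by (rule T_conj[OF v(2,1,4) J(1) q splittingD(1)[OF F q]])
  fix x :: "'a mat" assume x: "x \<in> T q"
  have xM: "x \<in> M" by (rule T_carrier[OF x])
  have FM: "F q \<in> M" by (rule splittingD(4)[OF F q])
  have y: "v * x * v' \<in> T q" by (rule T_conj[OF v(1-3) J(2) q x])
  have "x * (v' * F q * v) = (v' * (v * x * v') * v) * (v' * F q * v)"
    using conj_conj[OF v(2,1,4) xM] by simp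
  also have "\<dots> = v' * ((v * x * v') * F q) * v"
    by (rule conj_mult[OF v(2,1,3) T_carrier[OF y] FM])
  also have "(v * x * v') * F q = v * x * v'" by (rule splittingD(2)[OF F q y])
  also have "v' * (v * x * v') * v = x" by (rule conj_conj[OF v(2,1,4) xM])
  finally show "x * (v' * F q * v) = x" .
next
  fix p q :: nat assume pq: "p \<le> q" "q \<le> s"
  have "F p \<in> M" "F q \<in> M" using splittingD(4)[OF F] pq by auto
  then show "v' * F p * v * (v' * F q * v) = v' * F q * v"
    using conj_mult[OF v(2,1,3)] splittingD(3)[OF F pq] by simp
qed

text \<open>The isomorphism of the restrictions is conjugation by a matrix \<open>v\<close>, and by uniqueness of
  extensions it matches the \<open>G\<close>-gradings of \<open>M\<close>. It may move the block idempotents to another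
  splitting \<open>G\<close> of the flag, again of degree zero. The matrix that conjugates \<open>G\<close> back to the
  standard splitting has degree zero, so correcting by it keeps the \<open>G\<close>-grading and restores the
  block diagonals.\<close>

lemma restrict_reflects_iso:
  fixes A A' :: "int \<times> 'g::ab_group_add \<Rightarrow> 'a::field mat set"
  assumes A: "compatible A" and A': "compatible A'"
    and \<psi>: "algebra_automorphism U \<psi>"
    and im: "\<And>g. \<psi> ` restrict_coarsen n A g = restrict_coarsen n A' g"
  shows "\<exists>\<phi>. algebra_automorphism M \<phi> \<and> (\<forall>k. \<phi> ` A k = A' k)"
proof -
  obtain v v' where v: "v \<in> M" "v' \<in> M" "v * v' = 1\<^sub>m n" "v' * v = 1\<^sub>m n"
    and \<psi>v: "\<And>x. x \<in> U \<Longrightarrow> \<psi> x = v' * x * v"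
    using automorphism_inner[OF \<psi>] by blast
  have \<psi>U: "\<psi> ` U = U" using \<psi> by (auto simp: algebra_automorphism_def bij_betw_def)
  have stable': "v' * x * v \<in> U" if "x \<in> U" for x using \<psi>U \<psi>v[OF that] that by (metis imageI)
  have stable: "v * x * v' \<in> U" if x: "x \<in> U" for x
  proof -
    obtain y where y: "y \<in> U" "x = v' * y * v" using \<psi>U \<psi>v x by (metis imageE)
    then show ?thesis using conj_conj[OF v(1-3) U_carrier[OF y(1)]] by simp
  qed
  let ?D = "coarsening n snd A" and ?D' = "coarsening n snd A'"
  let ?B = "restrict_coarsen n A" and ?B' = "restrict_coarsen n A'"
  note D = compatible_coarsenings(2)[OF A] and D' = compatible_coarsenings(2)[OF A']
  note B = restrict_grading[OF A] and B' = restrict_grading[OF A']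
  \<comment> \<open>Both gradings of the full matrix algebra extend the second restriction.\<close>
  have conjD: "(\<lambda>g. (\<lambda>x. v' * x * v) ` ?D g) = ?D'"
  proof -
    have "is_grading n M (\<lambda>g. (\<lambda>x. v' * x * v) ` ?D g)"
      using grading_conj[OF D v(2,1,3)] conj_image_whole[OF v(2,1,4)] by simp
    moreover have "?B' g \<subseteq> (\<lambda>x. v' * x * v) ` ?D g" for g
    proof
      fix y assume "y \<in> ?B' g"
      then obtain x where x: "x \<in> ?B g" "y = \<psi> x" using im[of g] by blast
      then have "y = v' * x * v" using \<psi>v[OF homogeneous_subset[OF B x(1)]] by simp
      then show "y \<in> (\<lambda>x. v' * x * v) ` ?D g" using x(1) restrict_le[of A g] by blast
    qed
    ultimately have "(\<lambda>g. (\<lambda>x. v' * x * v) ` ?D g) = ext ?B'" by (rule extension_unique[OF B'])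
    also have "\<dots> = ?D'" by (rule extension_unique[OF B' D' restrict_le, symmetric])
    finally show ?thesis .
  qed
  have conj_mem: "v' * x * v \<in> ?D' g" if "x \<in> ?D g" for x g
    using that fun_cong[OF conjD, of g] by blast
  define G where "G = (\<lambda>q. v' * std q * v)"
  have G: "splitting G"
    unfolding G_def
    by (rule splitting_conj[OF v J_conj[OF v stable stable'] J_conj[OF v(2,1,4,3) stable' stable] splitting_std])
  have stdM: "(std q :: 'a mat) \<in> M" for q by (simp add: std_def)
  have pieceG: "piece G q = v' * piece std q * v" for q
    unfolding piece_def G_def using v(1,2) stdM by (simp add: diff_left diff_right)
  let ?t = "intertwiner s (piece std) (piece G)" and ?t' = "intertwiner s (piece G) (piece std)"
  have tM: "?t \<in> M" and tt': "?t * ?t' = 1\<^sub>m n"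
    and comm: "\<And>q. q < s \<Longrightarrow> piece std q * ?t = ?t * piece G q"
    using splitting_conjugate[OF splitting_std G] by auto
  have t'M: "?t' \<in> M" and t't: "?t' * ?t = 1\<^sub>m n"
    using splitting_conjugate(1,2)[OF G splitting_std] by auto
  have e': "piece std q \<in> ?D' 0" if "q < s" for q by (rule compatible_piece_std[OF A' that])
  have eG: "piece G q \<in> ?D' 0" if "q < s" for q
    unfolding pieceG by (rule conj_mem[OF compatible_piece_std[OF A that]])
  have tD: "?t \<in> ?D' 0" "?t' \<in> ?D' 0"
    unfolding intertwiner_def
    using subspace_mat_sum[OF gradingD(1)[OF D', of 0], of "{..<s}"]
      gradingD(4)[OF D' e' eG] gradingD(4)[OF D' eG e'] by auto
  define w where "w = ?t * v'"
  define w' where "w' = v * ?t'"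
  have wM: "w \<in> M" "w' \<in> M" unfolding w_def w'_def using tM t'M v by auto
  have "w * w' = ?t * (v' * v) * ?t'" unfolding w_def w'_def using tM t'M v(1,2) by (simp add: mult_assoc)
  then have ww': "w * w' = 1\<^sub>m n" using v(4) tM tt' by simp
  have "w' * w = v * (?t' * ?t) * v'" unfolding w_def w'_def using tM t'M v(1,2) by (simp add: mult_assoc)
  then have w'w: "w' * w = 1\<^sub>m n" using v t't by simp
  have wcomm: "piece std q * w = w * piece std q" if q: "q < s" for q
  proof -
    have eM: "(piece std q :: 'a mat) \<in> M" by (rule piece_closed[OF splitting_std q])
    have "piece std q * w = (piece std q * ?t) * v'" unfolding w_def using eM tM v by (simp add: mult_assoc)
    also have "\<dots> = ?t * v' * piece std q * (v * v')"
      unfolding comm[OF q] pieceG[of q] using eM tM v(1,2) by (simp add: mult_assoc)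
    finally show ?thesis unfolding w_def using v eM tM by simp
  qed
  let ?\<phi> = "\<lambda>x. w * x * w'"
  have "algebra_automorphism M ?\<phi>"
    by (rule automorphism_conj[OF wM ww' w'w]) (use wM in auto)
  moreover have "(\<lambda>k. ?\<phi> ` A k) = A'"
  proof (rule grading_le_eq[OF _ compatible_grading[OF A']])
    show "is_grading n M (\<lambda>k. ?\<phi> ` A k)"
      using grading_conj[OF compatible_grading[OF A] wM w'w] conj_image_whole[OF wM ww'] by simp
    show "?\<phi> ` A k \<subseteq> A' k" for k
    proof
      fix y assume "y \<in> ?\<phi> ` A k"
      then obtain x where "x \<in> A k" "y = ?\<phi> x" by (rule imageE) simp
      then have x: "x \<in> \<Delta> (fst k)" "x \<in> ?D (snd k)" "y = ?\<phi> x"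
        using compatible_iff[OF A, of x k] by simp_all
      have "y \<in> \<Delta> (fst k)" unfolding x(3) by (rule \<Delta>_conj[OF wM ww' w'w wcomm x(1)])
      moreover have "y \<in> ?D' (snd k)"
      proof -
        have xM: "x \<in> M" by (rule \<Delta>_carrier[OF x(1)])
        have "y = ?t * (v' * x * v) * ?t'"
          unfolding x(3) w_def w'_def using tM t'M v(1,2) xM by (simp add: mult_assoc)
        moreover have "?t * (v' * x * v) * ?t' \<in> ?D' (0 + snd k + 0)"
          by (rule gradingD(4)[OF D' gradingD(4)[OF D' tD(1) conj_mem[OF x(2)]] tD(2)])
        ultimately show ?thesis by simp
      qed
      ultimately show "y \<in> A' k" using compatible_iff[OF A', of y k] by simp
    qed
  qed
  then have "\<forall>k. ?\<phi> ` A k = A' k" by (metis (no_types))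
  ultimately show ?thesis by blast
qed

section \<open>Every grading is a restriction up to isomorphism\<close>

text \<open>Extend \<open>B\<close> to \<open>M\<close> and conjugate by an element of \<open>U\<close> that carries a splitting of degree zero
  to the standard one. Then the block diagonals are graded, and intersecting them with the
  homogeneous components gives the required refinement.\<close>

lemma restrict_surj:
  fixes B :: "'g::ab_group_add \<Rightarrow> 'a::field mat set"
  assumes B: "is_grading n U B"
  shows "\<exists>A :: int \<times> 'g \<Rightarrow> 'a mat set. compatible A \<and>
    (\<exists>\<psi>. algebra_automorphism U \<psi> \<and> (\<forall>g. \<psi> ` B g = restrict_coarsen n A g))"
proof -
  let ?D = "ext B"
  note D = ext_grading[OF B]
  note le = subset_ext[OF B]
  have U: "component n ?D g x \<in> U" if "x \<in> U" for x g
    using component_coarser[OF B D le that] homogeneous_subset[OF B component_mem[OF B that]] by simp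
  have inter: "x \<in> B g" if "x \<in> ?D g" "x \<in> U" for x g
    using component_coarser[OF B D le that(2), of g] component_homogeneous[OF D that(1), of g]
      component_mem[OF B that(2), of g] by simp
  obtain F where F: "splitting F" and F0: "\<And>q. q \<le> s \<Longrightarrow> F q \<in> ?D 0" "\<And>q. q \<le> s \<Longrightarrow> F q \<in> U"
    using homogeneous_splitting[OF D J_graded_extension[OF B D le] U] by blast
  let ?t = "intertwiner s (piece std) (piece F)" and ?t' = "intertwiner s (piece F) (piece std)"
  have tM: "?t \<in> M" and tt': "?t * ?t' = 1\<^sub>m n"
    and comm: "\<And>q. q < s \<Longrightarrow> piece std q * ?t = ?t * piece F q"
    using splitting_conjugate[OF splitting_std F] by auto
  have t'M: "?t' \<in> M" and t't: "?t' * ?t = 1\<^sub>m n"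
    using splitting_conjugate(1,2)[OF F splitting_std] by auto
  have pU: "(piece std q :: 'a mat) \<in> U" "piece F q \<in> U" if "q < s" for q
    unfolding piece_def using F0(2)[of q] F0(2)[of "Suc q"] that
    by (auto intro!: subspace_diff[OF U_subspace] std_U)
  have tU: "?t \<in> U" "?t' \<in> U"
    unfolding intertwiner_def
    by (rule subspace_mat_sum[OF U_subspace]; use pU in \<open>auto intro!: U_mult\<close>)+
  let ?c = "\<lambda>x. ?t * x * ?t'"
  define E' where "E' = (\<lambda>g. ?c ` ?D g)"
  have E': "is_grading n M E'"
    unfolding E'_def using grading_conj[OF D tM t'M t't] conj_image_whole[OF tM t'M tt'] by simp
  have piece_F: "piece F q \<in> ?D 0" if "q < s" for q
    unfolding piece_def using subspace_diff[OF gradingD(1)[OF D, of 0]] F0(1) that by simp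
  have "piece std q \<in> E' 0" if q: "q < s" for q
  proof -
    have eM: "(piece std q :: 'a mat) \<in> M" by (rule piece_closed[OF splitting_std q])
    have "piece std q = piece std q * (?t * ?t')" using tt' eM by simp
    also have "\<dots> = (piece std q * ?t) * ?t'" using tM t'M eM by (simp add: mult_assoc)
    also have "\<dots> = ?c (piece F q)" using comm[OF q] by simp
    finally show ?thesis unfolding E'_def using piece_F[OF q] by (rule image_eqI)
  qed
  then have \<Delta>g: "graded_subspace n M E' (\<Delta> m)" for m by (rule \<Delta>_graded[OF E'])
  define A :: "int \<times> 'g \<Rightarrow> 'a mat set" where "A = (\<lambda>k. \<Delta> (fst k) \<inter> E' (snd k))"
  have gr: "is_grading n M A" unfolding A_def by (rule grading_refine[OF E' \<Delta>_grading \<Delta>g])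
  have "\<Delta> m \<subseteq> coarsening n fst A m" for m
  proof
    fix x :: "'a mat" assume x: "x \<in> \<Delta> m"
    have xM: "x \<in> M" by (rule \<Delta>_carrier[OF x])
    have "component n E' g x \<in> A (m, g)" for g
      using graded_subspaceD(3)[OF \<Delta>g x] component_mem[OF E' xM] by (simp add: A_def)
    then have "component n E' g x \<in> subspace_sum n A (fst -` {m})" for g
      using homogeneous_in_subspace_sum[OF gr, of _ "(m, g)" "fst -` {m}"] by simp
    then have "mat_sum n (\<lambda>g. component n E' g x) {g. component n E' g x \<noteq> \<O>} \<in> subspace_sum n A (fst -` {m})"
      by (intro subspace_mat_sum[OF subspace_sum_subspace[OF gr]] finite_component_support[OF E' xM])
    then show "x \<in> coarsening n fst A m"
      unfolding coarsening_def
      using component_sum[OF E' xM finite_component_support[OF E' xM] subset_refl] by simp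
  qed
  then have comp: "compatible A" using gr by (simp add: compatible_def)
  have stable: "?c x \<in> U" "?t' * x * ?t \<in> U" if "x \<in> U" for x using tU that by (auto intro!: U_mult)
  have aut: "algebra_automorphism U ?c"
    by (rule automorphism_conj[OF tM t'M tt' t't]) (use stable in \<open>auto intro: U_carrier\<close>)
  have "restrict_coarsen n A = (\<lambda>g. ?c ` B g)"
  proof (rule grading_le_eq[OF restrict_grading[OF comp]])
    have "?c ` U = U" using aut by (auto simp: algebra_automorphism_def bij_betw_def)
    then show cB: "is_grading n U (\<lambda>g. ?c ` B g)" using grading_conj[OF B tM t'M t't] by simp
    show "restrict_coarsen n A g \<subseteq> ?c ` B g" for g
    proof
      fix x assume "x \<in> restrict_coarsen n A g"
      then have "x \<in> subspace_sum n A {(m, g) | m. 0 \<le> m}" by (simp add: restrict_coarsen_def)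
      with gr show "x \<in> ?c ` B g"
      proof (induction rule: subspace_sum_induct[where P = "\<lambda>x. x \<in> ?c ` B g"])
        case zero
        show ?case by (rule gradingD(3)[OF cB])
      next
        case (add x y)
        then show ?case by (intro subspaceD(3)[OF gradingD(1)[OF cB]])
      next
        case (homogeneous k x)
        then obtain m where k: "k = (m, g)" "0 \<le> m" by blast
        have x\<Delta>: "x \<in> \<Delta> m" and "x \<in> E' g" using homogeneous(2) k by (auto simp: A_def)
        then obtain y where y: "y \<in> ?D g" "x = ?c y" unfolding E'_def by blast
        have "x \<in> U" using x\<Delta> k(2) unfolding U_def \<Delta>_def by (elim pattern_mono) auto
        moreover have "y = ?t' * x * ?t"
          unfolding y(2) using conj_conj[OF t'M tM t't gradingD(2)[OF D y(1)]] by simp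
        ultimately have "y \<in> U" using stable(2) by simp
        then show ?case using inter[OF y(1)] y(2) by blast
      qed
    qed
  qed
  then have "\<forall>g. ?c ` B g = restrict_coarsen n A g" by simp
  then show ?thesis using comp aut by blast
qed

end

section \<open>Isomorphism classes\<close>

lemma automorphism_inv:
  assumes \<phi>: "algebra_automorphism S \<phi>"
    and cl: "\<And>x y. x \<in> S \<Longrightarrow> y \<in> S \<Longrightarrow> x + y \<in> S" "\<And>c x. x \<in> S \<Longrightarrow> c \<cdot>\<^sub>m x \<in> S"
      "\<And>x y. x \<in> S \<Longrightarrow> y \<in> S \<Longrightarrow> x * y \<in> S"
  shows "algebra_automorphism S (inv_into S \<phi>)"
proof -
  let ?\<theta> = "inv_into S \<phi>"
  have bij: "bij_betw \<phi> S S" using \<phi> by (simp add: algebra_automorphism_def)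
  have inj: "\<phi> x = \<phi> y \<Longrightarrow> x \<in> S \<Longrightarrow> y \<in> S \<Longrightarrow> x = y" for x y
    using bij by (auto simp: bij_betw_def dest: inj_onD)
  have \<theta>: "?\<theta> x \<in> S" "\<phi> (?\<theta> x) = x" if "x \<in> S" for x
    using bij that by (auto simp: bij_betw_def inv_into_into f_inv_into_f)
  have "?\<theta> (x + y) = ?\<theta> x + ?\<theta> y" if "x \<in> S" "y \<in> S" for x y
    by (rule inj) (use \<phi> \<theta> cl that in \<open>auto simp: algebra_automorphism_def\<close>)
  moreover have "?\<theta> (c \<cdot>\<^sub>m x) = c \<cdot>\<^sub>m ?\<theta> x" if "x \<in> S" for c x
    by (rule inj) (use \<phi> \<theta> cl that in \<open>auto simp: algebra_automorphism_def\<close>)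
  moreover have "?\<theta> (x * y) = ?\<theta> x * ?\<theta> y" if "x \<in> S" "y \<in> S" for x y
    by (rule inj) (use \<phi> \<theta> cl that in \<open>auto simp: algebra_automorphism_def\<close>)
  ultimately show ?thesis
    using bij_betw_inv_into[OF bij] by (simp add: algebra_automorphism_def)
qed

lemma equiv_grading_iso:
  assumes S: "mat_subspace n S" and mult: "\<And>x y. x \<in> S \<Longrightarrow> y \<in> S \<Longrightarrow> x * y \<in> S"
  shows "equiv (gradings n S) (grading_iso n S)"
proof -
  interpret square_matrices n .
  note Ss = subspaceD[OF S]
  show ?thesis
  proof (rule equivI)
    show "grading_iso n S \<subseteq> gradings n S \<times> gradings n S" by (auto simp: grading_iso_def)
    show "refl_on (gradings n S) (grading_iso n S)"
      by (auto simp: refl_on_def grading_iso_def algebra_automorphism_def intro!: exI[of _ id])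
    show "sym (grading_iso n S)"
    proof (rule symI)
      fix A A' assume "(A, A') \<in> grading_iso n S"
      then obtain \<phi> where A: "A \<in> gradings n S" "A' \<in> gradings n S"
        and \<phi>: "algebra_automorphism S \<phi>" "\<forall>g. \<phi> ` A g = A' g"
        by (auto simp: grading_iso_def)
      have inj: "inj_on \<phi> S" using \<phi>(1) by (simp add: algebra_automorphism_def bij_betw_def)
      have "inv_into S \<phi> ` A' g = A g" for g
      proof -
        have "A g \<subseteq> S" using A(1) homogeneous_subset[of S A] by (auto simp: gradings_def)
        then have "inv_into S \<phi> ` (\<phi> ` A g) = A g"
          by (rule inv_into_image_cancel[OF inj])
        then show ?thesis using \<phi>(2) by simp
      qed
      then show "(A', A) \<in> grading_iso n S"
        using A automorphism_inv[OF \<phi>(1) Ss(3,4) mult] by (auto simp: grading_iso_def)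
    qed
    show "trans (grading_iso n S)"
    proof (rule transI)
      fix A A' A'' assume "(A, A') \<in> grading_iso n S" "(A', A'') \<in> grading_iso n S"
      then obtain \<phi> \<psi> where A: "A \<in> gradings n S" "A'' \<in> gradings n S"
        and \<phi>: "algebra_automorphism S \<phi>" "\<forall>g. \<phi> ` A g = A' g"
        and \<psi>: "algebra_automorphism S \<psi>" "\<forall>g. \<psi> ` A' g = A'' g"
        by (auto simp: grading_iso_def)
      have "\<phi> x \<in> S" if "x \<in> S" for x using \<phi>(1) that by (auto simp: algebra_automorphism_def bij_betw_def)
      then have "algebra_automorphism S (\<psi> \<circ> \<phi>)"
        using \<phi>(1) \<psi>(1) unfolding algebra_automorphism_def by (auto intro: bij_betw_trans)
      moreover have "\<forall>g. (\<psi> \<circ> \<phi>) ` A g = A'' g" using \<phi>(2) \<psi>(2) by (metis image_comp)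
      ultimately show "(A, A'') \<in> grading_iso n S" using A unfolding grading_iso_def by blast
    qed
  qed
qed

lemma sum_list_take_mono:
  fixes ns :: "nat list"
  assumes "p \<le> q"
  shows "sum_list (take p ns) \<le> sum_list (take q ns)"
  using take_add[of p "q - p" ns] assms by simp

lemma block_of_image:
  assumes pos: "\<forall>k\<in>set ns. k \<ge> 1"
  shows "block_of ns ` {..<sum_list ns} = {..<length ns}"
proof (intro equalityI subsetI)
  fix q assume "q \<in> block_of ns ` {..<sum_list ns}"
  then obtain i where i: "i < sum_list ns" "q = block_of ns i" by auto
  then have "ns \<noteq> []" by auto
  then have "i < sum_list (take (Suc (length ns - 1)) ns)" using i by simp
  then have "block_of ns i \<le> length ns - 1" unfolding block_of_def by (rule Least_le)
  then show "q \<in> {..<length ns}" using i(2) \<open>ns \<noteq> []\<close> by (cases ns) auto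
next
  fix q assume "q \<in> {..<length ns}"
  then have q: "q < length ns" by simp
  let ?i = "sum_list (take q ns)"
  have lt: "?i < sum_list (take (Suc q) ns)"
    using q pos nth_mem[OF q] by (fastforce simp: take_Suc_conv_app_nth)
  also have "\<dots> \<le> sum_list ns" using sum_list_take_mono[of "Suc q" "length ns" ns] q by simp
  finally have "?i < sum_list ns" .
  moreover have "block_of ns ?i = q"
    unfolding block_of_def
  proof (rule Least_equality)
    show "?i < sum_list (take (Suc q) ns)" by (rule lt)
    fix r assume "?i < sum_list (take (Suc r) ns)"
    then show "q \<le> r" using sum_list_take_mono[of "Suc r" q ns] by (meson not_less not_less_eq_eq)
  qed
  ultimately show "q \<in> block_of ns ` {..<sum_list ns}" by force
qed

theorem theorem9:
  fixes n :: nat and ns :: "nat list"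
  assumes "ns \<noteq> []" and "\<forall>k\<in>set ns. k \<ge> 1" and "n = sum_list ns"
  shows
    "(\<forall>A :: int \<times> 'g::ab_group_add \<Rightarrow> 'f::field mat set.
        admissible ns A \<longrightarrow> restrict_coarsen n A \<in> gradings n (UT ns)) \<and>
     (\<exists>\<Phi> :: (int \<times> 'g \<Rightarrow> 'f mat set) set \<Rightarrow> ('g \<Rightarrow> 'f mat set) set.
        (\<forall>A. admissible ns A \<longrightarrow>
           \<Phi> (grading_iso n (carrier_mat n n) `` {A}) =
             grading_iso n (UT ns) `` {restrict_coarsen n A}) \<and>
        bij_betw \<Phi> (admissible_classes ns) (gradings n (UT ns) // grading_iso n (UT ns)))"
proof -
  interpret block_pattern n "block_of ns" "length ns"
    using block_of_image[OF assms(2)] assms(1,3) by unfold_locales auto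
  have UT: "UT ns = (U :: 'f mat set)"
    unfolding UT_def assms(3)[symmetric] U_def pattern_def by (simp add: not_le)
  have "block_diagonal ns m = (\<Delta> m :: 'f mat set)" for m
    unfolding block_diagonal_def assms(3)[symmetric] \<Delta>_def pattern_def by simp
  then have adm: "admissible ns A \<longleftrightarrow> compatible A" for A :: "int \<times> 'g \<Rightarrow> 'f mat set"
    by (simp add: admissible_def compatible_def gradings_def assms(3)[symmetric])
  define R :: "((int \<times> 'g \<Rightarrow> 'f mat set) \<times> (int \<times> 'g \<Rightarrow> 'f mat set)) set"
    where "R = grading_iso n M"
  define R' :: "(('g \<Rightarrow> 'f mat set) \<times> ('g \<Rightarrow> 'f mat set)) set" where "R' = grading_iso n U"
  have eqR: "equiv (gradings n M) R"
    unfolding R_def by (rule equiv_grading_iso[OF subspace_carrier]) simp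
  have eqR': "equiv (gradings n U) R'"
    unfolding R'_def by (rule equiv_grading_iso[OF U_subspace U_mult])
  have restr: "restrict_coarsen n A \<in> gradings n U" if "compatible A" for A :: "int \<times> 'g \<Rightarrow> 'f mat set"
    using restrict_grading[OF that] by (simp add: gradings_def)
  have iso: "(A, A') \<in> R \<longleftrightarrow> (restrict_coarsen n A, restrict_coarsen n A') \<in> R'"
    if "compatible A" "compatible A'" for A A' :: "int \<times> 'g \<Rightarrow> 'f mat set"
  proof
    assume "(A, A') \<in> R"
    then obtain \<phi> where \<phi>: "algebra_automorphism M \<phi>" "\<And>k. \<phi> ` A k = A' k"
      by (auto simp: R_def grading_iso_def)
    then show "(restrict_coarsen n A, restrict_coarsen n A') \<in> R'"
      using restrict_iso[OF that \<phi>] restr[OF that(1)] restr[OF that(2)]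
      by (auto simp: R'_def grading_iso_def)
  next
    assume "(restrict_coarsen n A, restrict_coarsen n A') \<in> R'"
    then obtain \<psi> where \<psi>: "algebra_automorphism U \<psi>"
      "\<And>g. \<psi> ` restrict_coarsen n A g = restrict_coarsen n A' g"
      by (auto simp: R'_def grading_iso_def)
    then show "(A, A') \<in> R"
      using restrict_reflects_iso[OF that \<psi>] that by (auto simp: R_def grading_iso_def gradings_def compatible_def)
  qed
  define \<Phi> :: "(int \<times> 'g \<Rightarrow> 'f mat set) set \<Rightarrow> ('g \<Rightarrow> 'f mat set) set"
    where "\<Phi> = (\<lambda>C. \<Union>A\<in>{A \<in> C. compatible A}. R' `` {restrict_coarsen n A})"
  have self: "A \<in> R `` {A}" if "compatible A" for A
    using equiv_class_self[OF eqR] that by (simp add: gradings_def compatible_def)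
  have \<Phi>: "\<Phi> (R `` {A}) = R' `` {restrict_coarsen n A}" if A: "compatible A" for A
  proof -
    have "R' `` {restrict_coarsen n A'} = R' `` {restrict_coarsen n A}"
      if "A' \<in> R `` {A}" "compatible A'" for A'
      using equiv_class_eq[OF eqR'] iso[OF A that(2)] that(1) by blast
    then show ?thesis unfolding \<Phi>_def using self[OF A] A by blast
  qed
  have classes: "admissible_classes ns = {R `` {A} | A. compatible A}"
  proof -
    have "C = R `` {A}" if "C \<in> gradings n M // R" "A \<in> C" for C A
      using that eqR by (metis Image_singleton_iff equiv_class_eq quotientE)
    moreover have "R `` {A} \<in> gradings n M // R" if "compatible A" for A
      using that by (auto simp: gradings_def compatible_def intro: quotientI)
    ultimately show ?thesis
      unfolding admissible_classes_def adm assms(3)[symmetric] R_def[symmetric]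
      using self by blast
  qed
  have "bij_betw \<Phi> (admissible_classes ns) (gradings n U // R')"
    unfolding bij_betw_def
  proof
    show "inj_on \<Phi> (admissible_classes ns)"
    proof (rule inj_onI)
      fix C C' assume "C \<in> admissible_classes ns" "C' \<in> admissible_classes ns" and eq: "\<Phi> C = \<Phi> C'"
      then obtain A A' where A: "compatible A" "compatible A'" "C = R `` {A}" "C' = R `` {A'}"
        unfolding classes by blast
      then have "R' `` {restrict_coarsen n A} = R' `` {restrict_coarsen n A'}" using \<Phi> eq by simp
      then have "(restrict_coarsen n A, restrict_coarsen n A') \<in> R'"
        using eq_equiv_class[OF _ eqR' restr[OF A(2)]] by blast
      then have "(A, A') \<in> R" using iso[OF A(1,2)] by blast
      then show "C = C'" unfolding A(3,4) by (rule equiv_class_eq[OF eqR])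
    qed
    show "\<Phi> ` admissible_classes ns = gradings n U // R'"
    proof (intro equalityI subsetI)
      fix Q assume "Q \<in> \<Phi> ` admissible_classes ns"
      then obtain A where A: "compatible A" "Q = \<Phi> (R `` {A})" unfolding classes by blast
      then show "Q \<in> gradings n U // R'" using \<Phi>[OF A(1)] quotientI[OF restr[OF A(1)]] by simp
    next
      fix Q assume "Q \<in> gradings n U // R'"
      then obtain B where B: "B \<in> gradings n U" "Q = R' `` {B}" by (rule quotientE)
      then obtain A :: "int \<times> 'g \<Rightarrow> 'f mat set" and \<psi> where A: "compatible A"
        and \<psi>: "algebra_automorphism U \<psi>" "\<forall>g. \<psi> ` B g = restrict_coarsen n A g"
        using restrict_surj[of B] by (auto simp: gradings_def)
      have "(B, restrict_coarsen n A) \<in> R'"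
        using B(1) restr[OF A] \<psi> by (auto simp: R'_def grading_iso_def)
      then have "Q = R' `` {restrict_coarsen n A}" unfolding B(2) by (rule equiv_class_eq[OF eqR'])
      then show "Q \<in> \<Phi> ` admissible_classes ns" unfolding classes using \<Phi>[OF A] A by blast
    qed
  qed
  then show ?thesis
    unfolding UT adm R_def[symmetric] R'_def[symmetric] using restr \<Phi> by blast
qed

end
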